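(* Let $N$ be an even positive integer, $h=2\pi/N$, and for $\varepsilon>0$ consider the system $$\frac{dU_k}{d\tau}+\frac{U_k(U_{k+1}-U_{k-1})}{2h\,\varepsilon}=\frac{U_{k+1}-2U_k+U_{k-1}}{h^2},\qquad k=1,\dots,N,\qquad(\mathrm{S}_\varepsilon)$$ with periodic convention $U_{k+N}=U_k$. Let an initial condition $U^0\in(0,\infty)^N$ be given (alternatively, let initial conditions $U^0_\varepsilon$, depending on $\varepsilon$, be given in a fixed compact subset of $(0,\infty)^N$). Let $T>0$ be fixed, and denote by $U_\varepsilon(\tau)$, $\tau\in[0,T]$, the solution of $(\mathrm{S}_\varepsilon)$ with this initial condition. Then there exists a sequence $\varepsilon_i\to 0$ such that $U_{\varepsilon_i}(\cdot)$ converges as $i\to\infty$, in the sense of Young measures on $[0,T]$, to a Young measure $\mu_0(\tau)$, $\tau\in[0,T]$. Moreover, for almost every $\tau\in[0,T]$ the measure $\mu_0(\tau)$ is an invariant measure of the fast equation $$\frac{dU_k}{d\sigma}+U_k(U_{k+1}-U_{k-1})=0,\qquad k=1,\dots,N,\quad U_{k+N}=U_k .$$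
   Context: A Young measure on $[0,T]$ (with values in $\mathbb{R}^N$) is a measurable map $\tau\mapsto\mu(\tau)$ from $[0,T]$ to probability measures on $\mathbb{R}^N$; it is identified with the measure $\mu(\tau)(dU)\,d\tau$ on $[0,T]\times\mathbb{R}^N$. A function $U:[0,T]\to\mathbb{R}^N$ is viewed as the Young measure $\tau\mapsto\delta_{U(\tau)}$ (Dirac measures). Convergence in the sense of Young measures is weak convergence of the associated measures on $[0,T]\times\mathbb{R}^N$, i.e. $\int_0^T\int_{\mathbb{R}^N} f(\tau,U)\,\mu_i(\tau)(dU)\,d\tau\to\int_0^T\int_{\mathbb{R}^N} f(\tau,U)\,\mu_0(\tau)(dU)\,d\tau$ for all bounded continuous $f$. The fast equation is considered for initial data in the open positive orthant $(0,\infty)^N$, which is invariant and on which its solutions exist for all time; a probability measure $\mu$ on $\mathbb{R}^N$ is an invariant measure of the fast equation if it is concentrated on $(0,\infty)^N$ and is invariant under the flow of the fast equation there. *)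

theory Defs
  imports "HOL-Probability.Probability" "HOL-Library.Numeral_Type"
begin

text \<open>
  The type \<open>'m bit0\<close> is the ring of integers modulo \<open>N = CARD('m bit0) = 2 * CARD('m)\<close>.  With it
  as index type, \<open>k + 1\<close> and \<open>k - 1\<close> are taken modulo \<open>N\<close>, which is the periodic convention
  \<open>U\<^sub>k\<^sub>+\<^sub>N = U\<^sub>k\<close> (the index \<open>N\<close> is \<open>0\<close>).  As \<open>'m\<close> ranges over all finite types, \<open>N\<close> ranges over
  exactly the even positive integers.
\<close>

type_synonym 'm state = "(real, 'm bit0) vec"

definition pos_orthant :: "('m::finite) state set" where
  "pos_orthant = {V. \<forall>k. V $ k > 0}"

definition mesh :: "'m::finite itself \<Rightarrow> real" where
  "mesh _ = 2 * pi / real CARD('m bit0)"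

definition slow_field :: "real \<Rightarrow> ('m::finite) state \<Rightarrow> 'm state" where
  "slow_field \<epsilon> V = (let h = mesh TYPE('m) in
     \<chi> k. (V $ (k + 1) - 2 * V $ k + V $ (k - 1)) / h\<^sup>2
          - V $ k * (V $ (k + 1) - V $ (k - 1)) / (2 * h * \<epsilon>))"

definition fast_field :: "('m::finite) state \<Rightarrow> 'm state" where
  "fast_field V = (\<chi> k. - (V $ k * (V $ (k + 1) - V $ (k - 1))))"

definition solves_ode_on ::
    "('a::real_normed_vector \<Rightarrow> 'a) \<Rightarrow> real set \<Rightarrow> (real \<Rightarrow> 'a) \<Rightarrow> bool" where
  "solves_ode_on F I u \<longleftrightarrow> (\<forall>t\<in>I. (u has_vector_derivative F (u t)) (at t within I))"

text \<open>
  The flow is used only on \<open>pos_orthant\<close>, where the solution of the fast equation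
  exists on the whole real line and is unique.
\<close>

definition fast_flow :: "real \<Rightarrow> ('m::finite) state \<Rightarrow> 'm state" where
  "fast_flow \<sigma> V = (THE W. \<exists>u. solves_ode_on fast_field UNIV u \<and> u 0 = V \<and> u \<sigma> = W)"

definition fast_invariant_measure :: "('m::finite) state measure \<Rightarrow> bool" where
  "fast_invariant_measure \<mu> \<longleftrightarrow>
     prob_space \<mu> \<and> sets \<mu> = sets borel \<and>
     (AE V in \<mu>. V \<in> pos_orthant) \<and>
     (\<forall>\<sigma>. \<forall>A\<in>sets borel. A \<subseteq> pos_orthant \<longrightarrow>
        emeasure \<mu> {V \<in> pos_orthant. fast_flow \<sigma> V \<in> A} = emeasure \<mu> A)"

definition young_measure :: "real \<Rightarrow> (real \<Rightarrow> 'a::euclidean_space measure) \<Rightarrow> bool" where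
  "young_measure T \<mu> \<longleftrightarrow> \<mu> \<in> restrict_space lborel {0..T} \<rightarrow>\<^sub>M prob_algebra borel"

definition dirac_young :: "(real \<Rightarrow> 'a::euclidean_space) \<Rightarrow> real \<Rightarrow> 'a measure" where
  "dirac_young u = (\<lambda>\<tau>. return borel (u \<tau>))"

definition young_tendsto ::
    "real \<Rightarrow> (nat \<Rightarrow> real \<Rightarrow> 'a::euclidean_space measure) \<Rightarrow> (real \<Rightarrow> 'a measure) \<Rightarrow> bool" where
  "young_tendsto T \<mu> \<mu>\<^sub>0 \<longleftrightarrow>
     (\<forall>f :: real \<times> 'a \<Rightarrow> real.
        continuous_on ({0..T} \<times> UNIV) f \<and> bounded (f ` ({0..T} \<times> UNIV)) \<longrightarrow>
        (\<lambda>i. LINT \<tau>:{0..T}|lborel. LINT V|\<mu> i \<tau>. f (\<tau>, V))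
          \<longlonglongrightarrow> (LINT \<tau>:{0..T}|lborel. LINT V|\<mu>\<^sub>0 \<tau>. f (\<tau>, V)))"

end

theory Submission
  imports Defs "HOL-Complex_Analysis.Great_Picard"
begin

text \<open>
  The slow system conserves \<open>\<Sum> U\<^sub>k\<close> and does not decrease \<open>\<Prod> U\<^sub>k\<close>, so all solutions stay in one
  compact subset of the open orthant. There, for binary codes \<open>c\<^sub>n\<close> of finer and finer
  partitions, the indicators of \<open>c\<^sub>n (U\<^sub>\<epsilon> \<tau>) = j\<close> converge weakly-* along a subsequence to densities
  \<open>p\<^sub>n\<^sub>,\<^sub>j \<tau>\<close>. Cutting \<open>[0,1)\<close> into consecutive intervals of these lengths assigns to each \<open>y\<close> a nested
  sequence of cells, hence a point \<open>X (\<tau>, y)\<close>, and \<open>\<mu>\<^sub>0 \<tau>\<close> is the law of \<open>X (\<tau>, \<cdot>)\<close> for uniform \<open>y\<close>;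
  neither a representation theorem nor a disintegration is needed.

  For the invariance, a slow solution follows the fast flow \<open>\<Phi>\<close> with error \<open>O(\<epsilon>)\<close> during a slow time
  of order \<open>\<epsilon>\<close>. Hence time averages of \<open>g \<circ> \<Phi>\<^sub>\<sigma>\<close> and of \<open>g\<close> along \<open>U\<^sub>\<epsilon>\<close> differ by \<open>O(\<epsilon>)\<close>, and in the
  limit \<open>\<integral> g \<circ> \<Phi>\<^sub>\<sigma> d\<mu>\<^sub>0(\<tau>) = \<integral> g d\<mu>\<^sub>0(\<tau>)\<close> for almost every \<open>\<tau>\<close>, simultaneously for countably many \<open>g\<close>
  that determine a measure and for rational \<open>\<sigma>\<close>.
\<close>

section \<open>Ordinary differential equations\<close>

text \<open>The limit must be concentrated on the open orthant, so the solutions have to stay away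
  from its boundary uniformly in \<epsilon>, although the advection carries the factor 1/\<epsilon>.
  This works because the fast field conserves both the sum of U_k and the sum of ln U_k: the
  singular term drops out of both balances. Diffusion conserves the first sum and, by x/y + y/x >=
  2, does not decrease the second. An upper bound on the sum together with a positive lower bound on
  the product describes a compact subset of the open orthant.

  Cells are coded in binary so that cell j of one level splits into the neighbours 2j and 2j + 1 of
  the next. Partial sums of the densities then agree across levels, which is what makes the
  intervals in [0,1) nested.

  A fast time \<sigma> costs the slow time 2 h \<epsilon> \<sigma>. After rescaling, the Gronwall
  exponent is free of \<epsilon> and only the diffusive perturbation is proportional to it. The
  resulting error is a distance between states, so the test functions are chosen Lipschitz.\<close>

lemma vector_derivative_nonneg_mono:
  fixes f :: "real \<Rightarrow> real"
  assumes "a \<le> b"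
    and "\<And>t. t \<in> {a..b} \<Longrightarrow> (f has_vector_derivative f' t) (at t within {a..b})"
    and "\<And>t. t \<in> {a..b} \<Longrightarrow> 0 \<le> f' t"
  shows "f a \<le> f b"
proof -
  have "\<exists>x\<in>{a..b}. f b - f a = (\<lambda>h. h *\<^sub>R f' x) (b - a)"
    by (rule mvt_very_simple[OF assms(1)])
       (use assms(2) in \<open>auto simp: has_vector_derivative_def\<close>)
  then show ?thesis
    using assms(1,3) by (metis diff_ge_0_iff_ge mult_nonneg_nonneg real_scaleR_def)
qed

lemma vector_derivative_zero_const:
  fixes f :: "real \<Rightarrow> real"
  assumes "a \<le> b"
    and "\<And>t. t \<in> {a..b} \<Longrightarrow> (f has_vector_derivative 0) (at t within {a..b})"
  shows "f a = f b"
proof (rule antisym)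
  show "f a \<le> f b"
    by (rule vector_derivative_nonneg_mono[OF assms(1,2)]) auto
  have "- f a \<le> - f b"
    by (rule vector_derivative_nonneg_mono[OF assms(1), where f' = "\<lambda>_. 0"])
       (use has_vector_derivative_minus[OF assms(2)] in auto)
  then show "f b \<le> f a" by simp
qed

text \<open>The square of the norm is differentiable also where \<open>w\<close> vanishes. The
  inhomogeneity is absorbed by 2 |w| \<delta> \<le> |w|^2 + \<delta>^2, which accounts for the
  \<open>+ 1\<close> in the exponent: (|w|^2 + \<delta>^2) exp (- (2 L + 1) t) is
  nonincreasing.\<close>

lemma gronwall_norm_square:
  fixes w :: "real \<Rightarrow> 'a::real_inner"
  assumes "0 \<le> b" "0 \<le> L" "0 \<le> \<delta>"
    and der: "\<And>t. t \<in> {0..b} \<Longrightarrow> (w has_vector_derivative w' t) (at t within {0..b})"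
    and bound: "\<And>t. t \<in> {0..b} \<Longrightarrow> norm (w' t) \<le> L * norm (w t) + \<delta>"
  shows "(norm (w b))\<^sup>2 \<le> ((norm (w 0))\<^sup>2 + \<delta>\<^sup>2) * exp ((2 * L + 1) * b)"
proof -
  define M where "M = 2 * L + 1"
  let ?f = "\<lambda>t. - ((w t \<bullet> w t + \<delta>\<^sup>2) * exp (- M * t))"
  let ?f' = "\<lambda>t. (M * (w t \<bullet> w t + \<delta>\<^sup>2) - 2 * (w t \<bullet> w' t)) * exp (- M * t)"
  have "?f 0 \<le> ?f b"
  proof (rule vector_derivative_nonneg_mono[OF assms(1), where f' = ?f'])
    fix t assume t: "t \<in> {0..b}"
    have 1: "((\<lambda>t. w t \<bullet> w t) has_vector_derivative (w t \<bullet> w' t + w' t \<bullet> w t)) (at t within {0..b})"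
      by (rule bounded_bilinear.has_vector_derivative[OF bounded_bilinear_inner der[OF t] der[OF t]])
    have 2: "((\<lambda>t. exp (- M * t)) has_vector_derivative (- M * exp (- M * t))) (at t within {0..b})"
      unfolding has_real_derivative_iff_has_vector_derivative[symmetric]
      by (auto intro!: derivative_eq_intros)
    have 3: "((\<lambda>t. w t \<bullet> w t + \<delta>\<^sup>2) has_vector_derivative (w t \<bullet> w' t + w' t \<bullet> w t)) (at t within {0..b})"
      using has_vector_derivative_add[OF 1 has_vector_derivative_const] by simp
    show "(?f has_vector_derivative ?f' t) (at t within {0..b})"
      by (rule has_vector_derivative_eq_rhs[OF has_vector_derivative_minus[OF
            bounded_bilinear.has_vector_derivative[OF bounded_bilinear_mult 3 2]]])
         (simp add: algebra_simps inner_commute)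
    have "w t \<bullet> w' t \<le> norm (w t) * norm (w' t)" by (rule norm_cauchy_schwarz)
    also have "\<dots> \<le> norm (w t) * (L * norm (w t) + \<delta>)"
      by (intro mult_left_mono bound t) auto
    also have "\<dots> = L * (norm (w t))\<^sup>2 + norm (w t) * \<delta>" by (simp add: algebra_simps power2_eq_square)
    finally have "2 * (w t \<bullet> w' t) \<le> 2 * L * (norm (w t))\<^sup>2 + 2 * norm (w t) * \<delta>" by simp
    moreover have "2 * norm (w t) * \<delta> \<le> (norm (w t))\<^sup>2 + \<delta>\<^sup>2"
      by (rule sum_squares_bound)
    moreover have "0 \<le> 2 * L * \<delta>\<^sup>2" using assms by simp
    ultimately have "2 * (w t \<bullet> w' t) \<le> M * (w t \<bullet> w t + \<delta>\<^sup>2)"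
      unfolding M_def power2_norm_eq_inner[symmetric] by (simp add: algebra_simps)
    then show "0 \<le> ?f' t" by simp
  qed
  then have "(w b \<bullet> w b + \<delta>\<^sup>2) * exp (- M * b) \<le> w 0 \<bullet> w 0 + \<delta>\<^sup>2" by simp
  then have "w b \<bullet> w b + \<delta>\<^sup>2 \<le> (w 0 \<bullet> w 0 + \<delta>\<^sup>2) * exp (M * b)"
    by (simp add: exp_minus field_simps)
  moreover have "0 \<le> \<delta>\<^sup>2" by simp
  ultimately show ?thesis
    unfolding M_def power2_norm_eq_inner by linarith
qed

lemma solves_ode_on_subset:
  "solves_ode_on F I u \<Longrightarrow> J \<subseteq> I \<Longrightarrow> solves_ode_on F J u"
  unfolding solves_ode_on_def using has_vector_derivative_within_subset by blast

lemma solves_ode_on_shift: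
  assumes "solves_ode_on F UNIV u"
  shows "solves_ode_on F UNIV (\<lambda>t. u (t + s))"
  unfolding solves_ode_on_def
proof
  fix t
  have "(u has_vector_derivative F (u (t + s))) (at (t + s))"
    using assms unfolding solves_ode_on_def by auto
  moreover have "((\<lambda>t. t + s) has_vector_derivative 1) (at t)"
    by (auto intro!: derivative_eq_intros)
  ultimately show "((\<lambda>t. u (t + s)) has_vector_derivative F (u (t + s))) (at t)"
    using vector_diff_chain_at[of "\<lambda>t. t + s" 1 t u "F (u (t + s))"] by (simp add: o_def)
qed

lemma solves_ode_on_reverse:
  assumes "solves_ode_on F I u"
  shows "solves_ode_on (\<lambda>x. - F x) (uminus ` I) (\<lambda>t. u (- t))"
  unfolding solves_ode_on_def
proof
  fix t assume "t \<in> uminus ` I"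
  then have t: "- t \<in> I" by auto
  have "(u has_vector_derivative F (u (- t))) (at (- t) within uminus ` (uminus ` I))"
    using assms t unfolding solves_ode_on_def by (simp add: image_image)
  moreover have "((\<lambda>t. - t) has_vector_derivative - 1) (at t within uminus ` I)"
    by (auto intro!: derivative_eq_intros)
  ultimately show "((\<lambda>t. u (- t)) has_vector_derivative - F (u (- t))) (at t within uminus ` I)"
    using vector_diff_chain_within[of "\<lambda>t. - t" "- 1" t "uminus ` I" u "F (u (- t))"]
    by (simp add: o_def)
qed

lemma has_integral_exp_mult:
  fixes c t :: real
  assumes "0 < c" "0 \<le> t"
  shows "((\<lambda>s. exp (c * s)) has_integral (exp (c * t) - 1) / c) {0..t}"
proof -
  have "((\<lambda>s. exp (c * s)) has_integral (exp (c * t) / c - exp (c * 0) / c)) {0..t}"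
    by (rule fundamental_theorem_of_calculus)
       (use assms in \<open>auto intro!: derivative_eq_intros simp: has_real_derivative_iff_has_vector_derivative[symmetric]\<close>)
  then show ?thesis by (simp add: diff_divide_distrib)
qed

text \<open>Picard iteration is a contraction for the weighted norm \<open>sup\<^sub>t e\<^sup>-\<^sup>2\<^sup>L\<^sup>t |x t|\<close>,
  which gives the solution on the whole half-line at once.\<close>

lemma lipschitz_ode_forward_exists:
  fixes G :: "'a::euclidean_space \<Rightarrow> 'a"
  assumes "0 < L" and lip: "\<And>x y. norm (G x - G y) \<le> L * norm (x - y)"
    and bnd: "\<And>x. norm (G x) \<le> B"
  shows "\<exists>u. solves_ode_on G {0..} u \<and> u 0 = V"
proof -
  have contG: "continuous_on UNIV G"
    by (rule lipschitz_on_continuous_on[of L])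
       (use assms in \<open>auto simp: lipschitz_on_def dist_norm\<close>)
  \<comment> \<open>The unknown is y t = exp (- 2 L t) u t, so that the plain sup norm of
    \<open>y\<close> is the weighted norm of the solution u.\<close>
  define g where "g = (\<lambda>y s. G (exp (2 * L * s) *\<^sub>R (apply_bcontfun y s)))" for y :: "real \<Rightarrow>\<^sub>C 'a"
  have contg: "continuous_on A (g y)" for y A
    unfolding g_def
    by (intro continuous_on_compose2[OF contG] continuous_intros continuous_on_apply_bcontfun) auto
  have intg: "g y integrable_on {0..t}" for y t
    by (intro integrable_continuous_interval contg)
  \<comment> \<open>Elements of \<open>bcontfun\<close> live on the whole real line;
    \<open>max 0 t\<close> freezes the iterate at its initial value for negative times.\<close>
  define P where "P = (\<lambda>y t. exp (- (2 * L) * max 0 t) *\<^sub>R (V + integral {0..max 0 t} (g y)))"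
  have cont_int: "continuous_on UNIV (\<lambda>t. integral {0..max 0 t} (g y))" for y
  proof -
    have "continuous_on {0..} (\<lambda>t. integral {0..t} (g y))"
      unfolding continuous_on_eq_continuous_within
    proof
      fix t :: real assume t: "t \<in> {0..}"
      have "continuous_on {0..t+1} (\<lambda>t. integral {0..t} (g y))"
        by (rule indefinite_integral_continuous_1[OF intg])
      then have c: "continuous (at t within {0..t+1}) (\<lambda>t. integral {0..t} (g y))"
        using t by (auto simp: continuous_on_eq_continuous_within)
      have "at t within {0..t+1} = at t within {0..}"
        by (rule at_within_nhd[of _ "{..<t+1}"]) auto
      then show "continuous (at t within {0..}) (\<lambda>t. integral {0..t} (g y))"
        using c by (simp add: continuous_within)
    qed
    then show ?thesis
      by (rule continuous_on_compose2[where f = "\<lambda>t. max 0 t"]) (auto intro!: continuous_intros)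
  qed
  have Pcont: "continuous_on UNIV (P y)" for y
    unfolding P_def by (intro continuous_intros cont_int)
  have B0: "0 \<le> B" using bnd[of 0] norm_ge_zero order_trans by blast
  have Pbound: "norm (P y t) \<le> norm V + B / (2 * L)" for y and t :: real
  proof -
    let ?t = "max 0 t"
    have "norm (integral {0..?t} (g y)) \<le> B * (?t - 0)"
      by (rule integral_bound[OF _ contg]) (auto simp: g_def bnd)
    then have "norm (V + integral {0..?t} (g y)) \<le> norm V + B * ?t"
      using norm_triangle_ineq[of V "integral {0..?t} (g y)"] by simp
    then have "norm (P y t) \<le> exp (- (2 * L) * ?t) * (norm V + B * ?t)"
      unfolding P_def by simp
    also have "\<dots> = exp (- (2 * L) * ?t) * norm V + B * (?t * exp (- (2 * L) * ?t))"
      by (simp add: algebra_simps)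
    also have "\<dots> \<le> 1 * norm V + B * (1 / (2 * L))"
    proof (intro add_mono mult_left_mono mult_right_mono B0)
      show "exp (- (2 * L) * ?t) \<le> 1" using \<open>0 < L\<close> by simp
      have "2 * L * ?t \<le> exp (2 * L * ?t)" using exp_ge_add_one_self[of "2 * L * ?t"] by linarith
      then show "?t * exp (- (2 * L) * ?t) \<le> 1 / (2 * L)"
        using \<open>0 < L\<close> by (simp add: exp_minus field_simps)
    qed auto
    finally show ?thesis by simp
  qed
  have Pb: "P y \<in> bcontfun" for y by (rule bcontfun_normI[OF Pcont Pbound])
  define Q where "Q y = Bcontfun (P y)" for y
  have Q: "apply_bcontfun (Q y) = P y" for y
    unfolding Q_def using Pb by (simp add: Bcontfun_inverse)
  \<comment> \<open>The weight exponent 2 L yields the factor 1/2: the integral of L exp (2 L s)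
    over [0,t] is at most exp (2 L t) / 2.\<close>
  have contr: "dist (Q y) (Q z) \<le> (1/2) * dist y z" for y z
  proof (rule dist_bound)
    fix t :: real
    let ?t = "max 0 t"
    have "norm (integral {0..?t} (\<lambda>s. g y s - g z s)) \<le> integral {0..?t} (\<lambda>s. L * dist y z * exp (2 * L * s))"
    proof (rule integral_norm_bound_integral)
      show "(\<lambda>s. g y s - g z s) integrable_on {0..?t}"
        by (intro integrable_diff intg)
      show "(\<lambda>s. L * dist y z * exp (2 * L * s)) integrable_on {0..?t}"
        by (intro integrable_continuous_interval continuous_intros)
      fix s
      have "norm (g y s - g z s) \<le> L * norm (exp (2 * L * s) *\<^sub>R y s - exp (2 * L * s) *\<^sub>R z s)"
        unfolding g_def by (rule lip)
      also have "\<dots> = L * (exp (2 * L * s) * dist (y s) (z s))"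
        by (simp add: scaleR_diff_right[symmetric] dist_norm)
      also have "\<dots> \<le> L * (exp (2 * L * s) * dist y z)"
        using \<open>0 < L\<close> dist_bounded[of y s z] by simp
      finally show "norm (g y s - g z s) \<le> L * dist y z * exp (2 * L * s)" by (simp add: mult_ac)
    qed
    also have "\<dots> = L * dist y z * ((exp (2 * L * ?t) - 1) / (2 * L))"
      using integral_unique[OF has_integral_exp_mult[of "2 * L" ?t]] \<open>0 < L\<close> by simp
    also have "\<dots> \<le> (1/2) * dist y z * exp (2 * L * ?t)"
      using \<open>0 < L\<close> by (simp add: field_simps)
    finally have *: "norm (integral {0..?t} (g y) - integral {0..?t} (g z)) \<le> (1/2) * dist y z * exp (2 * L * ?t)"
      by (simp add: integral_diff[OF intg intg])
    have "dist (Q y t) (Q z t) = exp (- (2 * L) * ?t) * norm (integral {0..?t} (g y) - integral {0..?t} (g z))"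
      unfolding Q P_def dist_norm scaleR_diff_right[symmetric] by simp
    also have "\<dots> \<le> exp (- (2 * L) * ?t) * ((1/2) * dist y z * exp (2 * L * ?t))"
      by (intro mult_left_mono *) auto
    also have "\<dots> = (1/2) * dist y z" by (simp add: exp_minus)
    finally show "dist (Q y t) (Q z t) \<le> (1/2) * dist y z" .
  qed
  have "\<exists>!y. Q y = y"
    by (rule banach_fix_type[of "1/2"]) (use contr in simp_all)
  then obtain y where "Q y = y" by auto
  then have y: "P y t = y t" for t using Q by metis
  define u where "u t = V + integral {0..t} (g y)" for t
  have ue: "u t = exp (2 * L * t) *\<^sub>R y t" if "0 \<le> t" for t
    using y[of t, symmetric] that unfolding P_def u_def by (simp add: exp_minus)
  have "(u has_vector_derivative G (u t)) (at t within {0..})" if t: "0 \<le> t" for t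
  proof -
    have "((\<lambda>t. integral {0..t} (g y)) has_vector_derivative g y t) (at t within {0..t+1})"
      by (rule integral_has_vector_derivative[OF contg]) (use t in auto)
    then have "(u has_vector_derivative g y t) (at t within {0..t+1})"
      unfolding u_def using has_vector_derivative_add[OF has_vector_derivative_const] by fastforce
    moreover have "at t within {0..t+1} = at t within {0..}"
      by (rule at_within_nhd[of _ "{..<t+1}"]) auto
    moreover have "g y t = G (u t)" unfolding g_def ue[OF t] ..
    ultimately show ?thesis by simp
  qed
  then have "solves_ode_on G {0..} u" unfolding solves_ode_on_def by auto
  moreover have "u 0 = V" unfolding u_def by simp
  ultimately show ?thesis by blast
qed

text \<open>A forward solution for \<open>G\<close> is glued at time 0 to a forward solution for - G
  run backwards. Both one-sided derivatives at 0 equal G V, so the glued function is differentiable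
  there.\<close>

lemma lipschitz_ode_exists:
  fixes G :: "'a::euclidean_space \<Rightarrow> 'a"
  assumes "0 < L" and lip: "\<And>x y. norm (G x - G y) \<le> L * norm (x - y)"
    and bnd: "\<And>x. norm (G x) \<le> B"
  shows "\<exists>u. solves_ode_on G UNIV u \<and> u 0 = V"
proof -
  obtain u1 where u1: "solves_ode_on G {0..} u1" "u1 0 = V"
    using lipschitz_ode_forward_exists[OF assms] by blast
  have "norm (- G x - - G y) \<le> L * norm (x - y)" for x y
    using lip[of y x] by (simp add: norm_minus_commute)
  then obtain u2 where u2: "solves_ode_on (\<lambda>x. - G x) {0..} u2" "u2 0 = V"
    using lipschitz_ode_forward_exists[of L "\<lambda>x. - G x" B V] assms by auto
  have u3: "solves_ode_on G {..0} (\<lambda>t. u2 (- t))"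
    using solves_ode_on_reverse[OF u2(1)] by simp
  define u where "u t = (if t \<in> {..0} then u2 (- t) else u1 t)" for t
  have "(u has_vector_derivative G (u t)) (at t)" for t
  proof -
    have "((\<lambda>t. if t \<in> {..0} then u2 (- t) else u1 t) has_vector_derivative
        (if t \<in> {..0} then G (u2 (- t)) else G (u1 t))) (at t within UNIV)"
    proof (rule has_vector_derivative_If_within_closures)
      have e1: "{..0::real} \<union> closure {..0} \<inter> closure {0<..} = {..0}" by auto
      have e2: "{0::real<..} \<union> closure {..0} \<inter> closure {0<..} = {0..}" by auto
      show "((\<lambda>t. u2 (- t)) has_vector_derivative G (u2 (- t)))
        (at t within {..0} \<union> closure {..0} \<inter> closure {0<..})" 
        if "t \<in> {..0} \<union> closure {..0} \<inter> closure {0<..}"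
        using u3 that unfolding e1 solves_ode_on_def by auto
      show "(u1 has_vector_derivative G (u1 t))
        (at t within {0<..} \<union> closure {..0} \<inter> closure {0<..})" 
        if "t \<in> {0<..} \<union> closure {..0} \<inter> closure {0<..}"
        using u1 that unfolding e2 solves_ode_on_def by auto
    qed (use u1 u2 in auto)
    then show ?thesis unfolding u_def by (simp add: if_distrib)
  qed
  then have "solves_ode_on G UNIV u" unfolding solves_ode_on_def by auto
  moreover have "u 0 = V" unfolding u_def using u2 by simp
  ultimately show ?thesis by blast
qed

section \<open>The flow of the fast equation\<close>

lemma has_vector_derivative_vec_iff:
  fixes u :: "real \<Rightarrow> real ^ 'n"
  shows "(u has_vector_derivative D) (at t within S) \<longleftrightarrow>
    (\<forall>k. ((\<lambda>t. u t $ k) has_vector_derivative D $ k) (at t within S))"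
proof
  assume "(u has_vector_derivative D) (at t within S)"
  then show "\<forall>k. ((\<lambda>t. u t $ k) has_vector_derivative D $ k) (at t within S)"
    by (auto intro!: bounded_linear.has_vector_derivative[OF bounded_linear_vec_nth])
next
  assume *: "\<forall>k. ((\<lambda>t. u t $ k) has_vector_derivative D $ k) (at t within S)"
  have "((\<lambda>t. \<Sum>k\<in>UNIV. u t $ k *\<^sub>R axis k (1::real)) has_vector_derivative
      (\<Sum>k\<in>UNIV. D $ k *\<^sub>R axis k 1)) (at t within S)"
    by (intro has_vector_derivative_sum bounded_linear.has_vector_derivative[OF bounded_linear_scaleR_left])
       (use * in auto)
  moreover have "(\<Sum>k\<in>UNIV. v $ k *\<^sub>R axis k (1::real)) = v" for v :: "real ^ 'n"
    using basis_expansion[of v] by (simp add: scalar_mult_eq_scaleR)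
  ultimately show "(u has_vector_derivative D) (at t within S)" by simp
qed

lemma sum_bit0_shift:
  "(\<Sum>k\<in>UNIV. f (k + 1)) = (\<Sum>k\<in>UNIV. f (k :: ('m::finite) bit0))"
  "(\<Sum>k\<in>UNIV. f (k - 1)) = (\<Sum>k\<in>UNIV. f (k :: ('m::finite) bit0))"
  by (rule sum.reindex_bij_witness[of _ "\<lambda>k. k - 1" "\<lambda>k. k + 1"]; simp)
     (rule sum.reindex_bij_witness[of _ "\<lambda>k. k + 1" "\<lambda>k. k - 1"]; simp)

text \<open>Summation by parts: the central difference is skew-symmetric on the cycle. With f = U
  this is conservation of mass; with the truncated exponential of ln U it is the conservation law
  behind global existence of the fast flow.\<close>

lemma sum_mult_central_difference:
  fixes f :: "('m::finite) bit0 \<Rightarrow> real"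
  shows "(\<Sum>k\<in>UNIV. f k * (f (k + 1) - f (k - 1))) = 0"
  using sum_bit0_shift(1)[of "\<lambda>k. f k * f (k - 1)"]
  by (simp add: right_diff_distrib sum_subtractf mult.commute)

lemma norm_vec_le_card:
  fixes x :: "real ^ 'n"
  assumes "\<And>k. \<bar>x $ k\<bar> \<le> c"
  shows "norm x \<le> real CARD('n) * c"
proof -
  have "norm x \<le> (\<Sum>k\<in>UNIV. \<bar>x $ k\<bar>)" by (rule norm_le_l1_cart)
  also have "\<dots> \<le> real CARD('n) * c" using sum_bounded_above[of UNIV "\<lambda>k. \<bar>x $ k\<bar>" c] assms by simp
  finally show ?thesis .
qed

text \<open>The field is quadratic, hence Lipschitz only on boxes. Splitting a b - a' b' into (a -
  a') b + a' (b - b') gives 2 R twice per component, and bounding the Euclidean norm by the sum of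
  the components gives the factor \<open>CARD('m bit0)\<close>. This constant reappears in all later
  exponents.\<close>

lemma fast_field_lipschitz:
  fixes V W :: "('m::finite) state"
  assumes V: "\<And>k. \<bar>V $ k\<bar> \<le> R" and W: "\<And>k. \<bar>W $ k\<bar> \<le> R"
  shows "norm (fast_field V - fast_field W) \<le> (real CARD('m bit0) * (4 * R)) * norm (V - W)"
proof -
  have d: "\<bar>V $ k - W $ k\<bar> \<le> norm (V - W)" for k
    using component_le_norm_cart[of "V - W" k] by simp
  have "\<bar>(fast_field V - fast_field W) $ k\<bar> \<le> 4 * R * norm (V - W)" for k
  proof -
    have "(fast_field V - fast_field W) $ k =
      - ((V $ k - W $ k) * (V $ (k+1) - V $ (k-1)) + W $ k * ((V $ (k+1) - W $ (k+1)) - (V $ (k-1) - W $ (k-1))))"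
      unfolding fast_field_def by (simp add: algebra_simps)
    also have "\<bar>\<dots>\<bar> \<le> \<bar>V $ k - W $ k\<bar> * \<bar>V $ (k+1) - V $ (k-1)\<bar>
        + \<bar>W $ k\<bar> * \<bar>(V $ (k+1) - W $ (k+1)) - (V $ (k-1) - W $ (k-1))\<bar>"
      unfolding abs_minus_cancel abs_mult[symmetric] by (rule abs_triangle_ineq)
    also have "\<dots> \<le> norm (V - W) * (2 * R) + R * (2 * norm (V - W))"
    proof (intro add_mono mult_mono)
      show "\<bar>V $ (k+1) - V $ (k-1)\<bar> \<le> 2 * R" using V[of "k+1"] V[of "k-1"] by linarith
      show "\<bar>(V $ (k+1) - W $ (k+1)) - (V $ (k-1) - W $ (k-1))\<bar> \<le> 2 * norm (V - W)"
        using d[of "k+1"] d[of "k-1"] by linarith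
      show "0 \<le> R" using V[of k] by linarith
    qed (use d W in auto)
    finally show ?thesis by simp
  qed
  from norm_vec_le_card[OF this] show ?thesis by simp
qed

text \<open>In the variables \<open>x = ln U\<close> the fast equation reads
  \<open>x\<^sub>k' = - (\<phi> x\<^sub>k\<^sub>+\<^sub>1 - \<phi> x\<^sub>k\<^sub>-\<^sub>1)\<close> with \<open>\<phi> = exp\<close>. For the truncation \<open>\<phi> = min exp S\<close> the field is
  globally Lipschitz and \<open>\<Sum> \<Psi> x\<^sub>k\<close> with \<open>\<Psi>' = \<phi>\<close> is conserved, which shows
  that the truncation is never felt if \<open>S\<close> exceeds the total mass.\<close>

lemma fast_solution_exists:
  fixes V :: "('m::finite) state"
  assumes V: "V \<in> pos_orthant"
  shows "\<exists>u. solves_ode_on fast_field UNIV u \<and> u 0 = V \<and>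
     (\<forall>t. u t \<in> pos_orthant \<and> (\<Sum>k\<in>UNIV. u t $ k) = (\<Sum>k\<in>UNIV. V $ k))"
proof -
  have Vpos: "V $ k > 0" for k using V unfolding pos_orthant_def by auto
  \<comment> \<open>The summand 1 keeps the truncation level strictly above the conserved
    mass.\<close>
  define S where "S = (\<Sum>k\<in>UNIV. V $ k) + 1"
  have VS: "V $ k < S" for k
  proof -
    have "V $ k \<le> (\<Sum>k\<in>UNIV. V $ k)"
      by (rule member_le_sum) (use Vpos less_imp_le in auto)
    then show ?thesis unfolding S_def by simp
  qed
  have S0: "S > 0" using VS Vpos less_trans by blast
  define \<phi> where "\<phi> y = exp (min y (ln S))" for y :: real
  \<comment> \<open>The exponential, continued beyond ln S by its tangent line; this is a primitive
    of \<open>\<phi>\<close>, and both pieces are nonnegative.\<close>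
  define \<Psi> where "\<Psi> y = (if y \<in> {..ln S} then exp y else S + S * (y - ln S))" for y :: real
  have \<phi>_pos: "0 < \<phi> y" and \<phi>_le: "\<phi> y \<le> S" for y
  proof -
    show "0 < \<phi> y" by (simp add: \<phi>_def)
    have "exp (min y (ln S)) \<le> exp (ln S)" by simp
    then show "\<phi> y \<le> S" using S0 by (simp add: \<phi>_def)
  qed
  have \<phi>_lip1: "\<bar>\<phi> y - \<phi> z\<bar> \<le> S * \<bar>y - z\<bar>" if "y \<le> z" for y z
  proof -
    define a b where "a = min y (ln S)" and "b = min z (ln S)"
    have ab: "a \<le> b" "b - a \<le> z - y" using that unfolding a_def b_def by linarith+
    have "exp b - exp a = exp b * (1 - exp (a - b))" by (simp add: algebra_simps exp_diff)
    also have "\<dots> \<le> exp b * (b - a)"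
      using exp_ge_add_one_self[of "a - b"] by (intro mult_left_mono) (linarith, simp)
    also have "\<dots> \<le> S * (z - y)"
      using \<phi>_le[of z] ab by (intro mult_mono) (auto simp: \<phi>_def b_def S0 less_imp_le)
    finally show ?thesis using that ab(1) by (simp add: \<phi>_def a_def b_def)
  qed
  have \<phi>_lip: "\<bar>\<phi> y - \<phi> z\<bar> \<le> S * \<bar>y - z\<bar>" for y z
    using \<phi>_lip1[of y z] \<phi>_lip1[of z y] by (cases "y \<le> z") (auto simp: abs_minus_commute)
  define G :: "'m state \<Rightarrow> 'm state" where
    "G x = (\<chi> k. - (\<phi> (x $ (k + 1)) - \<phi> (x $ (k - 1))))" for x
  have Gbnd: "norm (G x) \<le> real CARD('m bit0) * S" for x
  proof (rule norm_vec_le_card)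
    fix k show "\<bar>G x $ k\<bar> \<le> S"
      using \<phi>_pos[of "x $ (k+1)"] \<phi>_pos[of "x $ (k-1)"] \<phi>_le[of "x $ (k+1)"] \<phi>_le[of "x $ (k-1)"]
      unfolding G_def by simp
  qed
  have Glip: "norm (G x - G y) \<le> (real CARD('m bit0) * (2 * S)) * norm (x - y)" for x y
  proof -
    have *: "\<bar>\<phi> (x $ k) - \<phi> (y $ k)\<bar> \<le> S * norm (x - y)" for k
    proof -
      have "\<bar>x $ k - y $ k\<bar> \<le> norm (x - y)" using component_le_norm_cart[of "x - y" k] by simp
      then have "S * \<bar>x $ k - y $ k\<bar> \<le> S * norm (x - y)" using S0 by simp
      then show ?thesis using \<phi>_lip[of "x $ k" "y $ k"] by linarith
    qed
    have "norm (G x - G y) \<le> real CARD('m bit0) * (2 * S * norm (x - y))"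
    proof (rule norm_vec_le_card)
      fix k show "\<bar>(G x - G y) $ k\<bar> \<le> 2 * S * norm (x - y)"
        using *[of "k+1"] *[of "k-1"] unfolding G_def vector_minus_component vec_lambda_beta by linarith
    qed
    then show ?thesis by simp
  qed
  have "0 < real CARD('m bit0) * (2 * S)" using S0 by simp
  then obtain x where x: "solves_ode_on G UNIV x" and x0: "x 0 = (\<chi> k. ln (V $ k))"
    using lipschitz_ode_exists[OF _ Glip Gbnd] by blast
  have xder: "((\<lambda>t. x t $ k) has_real_derivative - (\<phi> (x t $ (k + 1)) - \<phi> (x t $ (k - 1)))) (at t)" for t k
    using x unfolding solves_ode_on_def has_vector_derivative_vec_iff G_def
    by (simp add: has_real_derivative_iff_has_vector_derivative)
  have \<Psi>der: "(\<Psi> has_real_derivative \<phi> y) (at y)" for y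
  proof -
    have "(\<Psi> has_vector_derivative (if y \<in> {..ln S} then exp y else S)) (at y within UNIV)"
      unfolding \<Psi>_def
    proof (rule has_vector_derivative_If_within_closures[where T = "{ln S<..}"])
      fix A
      show "(exp has_vector_derivative exp y) (at y within A)"
        by (auto simp: has_real_derivative_iff_has_vector_derivative[symmetric] intro!: derivative_eq_intros)
      show "((\<lambda>y. S + S * (y - ln S)) has_vector_derivative S) (at y within A)"
        by (auto simp: has_real_derivative_iff_has_vector_derivative[symmetric] intro!: derivative_eq_intros)
    qed (use S0 in auto)
    moreover have "(if y \<in> {..ln S} then exp y else S) = \<phi> y" using S0 by (auto simp: \<phi>_def min_def)
    ultimately show ?thesis by (simp add: has_real_derivative_iff_has_vector_derivative)
  qed
  have "((\<lambda>t. \<Sum>k\<in>UNIV. \<Psi> (x t $ k)) has_real_derivative 0) (at t)" for t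
  proof -
    have "((\<lambda>t. \<Sum>k\<in>UNIV. \<Psi> (x t $ k)) has_real_derivative
        (\<Sum>k\<in>UNIV. \<phi> (x t $ k) * - (\<phi> (x t $ (k + 1)) - \<phi> (x t $ (k - 1))))) (at t)"
      by (intro DERIV_sum DERIV_chain2[OF \<Psi>der] xder)
    also have "(\<Sum>k\<in>UNIV. \<phi> (x t $ k) * - (\<phi> (x t $ (k + 1)) - \<phi> (x t $ (k - 1)))) = 0"
      using sum_mult_central_difference[of "\<lambda>k. \<phi> (x t $ k)"] by (simp only: mult_minus_right sum_negf)
    finally show ?thesis .
  qed
  then have const: "(\<Sum>k\<in>UNIV. \<Psi> (x t $ k)) = (\<Sum>k\<in>UNIV. \<Psi> (x 0 $ k))" for t
    by (intro DERIV_isconst_all) auto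
  have "\<Psi> (x 0 $ k) = V $ k" for k
    using VS[of k] Vpos[of k] S0 by (auto simp: \<Psi>_def x0)
  with const have const: "(\<Sum>k\<in>UNIV. \<Psi> (x t $ k)) = (\<Sum>k\<in>UNIV. V $ k)" for t by simp
  have \<Psi>pos: "0 \<le> \<Psi> y" for y
    using S0 by (auto simp: \<Psi>_def not_le intro!: add_nonneg_nonneg mult_nonneg_nonneg)
  \<comment> \<open>A component beyond ln S would alone contribute at least \<open>S\<close> to a
    sum of nonnegative terms whose value is S - 1.\<close>
  have xS: "x t $ k \<le> ln S" for t k
  proof (rule ccontr)
    assume "\<not> x t $ k \<le> ln S"
    then have "S \<le> \<Psi> (x t $ k)" using S0 by (auto simp: \<Psi>_def)
    also have "\<dots> \<le> (\<Sum>k\<in>UNIV. \<Psi> (x t $ k))" by (rule member_le_sum) (use \<Psi>pos in auto)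
    finally show False unfolding const S_def by simp
  qed
  define u where "u t = (\<chi> k. exp (x t $ k))" for t
  have "(u has_vector_derivative fast_field (u t)) (at t)" for t
  proof -
    have "((\<lambda>t. exp (x t $ k)) has_real_derivative fast_field (u t) $ k) (at t)" for k
    proof -
      have "((\<lambda>t. exp (x t $ k)) has_real_derivative
         exp (x t $ k) * - (\<phi> (x t $ (k + 1)) - \<phi> (x t $ (k - 1)))) (at t)"
        by (intro DERIV_chain2[OF DERIV_exp] xder)
      moreover have "\<phi> (x t $ j) = exp (x t $ j)" for j using xS[of t j] by (simp add: \<phi>_def)
      ultimately show ?thesis unfolding fast_field_def u_def by (simp add: algebra_simps)
    qed
    then show ?thesis
      unfolding has_vector_derivative_vec_iff by (simp add: u_def has_real_derivative_iff_has_vector_derivative)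
  qed
  then have "solves_ode_on fast_field UNIV u" unfolding solves_ode_on_def by simp
  moreover have "u 0 = V" unfolding u_def x0 using Vpos by (simp add: vec_eq_iff)
  moreover have "u t \<in> pos_orthant" for t unfolding u_def pos_orthant_def by simp
  moreover have "(\<Sum>k\<in>UNIV. u t $ k) = (\<Sum>k\<in>UNIV. V $ k)" for t
    using const[of t] xS[of t] unfolding u_def \<Psi>_def by simp
  ultimately show ?thesis by blast
qed

lemma state_bounded_component:
  fixes V :: "real ^ 'n"
  assumes "\<And>k. 0 \<le> V $ k" "(\<Sum>k\<in>UNIV. V $ k) \<le> S"
  shows "\<bar>V $ k\<bar> \<le> S"
proof -
  have "V $ k \<le> (\<Sum>k\<in>UNIV. V $ k)" by (rule member_le_sum) (use assms in auto)
  then show ?thesis using assms by (simp add: abs_of_nonneg)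
qed

text \<open>The sign \<open>c\<close> treats both directions of time at once. The perturbation
  \<open>p\<close> is zero when two fast orbits are compared, and is the rescaled diffusion when a
  slow solution is compared with a fast orbit.\<close>

lemma fast_field_gronwall:
  fixes u v :: "real \<Rightarrow> ('m::finite) state"
  assumes "0 \<le> b" "\<bar>c\<bar> = 1" "0 \<le> \<delta>"
    and u: "\<And>t. t \<in> {0..b} \<Longrightarrow> (u has_vector_derivative c *\<^sub>R fast_field (u t) + p t) (at t within {0..b})"
    and v: "solves_ode_on (\<lambda>x. c *\<^sub>R fast_field x) {0..b} v"
    and p: "\<And>t. t \<in> {0..b} \<Longrightarrow> norm (p t) \<le> \<delta>"
    and uR: "\<And>t k. t \<in> {0..b} \<Longrightarrow> \<bar>u t $ k\<bar> \<le> R"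
    and vR: "\<And>t k. t \<in> {0..b} \<Longrightarrow> \<bar>v t $ k\<bar> \<le> R"
  shows "(norm (u b - v b))\<^sup>2 \<le>
    ((norm (u 0 - v 0))\<^sup>2 + \<delta>\<^sup>2) * exp ((2 * (real CARD('m bit0) * (4 * R)) + 1) * b)"
proof (rule gronwall_norm_square[where w = "\<lambda>t. u t - v t"
      and w' = "\<lambda>t. c *\<^sub>R fast_field (u t) + p t - c *\<^sub>R fast_field (v t)"])
  have "0 \<le> R" using uR[of 0 0] assms(1) by force
  then show "0 \<le> real CARD('m bit0) * (4 * R)" by simp
  fix t assume t: "t \<in> {0..b}"
  show "((\<lambda>t. u t - v t) has_vector_derivative c *\<^sub>R fast_field (u t) + p t - c *\<^sub>R fast_field (v t))
    (at t within {0..b})"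
    using u[OF t] v t unfolding solves_ode_on_def by (auto intro: has_vector_derivative_diff)
  have "norm (c *\<^sub>R fast_field (u t) + p t - c *\<^sub>R fast_field (v t))
      = norm (c *\<^sub>R (fast_field (u t) - fast_field (v t)) + p t)"
    by (simp add: algebra_simps)
  also have "\<dots> \<le> norm (fast_field (u t) - fast_field (v t)) + norm (p t)"
    using norm_triangle_ineq[of "c *\<^sub>R (fast_field (u t) - fast_field (v t))" "p t"] assms(2) by simp
  also have "\<dots> \<le> real CARD('m bit0) * (4 * R) * norm (u t - v t) + \<delta>"
    by (intro add_mono fast_field_lipschitz p t uR vR)
  finally show "norm (c *\<^sub>R fast_field (u t) + p t - c *\<^sub>R fast_field (v t))
    \<le> real CARD('m bit0) * (4 * R) * norm (u t - v t) + \<delta>" .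
qed (use assms in auto)

lemma solves_ode_on_bounded:
  fixes u :: "real \<Rightarrow> real ^ 'n"
  assumes "solves_ode_on F {0..b} u"
  shows "\<exists>R. \<forall>t\<in>{0..b}. \<forall>k. \<bar>u t $ k\<bar> \<le> R"
proof -
  have "continuous_on {0..b} u"
    using assms unfolding solves_ode_on_def
    by (auto simp: continuous_on_eq_continuous_within intro: has_vector_derivative_continuous)
  then have "compact (u ` {0..b})" by (rule compact_continuous_image) simp
  then obtain R where "\<forall>x\<in>u ` {0..b}. norm x \<le> R" using compact_imp_bounded bounded_iff by blast
  then show ?thesis using component_le_norm_cart order_trans by blast
qed

text \<open>The description operator in \<open>fast_flow\<close> ranges over all global solutions,
  so uniqueness cannot presuppose positivity. A box that supplies a Lipschitz constant comes from
  continuity on the compact time interval.\<close>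

lemma fast_solution_unique_forward:
  fixes u v :: "real \<Rightarrow> ('m::finite) state"
  assumes "0 \<le> b" "\<bar>c\<bar> = 1"
    and u: "solves_ode_on (\<lambda>x. c *\<^sub>R fast_field x) {0..b} u"
    and v: "solves_ode_on (\<lambda>x. c *\<^sub>R fast_field x) {0..b} v"
    and "u 0 = v 0"
  shows "u b = v b"
proof -
  obtain R1 R2 where R: "\<forall>t\<in>{0..b}. \<forall>k. \<bar>u t $ k\<bar> \<le> R1" "\<forall>t\<in>{0..b}. \<forall>k. \<bar>v t $ k\<bar> \<le> R2"
    using solves_ode_on_bounded[OF u] solves_ode_on_bounded[OF v] by blast
  define R where "R = max R1 R2"
  have "(norm (u b - v b))\<^sup>2 \<le>
    ((norm (u 0 - v 0))\<^sup>2 + 0\<^sup>2) * exp ((2 * (real CARD('m bit0) * (4 * R)) + 1) * b)"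
  proof (rule fast_field_gronwall[OF assms(1,2) _ _ v, where p = "\<lambda>_. 0"])
    fix t k assume "t \<in> {0..b}"
    then have "\<bar>u t $ k\<bar> \<le> R1" "\<bar>v t $ k\<bar> \<le> R2" using R by auto
    then show "\<bar>u t $ k\<bar> \<le> R" "\<bar>v t $ k\<bar> \<le> R" unfolding R_def by auto
  qed (use u in \<open>auto simp: solves_ode_on_def\<close>)
  then show ?thesis using assms(5) by simp
qed

lemma solves_fast_reverse:
  assumes "solves_ode_on fast_field UNIV u"
  shows "solves_ode_on (\<lambda>x. (- 1) *\<^sub>R fast_field x) UNIV (\<lambda>t. u (- t))"
  using solves_ode_on_reverse[OF assms] by (simp add: surj_uminus)

lemma fast_solution_unique:
  fixes u v :: "real \<Rightarrow> ('m::finite) state"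
  assumes u: "solves_ode_on fast_field UNIV u" and v: "solves_ode_on fast_field UNIV v"
    and "u 0 = v 0"
  shows "u t = v t"
proof (cases "0 \<le> t")
  case True
  show ?thesis
    by (rule fast_solution_unique_forward[OF True, where c = 1])
       (use solves_ode_on_subset[OF u] solves_ode_on_subset[OF v] assms(3) in auto)
next
  case False
  have "(\<lambda>t. u (- t)) (- t) = (\<lambda>t. v (- t)) (- t)"
    by (rule fast_solution_unique_forward[where c = "- 1"];
        (rule solves_ode_on_subset[OF solves_fast_reverse subset_UNIV])?)
       (use False assms in auto)
  then show ?thesis by simp
qed

lemma fast_flow_eq:
  assumes "solves_ode_on fast_field UNIV u"
  shows "fast_flow \<sigma> (u 0) = u \<sigma>"
  unfolding fast_flow_def
proof (rule the_equality)
  show "\<exists>v. solves_ode_on fast_field UNIV v \<and> v 0 = u 0 \<and> v \<sigma> = u \<sigma>" using assms by blast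
qed (use fast_solution_unique[OF _ assms] in blast)

lemma fast_flow_solves:
  assumes "V \<in> pos_orthant"
  shows "solves_ode_on fast_field UNIV (\<lambda>\<sigma>. fast_flow \<sigma> V)"
    and "fast_flow 0 V = V"
    and "fast_flow \<sigma> V \<in> pos_orthant"
    and "(\<Sum>k\<in>UNIV. fast_flow \<sigma> V $ k) = (\<Sum>k\<in>UNIV. V $ k)"
proof -
  obtain u where u: "solves_ode_on fast_field UNIV u" "u 0 = V"
      "\<And>t. u t \<in> pos_orthant" "\<And>t. (\<Sum>k\<in>UNIV. u t $ k) = (\<Sum>k\<in>UNIV. V $ k)"
    using fast_solution_exists[OF assms] by blast
  have "(\<lambda>\<sigma>. fast_flow \<sigma> V) = u" using fast_flow_eq[OF u(1)] u(2) by auto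
  then show "solves_ode_on fast_field UNIV (\<lambda>\<sigma>. fast_flow \<sigma> V)"
    and "fast_flow 0 V = V"
    and "fast_flow \<sigma> V \<in> pos_orthant"
    and "(\<Sum>k\<in>UNIV. fast_flow \<sigma> V $ k) = (\<Sum>k\<in>UNIV. V $ k)"
    using u by (metis (no_types))+
qed

lemma fast_flow_add:
  assumes "V \<in> pos_orthant"
  shows "fast_flow s (fast_flow t V) = fast_flow (s + t) V"
  using fast_flow_eq[OF solves_ode_on_shift[OF fast_flow_solves(1)[OF assms], of t]] by simp

lemma fast_flow_component_le:
  assumes "V \<in> pos_orthant" "(\<Sum>k\<in>UNIV. V $ k) \<le> S"
  shows "\<bar>fast_flow \<sigma> V $ k\<bar> \<le> S"
  using fast_flow_solves(3,4)[OF assms(1), of \<sigma>] assms(2)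
  by (intro state_bounded_component) (auto simp: pos_orthant_def less_imp_le)

text \<open>Positivity and conservation of mass keep every component of both orbits in [-S, S] for
  all times, so one Gronwall constant serves for every \<sigma>.\<close>

lemma fast_flow_lipschitz:
  fixes V W :: "('m::finite) state"
  assumes V: "V \<in> pos_orthant" "(\<Sum>k\<in>UNIV. V $ k) \<le> S"
    and W: "W \<in> pos_orthant" "(\<Sum>k\<in>UNIV. W $ k) \<le> S"
  shows "(norm (fast_flow \<sigma> V - fast_flow \<sigma> W))\<^sup>2 \<le>
    (norm (V - W))\<^sup>2 * exp ((2 * (real CARD('m bit0) * (4 * S)) + 1) * \<bar>\<sigma>\<bar>)"
proof -
  \<comment> \<open>For negative \<sigma> the time-reversed orbits are compared.\<close>
  define c :: real where "c = (if 0 \<le> \<sigma> then 1 else - 1)"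
  have sol: "solves_ode_on (\<lambda>x. c *\<^sub>R fast_field x) UNIV (\<lambda>t. fast_flow (c * t) X)"
    if "X \<in> pos_orthant" for X :: "'m state"
    using fast_flow_solves(1)[OF that] solves_fast_reverse[OF fast_flow_solves(1)[OF that]]
    unfolding c_def by auto
  have "(norm (fast_flow (c * \<bar>\<sigma>\<bar>) V - fast_flow (c * \<bar>\<sigma>\<bar>) W))\<^sup>2 \<le>
    ((norm (fast_flow (c * 0) V - fast_flow (c * 0) W))\<^sup>2 + 0\<^sup>2)
      * exp ((2 * (real CARD('m bit0) * (4 * S)) + 1) * \<bar>\<sigma>\<bar>)"
  proof (rule fast_field_gronwall[where u = "\<lambda>t. fast_flow (c * t) V" and v = "\<lambda>t. fast_flow (c * t) W"
      and c = c and p = "\<lambda>_. 0"])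
    show "solves_ode_on (\<lambda>x. c *\<^sub>R fast_field x) {0..\<bar>\<sigma>\<bar>} (\<lambda>t. fast_flow (c * t) W)"
      by (rule solves_ode_on_subset[OF sol[OF W(1)]]) simp
    fix t assume "t \<in> {0..\<bar>\<sigma>\<bar>}"
    then show "((\<lambda>t. fast_flow (c * t) V) has_vector_derivative c *\<^sub>R fast_field (fast_flow (c * t) V) + 0)
      (at t within {0..\<bar>\<sigma>\<bar>})"
      using solves_ode_on_subset[OF sol[OF V(1)], of "{0..\<bar>\<sigma>\<bar>}"] unfolding solves_ode_on_def by simp
  qed (auto simp: c_def intro!: fast_flow_component_le V W)
  moreover have "c * \<bar>\<sigma>\<bar> = \<sigma>" unfolding c_def by auto
  ultimately show ?thesis by (simp add: fast_flow_solves(2)[OF V(1)] fast_flow_solves(2)[OF W(1)])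
qed

lemma open_pos_orthant: "open (pos_orthant :: ('m::finite) state set)"
proof -
  have "open (\<Inter>k. {V :: 'm state. 0 < V $ k})"
    by (intro open_INT ballI open_Collect_less continuous_intros) simp
  also have "(\<Inter>k. {V :: 'm state. 0 < V $ k}) = pos_orthant" unfolding pos_orthant_def by auto
  finally show ?thesis .
qed

lemma continuous_on_fast_flow:
  "continuous_on pos_orthant (fast_flow \<sigma> :: ('m::finite) state \<Rightarrow> _)"
  unfolding continuous_on_eq_continuous_within
proof
  fix V :: "'m state" assume V: "V \<in> pos_orthant"
  \<comment> \<open>The slack 1 makes \<open>A\<close> an open neighbourhood of \<open>V\<close>
    with a common mass bound, hence with a common Lipschitz constant of the flow.\<close>
  define S where "S = (\<Sum>k\<in>UNIV. V $ k) + 1"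
  define A where "A = pos_orthant \<inter> {W :: 'm state. (\<Sum>k\<in>UNIV. W $ k) < S}"
  have "open A" unfolding A_def
    by (intro open_Int open_pos_orthant open_Collect_less continuous_intros)
  have "V \<in> A" using V unfolding A_def S_def by simp
  define M where "M = exp ((2 * (real CARD('m bit0) * (4 * S)) + 1) * \<bar>\<sigma>\<bar>)"
  have "isCont (fast_flow \<sigma>) V"
    unfolding isCont_def
  proof (rule Lim_transform_bound[where g = "\<lambda>W. sqrt M * norm (W - V)", THEN LIM_zero_cancel])
    show "\<forall>\<^sub>F W in at V. norm (fast_flow \<sigma> W - fast_flow \<sigma> V) \<le> norm (sqrt M * norm (W - V))"
      using eventually_at_in_open'[OF \<open>open A\<close> \<open>V \<in> A\<close>]
    proof eventually_elim
      case (elim W)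
      have "(norm (fast_flow \<sigma> W - fast_flow \<sigma> V))\<^sup>2 \<le> (norm (W - V))\<^sup>2 * M"
        unfolding M_def using elim \<open>V \<in> A\<close> unfolding A_def by (intro fast_flow_lipschitz) auto
      then have "sqrt ((norm (fast_flow \<sigma> W - fast_flow \<sigma> V))\<^sup>2) \<le> sqrt ((norm (W - V))\<^sup>2 * M)"
        by (rule real_sqrt_le_mono)
      then show ?case by (simp add: real_sqrt_mult mult.commute M_def)
    qed
    have "((\<lambda>W. sqrt M * norm (W - V)) \<longlongrightarrow> sqrt M * norm (V - V)) (at V)"
      by (intro tendsto_intros)
    then show "((\<lambda>W. sqrt M * norm (W - V)) \<longlongrightarrow> 0) (at V)" by simp
  qed
  then show "continuous (at V within pos_orthant) (fast_flow \<sigma>)"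
    by (rule continuous_at_imp_continuous_at_within)
qed

section \<open>A trapping region of the slow equation\<close>

definition diffusion_field :: "('m::finite) state \<Rightarrow> 'm state" where
  "diffusion_field V = (\<chi> k. (V $ (k + 1) - 2 * V $ k + V $ (k - 1)) / (mesh TYPE('m))\<^sup>2)"

lemma mesh_pos: "0 < mesh TYPE('m::finite)"
  unfolding mesh_def by simp

text \<open>This fixes the change of time scale: in the time \<tau> / (2 h \<epsilon>) the advection
  becomes exactly \<open>fast_field\<close>, and the diffusion becomes a perturbation with the
  factor 2 h \<epsilon>.\<close>

lemma slow_field_split:
  fixes V :: "('m::finite) state"
  shows "slow_field \<epsilon> V = diffusion_field V + (1 / (2 * mesh TYPE('m) * \<epsilon>)) *\<^sub>R fast_field V"
  unfolding slow_field_def diffusion_field_def fast_field_def Let_def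
  by (simp add: vec_eq_iff)

lemma norm_diffusion_field_le:
  fixes V :: "('m::finite) state"
  assumes "\<And>k. \<bar>V $ k\<bar> \<le> R"
  shows "norm (diffusion_field V) \<le> real CARD('m bit0) * (4 * R / (mesh TYPE('m))\<^sup>2)"
proof (rule norm_vec_le_card)
  fix k
  have "\<bar>V $ (k + 1) - 2 * V $ k + V $ (k - 1)\<bar> \<le> 4 * R"
    using assms[of "k+1"] assms[of k] assms[of "k-1"] by linarith
  then show "\<bar>diffusion_field V $ k\<bar> \<le> 4 * R / (mesh TYPE('m))\<^sup>2"
    unfolding diffusion_field_def by (simp add: divide_right_mono)
qed

lemma sum_slow_field: "(\<Sum>k\<in>UNIV. slow_field \<epsilon> V $ k) = 0"
proof -
  have "(\<Sum>k\<in>UNIV. diffusion_field V $ k) = 0"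
    unfolding diffusion_field_def
    using sum_bit0_shift[of "\<lambda>k. V $ k"]
    by (simp add: sum_divide_distrib[symmetric] sum.distrib sum_subtractf sum_distrib_left[symmetric])
  moreover have "(\<Sum>k\<in>UNIV. fast_field V $ k) = 0"
    unfolding fast_field_def
    using sum_mult_central_difference[of "\<lambda>k. V $ k"] by (simp add: sum_negf)
  ultimately show ?thesis
    unfolding slow_field_split by (simp add: sum.distrib sum_distrib_left[symmetric] sum_divide_distrib[symmetric])
qed

text \<open>The sum is the time derivative of the sum of ln U_k. Division by U_k turns the advection
  into a bare central difference, which sums to zero. After an index shift the diffusion is a sum
  over neighbouring pairs of x/y + y/x - 2, which is nonnegative.\<close>

lemma sum_slow_field_div_nonneg:
  assumes "\<And>k. 0 < V $ k"
  shows "0 \<le> (\<Sum>k\<in>UNIV. slow_field \<epsilon> V $ k / (V :: ('m::finite) state) $ k)"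
proof -
  let ?h = "mesh TYPE('m)"
  have nz: "V $ k \<noteq> 0" for k using assms[of k] by simp
  have ge2: "2 \<le> x / y + y / x" if "0 < x" "0 < y" for x y :: real
  proof -
    have "0 \<le> (x - y)\<^sup>2 / (x * y)" using that by simp
    also have "\<dots> = x / y + y / x - 2" using that by (simp add: power2_eq_square field_simps)
    finally show ?thesis by simp
  qed
  have "slow_field \<epsilon> V $ k / V $ k =
      (V $ (k+1) / V $ k + V $ (k-1) / V $ k - 2) / ?h\<^sup>2 - (V $ (k+1) - V $ (k-1)) / (2 * ?h * \<epsilon>)" for k
    unfolding slow_field_def Let_def using nz[of k] by (simp add: add_divide_distrib diff_divide_distrib mult.commute)
  then have "(\<Sum>k\<in>UNIV. slow_field \<epsilon> V $ k / V $ k) =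
     (\<Sum>k\<in>UNIV. (V $ (k+1) / V $ k + V $ (k-1) / V $ k - 2) / ?h\<^sup>2)
       - (\<Sum>k\<in>UNIV. (V $ (k+1) - V $ (k-1)) / (2 * ?h * \<epsilon>))"
    by (simp add: sum_subtractf)
  also have "(\<Sum>k\<in>UNIV. (V $ (k+1) - V $ (k-1)) / (2 * ?h * \<epsilon>)) = 0"
    using sum_bit0_shift[of "\<lambda>k. V $ k"] by (simp add: sum_divide_distrib[symmetric] sum_subtractf)
  also have "(\<Sum>k\<in>UNIV. (V $ (k+1) / V $ k + V $ (k-1) / V $ k - 2) / ?h\<^sup>2)
      = (\<Sum>k\<in>UNIV. V $ (k+1) / V $ k + V $ k / V $ (k+1) - 2) / ?h\<^sup>2"
    using sum_bit0_shift(1)[of "\<lambda>k. V $ (k - 1) / V $ k"]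
    by (simp add: sum_divide_distrib[symmetric] sum_subtractf sum.distrib)
  finally show ?thesis
    using ge2[OF assms assms] by (auto intro!: divide_nonneg_nonneg sum_nonneg)
qed

text \<open>Given nonnegativity, the sum bounds all components from above, and a product of at least
  p > 0 then excludes zero components. Only non-strict inequalities occur, so the set is
  closed.\<close>

definition trap :: "real \<Rightarrow> real \<Rightarrow> ('m::finite) state set" where
  "trap S p = {V. (\<forall>k. 0 \<le> V $ k) \<and> (\<Sum>k\<in>UNIV. V $ k) \<le> S \<and> p \<le> (\<Prod>k\<in>UNIV. V $ k)}"

lemma compact_trap: "compact (trap S p :: ('m::finite) state set)"
proof -
  have "closed ({V :: 'm state. \<forall>k. 0 \<le> V $ k} \<inter> {V. (\<Sum>k\<in>UNIV. V $ k) \<le> S} \<inter> {V. p \<le> (\<Prod>k\<in>UNIV. V $ k)})"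
    by (intro closed_Int closed_Collect_all closed_Collect_le continuous_intros)
  also have "({V :: 'm state. \<forall>k. 0 \<le> V $ k} \<inter> {V. (\<Sum>k\<in>UNIV. V $ k) \<le> S} \<inter> {V. p \<le> (\<Prod>k\<in>UNIV. V $ k)})
      = trap S p" unfolding trap_def by auto
  finally have "closed (trap S p :: 'm state set)" .
  moreover have "norm V \<le> real CARD('m bit0) * S" if "V \<in> trap S p" for V :: "'m state"
    by (rule norm_vec_le_card, rule state_bounded_component) (use that in \<open>auto simp: trap_def\<close>)
  ultimately show ?thesis unfolding compact_eq_bounded_closed bounded_iff by blast
qed

lemma trap_subset_pos_orthant:
  assumes "0 < p" shows "trap S p \<subseteq> pos_orthant"
proof
  fix V assume V: "V \<in> trap S p"
  have "V $ k \<noteq> 0" for k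
  proof
    assume "V $ k = 0"
    then have "(\<Prod>k\<in>UNIV. V $ k) = 0" by (auto intro!: prod_zero)
    moreover have "p \<le> (\<Prod>k\<in>UNIV. V $ k)" using V unfolding trap_def by auto
    ultimately show False using assms by linarith
  qed
  moreover have "0 \<le> V $ k" for k using V unfolding trap_def by auto
  ultimately show "V \<in> pos_orthant" unfolding pos_orthant_def by (simp add: less_le)
qed

lemma compact_subset_trap:
  fixes K :: "('m::finite) state set"
  assumes "compact K" "K \<subseteq> pos_orthant"
  shows "\<exists>S p. 0 < p \<and> K \<subseteq> trap S p"
proof (cases "K = {}")
  case True then show ?thesis by (auto intro!: exI[of _ 1])
next
  case False
  have "continuous_on K (\<lambda>V. \<Sum>k\<in>UNIV. V $ k)" "continuous_on K (\<lambda>V. \<Prod>k\<in>UNIV. V $ k)"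
    by (intro continuous_intros)+
  note cont = this
  obtain V where V: "V \<in> K" "\<And>W. W \<in> K \<Longrightarrow> (\<Sum>k\<in>UNIV. W $ k) \<le> (\<Sum>k\<in>UNIV. V $ k)"
    using continuous_attains_sup[OF assms(1) False cont(1)] by blast
  obtain V' where V': "V' \<in> K" "\<And>W. W \<in> K \<Longrightarrow> (\<Prod>k\<in>UNIV. V' $ k) \<le> (\<Prod>k\<in>UNIV. W $ k)"
    using continuous_attains_inf[OF assms(1) False cont(2)] by blast
  have "0 < (\<Prod>k\<in>UNIV. V' $ k)" using V'(1) assms(2) unfolding pos_orthant_def by (auto intro!: prod_pos)
  moreover have "K \<subseteq> trap (\<Sum>k\<in>UNIV. V $ k) (\<Prod>k\<in>UNIV. V' $ k)"
    using V(2) V'(2) assms(2) unfolding trap_def pos_orthant_def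
    by (auto simp: subset_iff intro: less_imp_le)
  ultimately show ?thesis by blast
qed

text \<open>The product is controlled through logarithms, hence only as long as the solution is
  positive. The circle is broken at the first time at which a component vanishes: the product is
  zero there, yet by continuity it is still at least the positive initial product.\<close>

lemma slow_solution_stays_in_trap:
  fixes u :: "real \<Rightarrow> ('m::finite) state"
  assumes u: "solves_ode_on (slow_field \<epsilon>) {0..T} u" and u0: "u 0 \<in> trap S p" and "0 < p"
    and t: "t \<in> {0..T}"
  shows "u t \<in> trap S p"
proof -
  have der: "((\<lambda>t. u t $ k) has_vector_derivative slow_field \<epsilon> (u t) $ k) (at t within A)"
    if "t \<in> {0..T}" "A \<subseteq> {0..T}" for t k A
    using u that unfolding solves_ode_on_def has_vector_derivative_vec_iff
    by (blast intro: has_vector_derivative_within_subset)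
  have cont: "continuous_on A (\<lambda>t. u t $ k)" if "A \<subseteq> {0..T}" for A k
    using der that unfolding continuous_on_eq_continuous_within
    by (blast intro: has_vector_derivative_continuous)
  have sum_eq: "(\<Sum>k\<in>UNIV. u s $ k) = (\<Sum>k\<in>UNIV. u 0 $ k)" if "s \<in> {0..T}" for s
  proof (rule vector_derivative_zero_const[of 0 s "\<lambda>t. \<Sum>k\<in>UNIV. u t $ k", symmetric])
    fix r assume "r \<in> {0..s}"
    then have "((\<lambda>t. \<Sum>k\<in>UNIV. u t $ k) has_vector_derivative (\<Sum>k\<in>UNIV. slow_field \<epsilon> (u r) $ k)) (at r within {0..s})"
      using that by (intro has_vector_derivative_sum der) auto
    then show "((\<lambda>t. \<Sum>k\<in>UNIV. u t $ k) has_vector_derivative 0) (at r within {0..s})"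
      by (simp only: sum_slow_field)
  qed (use that in auto)
  have prod_le: "(\<Prod>k\<in>UNIV. u 0 $ k) \<le> (\<Prod>k\<in>UNIV. u s $ k)"
    if "s \<in> {0..T}" and pos: "\<And>r k. r \<in> {0..s} \<Longrightarrow> 0 < u r $ k" for s
  proof -
    have "(\<Sum>k\<in>UNIV. ln (u 0 $ k)) \<le> (\<Sum>k\<in>UNIV. ln (u s $ k))"
    proof (rule vector_derivative_nonneg_mono[where f = "\<lambda>t. \<Sum>k\<in>UNIV. ln (u t $ k)" and f' = "\<lambda>r. \<Sum>k\<in>UNIV. slow_field \<epsilon> (u r) $ k / u r $ k"])
      fix r assume r: "r \<in> {0..s}"
      have "((\<lambda>t. ln (u t $ k)) has_vector_derivative slow_field \<epsilon> (u r) $ k / u r $ k) (at r within {0..s})" for k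
        using der[of r "{0..s}" k] r that(1) pos[OF r, of k]
        unfolding has_real_derivative_iff_has_vector_derivative[symmetric]
        by (auto intro!: derivative_eq_intros)
      then show "((\<lambda>t. \<Sum>k\<in>UNIV. ln (u t $ k)) has_vector_derivative
         (\<Sum>k\<in>UNIV. slow_field \<epsilon> (u r) $ k / u r $ k)) (at r within {0..s})"
        by (intro has_vector_derivative_sum) auto
      show "0 \<le> (\<Sum>k\<in>UNIV. slow_field \<epsilon> (u r) $ k / u r $ k)"
        by (rule sum_slow_field_div_nonneg) (use pos r in auto)
    qed (use that in auto)
    then have "exp (\<Sum>k\<in>UNIV. ln (u 0 $ k)) \<le> exp (\<Sum>k\<in>UNIV. ln (u s $ k))" by simp
    then show ?thesis using pos[of 0] pos[of s] that(1) by (simp add: exp_sum)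
  qed
  have u0pos: "0 < u 0 $ k" for k
    using trap_subset_pos_orthant[OF \<open>0 < p\<close>] u0 unfolding pos_orthant_def by blast
  have pos: "0 < u s $ k" if "s \<in> {0..T}" for s k
  proof (rule ccontr)
    assume neg: "\<not> 0 < u s $ k"
    \<comment> \<open>The times at which some component is nonpositive. This set is closed, so its
      infimum is attained and is the first such time.\<close>
    define Z where "Z = (\<Union>k. {t \<in> {0..T}. u t $ k \<le> 0})"
    have "closed Z" unfolding Z_def
      by (intro closed_UN ballI continuous_on_closed_Collect_le cont continuous_on_const; simp)
    have "s \<in> Z" using neg that unfolding Z_def by (auto simp: not_less)
    then have "Z \<noteq> {}" by auto
    have bdd: "bdd_below Z" unfolding Z_def by (rule bdd_belowI[of _ 0]) auto
    define s0 where "s0 = Inf Z"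
    have "s0 \<in> Z" unfolding s0_def by (rule closed_contains_Inf[OF \<open>Z \<noteq> {}\<close> bdd \<open>closed Z\<close>])
    then obtain j where j: "s0 \<in> {0..T}" "u s0 $ j \<le> 0" unfolding Z_def by auto
    have "s0 \<noteq> 0" using j(2) u0pos[of j] by auto
    with j have "0 < s0" by auto
    have before: "0 < u r $ k" if "r \<in> {0..<s0}" for r k
    proof (rule ccontr)
      assume "\<not> 0 < u r $ k"
      then have "r \<in> Z" unfolding Z_def using that j by (auto simp: not_less)
      then have "s0 \<le> r" unfolding s0_def by (rule cInf_lower[OF _ bdd])
      then show False using that by auto
    qed
    have cl: "closure {0..<s0} = {0..s0}" using \<open>0 < s0\<close> by simp
    have "0 \<le> u s0 $ j"
      by (rule continuous_ge_on_closure[of "{0..<s0}" "\<lambda>t. u t $ j"])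
         (use before j \<open>0 < s0\<close> in \<open>auto simp: cl less_imp_le intro!: cont\<close>)
    then have "u s0 $ j = 0" using j by simp
    then have "(\<Prod>k\<in>UNIV. u s0 $ k) = 0" by (auto intro!: prod_zero)
    \<comment> \<open>\<open>prod_le\<close> is available up to each r < s0 only; continuity carries
      the bound to \<open>s0\<close> itself.\<close>
    moreover have "(\<Prod>k\<in>UNIV. u 0 $ k) \<le> (\<Prod>k\<in>UNIV. u s0 $ k)"
    proof (rule continuous_ge_on_closure[of "{0..<s0}" "\<lambda>t. \<Prod>k\<in>UNIV. u t $ k"])
      show "continuous_on (closure {0..<s0}) (\<lambda>t. \<Prod>k\<in>UNIV. u t $ k)"
        unfolding cl using j by (intro continuous_on_prod cont) auto
      show "s0 \<in> closure {0..<s0}" unfolding cl using \<open>0 < s0\<close> by auto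
      fix r assume "r \<in> {0..<s0}"
      then show "(\<Prod>k\<in>UNIV. u 0 $ k) \<le> (\<Prod>k\<in>UNIV. u r $ k)"
        using j by (intro prod_le before) auto
    qed
    moreover have "0 < (\<Prod>k\<in>UNIV. u 0 $ k)" by (intro prod_pos u0pos)
    ultimately show False by linarith
  qed
  have "p \<le> (\<Prod>k\<in>UNIV. u 0 $ k)" using u0 unfolding trap_def by auto
  also have "\<dots> \<le> (\<Prod>k\<in>UNIV. u t $ k)" using t by (intro prod_le pos) auto
  finally show ?thesis
    using pos[OF t] sum_eq[OF t] u0 unfolding trap_def by (auto intro: less_imp_le)
qed

section \<open>Compactness of Young measures\<close>

lemma measure_eqI_Ioc:
  fixes M N :: "real measure"
  assumes "sets M = sets borel" "sets N = sets borel"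
    and eq: "\<And>a b. a \<le> b \<Longrightarrow> emeasure M {a<..b} = emeasure N {a<..b}"
    and fin: "\<And>a b. a \<le> b \<Longrightarrow> emeasure M {a<..b} < \<infinity>"
  shows "M = N"
proof (rule measure_eqI_generator_eq[where E = "range (\<lambda>(a, b). {a<..b::real})" and \<Omega> = UNIV
      and A = "\<lambda>n. {- real n<..real n}"])
  show "Int_stable (range (\<lambda>(a, b). {a<..b::real}))"
    by (auto simp: Int_stable_def Int_greaterThanAtMost)
  show "emeasure M X = emeasure N X" if X: "X \<in> range (\<lambda>(a, b). {a<..b::real})" for X
  proof -
    obtain a b where "X = {a<..b}" using X by auto
    then show ?thesis using eq[of a b] by (cases "a \<le> b") auto
  qed
  show "(\<Union>i. {- real i<..real i}) = UNIV"
  proof -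
    have "\<exists>i. x \<in> {- real i<..real i}" for x
      using reals_Archimedean2[of "\<bar>x\<bar>"] by (auto simp: abs_less_iff) (metis less_eq_real_def neg_less_iff_less minus_minus minus_less_iff)
    then show ?thesis by auto
  qed
  show "emeasure M {- real i<..real i} \<noteq> \<infinity>" for i using fin[of "- real i" "real i"] by auto
qed (use assms(1,2) in \<open>auto simp: borel_sigma_sets_Ioc\<close>)

text \<open>Since \<open>t - H t\<close> is monotone as well, the interval measures of both functions add up to Lebesgue
  measure, which makes that of \<open>H\<close> absolutely continuous.\<close>

lemma lipschitz_monotone_density:
  fixes H :: "real \<Rightarrow> real"
  assumes mono: "\<And>s t. s \<le> t \<Longrightarrow> H s \<le> H t"
    and lip: "\<And>s t. s \<le> t \<Longrightarrow> H t - H s \<le> t - s"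
  shows "\<exists>G\<in>borel_measurable borel. \<forall>a b. a \<le> b \<longrightarrow>
    emeasure (density lborel G) {a<..b} = ennreal (H b - H a)"
proof -
  define H' where "H' t = t - H t" for t
  have mono': "H' s \<le> H' t" if "s \<le> t" for s t using lip[OF that] unfolding H'_def by linarith
  have "\<bar>H s - H t\<bar> \<le> 1 * \<bar>s - t\<bar>" for s t
    using mono[of s t] mono[of t s] lip[of s t] lip[of t s] by (cases "s \<le> t") auto
  then have "1-lipschitz_on UNIV H" by (auto simp: lipschitz_on_def dist_real_def)
  then have contH: "continuous_on UNIV H" by (rule lipschitz_on_continuous_on)
  then have contH': "continuous_on UNIV H'" unfolding H'_def by (intro continuous_intros)
  define M1 where "M1 = interval_measure H"
  define M2 where "M2 = interval_measure H'"
  have M1: "emeasure M1 {a<..b} = ennreal (H b - H a)" if "a \<le> b" for a b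
    unfolding M1_def using contH
    by (intro emeasure_interval_measure_Ioc that mono)
       (auto simp: continuous_on_eq_continuous_within intro: continuous_at_imp_continuous_at_within)
  have M2: "emeasure M2 {a<..b} = ennreal (H' b - H' a)" if "a \<le> b" for a b
    unfolding M2_def using contH'
    by (intro emeasure_interval_measure_Ioc that mono')
       (auto simp: continuous_on_eq_continuous_within intro: continuous_at_imp_continuous_at_within)
  define N where "N = measure_of UNIV (sets borel) (\<lambda>A. emeasure M1 A + emeasure M2 A)"
  have sM [simp]: "sets M1 = sets borel" "sets M2 = sets borel" unfolding M1_def M2_def by simp_all
  have sN: "sets N = sets borel" unfolding N_def
    by (metis sets.sets_measure_of_eq space_borel)
  have N: "emeasure N A = emeasure M1 A + emeasure M2 A" if "A \<in> sets borel" for A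
  proof (rule emeasure_measure_of[OF N_def])
    show "sets borel \<subseteq> Pow (UNIV :: real set)" by auto
    show "positive (sets N) (\<lambda>A. emeasure M1 A + emeasure M2 A)" by (simp add: positive_def)
    show "countably_additive (sets N) (\<lambda>A. emeasure M1 A + emeasure M2 A)"
      unfolding countably_additive_def sN
    proof (intro allI impI)
      fix A :: "nat \<Rightarrow> real set" assume A: "range A \<subseteq> sets borel" "disjoint_family A"
      then show "(\<Sum>i. emeasure M1 (A i) + emeasure M2 (A i)) = emeasure M1 (\<Union> (range A)) + emeasure M2 (\<Union> (range A))"
        by (simp add: suminf_add[symmetric] suminf_emeasure)
    qed
    show "A \<in> sets N" using that sN by simp
  qed
  have "lborel = N"
  proof (rule measure_eqI_Ioc)
    fix a b :: real assume "a \<le> b"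
    then show "emeasure lborel {a<..b} = emeasure N {a<..b}"
      using mono[of a b] mono'[of a b]
      by (simp add: N M1 M2 ennreal_plus[symmetric] H'_def del: ennreal_plus)
  qed (auto simp: sN)
  then have "absolutely_continuous lborel M1"
    unfolding absolutely_continuous_def null_sets_def
  proof (intro subsetI, clarsimp)
    fix A :: "real set" assume A: "A \<in> sets borel" "emeasure lborel A = 0"
    have "emeasure M1 A + emeasure M2 A = 0" using A N[OF A(1)] \<open>lborel = N\<close> by simp
    then show "emeasure M1 A = 0" by simp
  qed
  then obtain G where "G \<in> borel_measurable lborel" "density lborel G = M1"
    using sigma_finite_measure.Radon_Nikodym[OF sigma_finite_lborel, of M1] by auto
  then show ?thesis using M1 by auto
qed

lemma AE_eq_of_Ioc:
  fixes f g :: "real \<Rightarrow> ennreal"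
  assumes [measurable]: "f \<in> borel_measurable borel" "g \<in> borel_measurable borel"
    and "\<And>a b. a \<le> b \<Longrightarrow> emeasure (density lborel f) {a<..b} = emeasure (density lborel g) {a<..b}"
    and "\<And>a b. a \<le> b \<Longrightarrow> emeasure (density lborel f) {a<..b} < \<infinity>"
  shows "AE t in lborel. f t = g t"
proof (rule sigma_finite_measure.density_unique[OF sigma_finite_lborel])
  show "density lborel f = density lborel g"
    by (rule measure_eqI_Ioc) (use assms in auto)
qed auto

text \<open>A Helly argument. The functions measuring the part of \<open>E i q\<close> to the left
  of \<open>t\<close> are bounded, monotone and 1-Lipschitz in \<open>t\<close>. A diagonal
  subsequence converges for all \<open>q\<close> and all rational \<open>t\<close>, and the
  Lipschitz bound extends convergence to real \<open>t\<close>. The limit \<open>H\<close> is again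
  monotone and 1-Lipschitz, which is exactly what yields a density.\<close>

lemma weak_star_limit_indicators:
  fixes E :: "nat \<Rightarrow> 'q::countable \<Rightarrow> real set"
  assumes [measurable]: "\<And>i q. E i q \<in> sets borel"
    and sub: "\<And>i q. E i q \<subseteq> {0..T}"
  obtains r G H where "strict_mono (r :: nat \<Rightarrow> nat)"
    and "\<And>q. G q \<in> borel_measurable borel"
    and "\<And>q s t. s \<le> t \<Longrightarrow> H q s \<le> H q t"
    and "\<And>q a b. a \<le> b \<Longrightarrow> emeasure (density lborel (G q)) {a<..b} = ennreal (H q b - H q a)"
    and "\<And>q a b. a \<le> b \<Longrightarrow> (\<lambda>i. measure lborel (E (r i) q \<inter> {a<..b})) \<longlonglongrightarrow> H q b - H q a"
proof -
  define h where "h i q t = measure lborel (E i q \<inter> {..t})" for i q t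
  have fmT: "{0..T} \<in> fmeasurable lborel" by (auto simp: fmeasurable_def emeasure_lborel_Icc_eq)
  have fm: "E i q \<inter> A \<in> fmeasurable lborel" if [measurable]: "A \<in> sets borel" for i q A
  proof (rule fmeasurableI2[of "{0..T}"])
    show "{0..T} \<in> fmeasurable lborel" by (rule fmT)
  qed (use sub in auto)
  have fm0: "E i q \<in> fmeasurable lborel" for i q using fm[of UNIV] by simp
  have diff: "h i q t - h i q s = measure lborel (E i q \<inter> {s<..t})" if "s \<le> t" for i q s t
  proof -
    have "measure lborel (E i q \<inter> {..s} \<union> E i q \<inter> {s<..t}) = h i q s + measure lborel (E i q \<inter> {s<..t})"
      unfolding h_def by (rule measure_Un2[THEN trans]) (use that fm in \<open>auto intro!: arg_cong2[where f = "(+)"] arg_cong[where f = "measure lborel"]\<close>)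
    moreover have "E i q \<inter> {..s} \<union> E i q \<inter> {s<..t} = E i q \<inter> {..t}" using that by auto
    ultimately show ?thesis unfolding h_def by simp
  qed
  have hmono: "h i q s \<le> h i q t" if "s \<le> t" for i q s t
    using diff[OF that, of i q] measure_nonneg[of lborel "E i q \<inter> {s<..t}"] by linarith
  have hlip: "h i q t - h i q s \<le> t - s" if "s \<le> t" for i q s t
  proof -
    have "measure lborel (E i q \<inter> {s<..t}) \<le> measure lborel {s<..t}"
      by (rule measure_mono_fmeasurable) (auto simp: fmeasurable_def emeasure_lborel_Ioc that)
    then show ?thesis unfolding diff[OF that] using that by simp
  qed
  have hb: "norm (h i q t) \<le> \<bar>T\<bar>" for i q t
  proof -
    have "h i q t \<le> measure lborel {0..T}"
      unfolding h_def by (rule measure_mono_fmeasurable[OF _ _ fmT]) (use sub in auto)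
    also have "\<dots> \<le> \<bar>T\<bar>" by (auto simp: measure_def emeasure_lborel_Icc_eq)
    finally show ?thesis by (simp add: h_def)
  qed
  obtain r where r: "strict_mono (r :: nat \<Rightarrow> nat)"
    and conv: "\<And>x. x \<in> UNIV \<times> \<rat> \<Longrightarrow> \<exists>l. (\<lambda>n. (\<lambda>n (q, t). h n q t) (r n) x) \<longlonglongrightarrow> l"
  proof (rule function_convergent_subsequence[where f = "\<lambda>n (q, t). h n q t" and S = "(UNIV :: 'q set) \<times> (\<rat> :: real set)" and M = "\<bar>T\<bar>"])
    show "countable ((UNIV :: 'q set) \<times> (\<rat> :: real set))" by (intro countable_SIGMA countableI_type countable_rat)
  qed (use hb in auto)
  have convt: "convergent (\<lambda>n. h (r n) q t)" for q t
  proof -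
    have "Cauchy (\<lambda>n. h (r n) q t)"
    proof (rule metric_CauchyI)
      fix e :: real assume "0 < e"
      obtain s where s: "s \<in> \<rat>" "t < s" "s < t + e / 3"
        using Rats_dense_in_real[of t "t + e / 3"] \<open>0 < e\<close> by auto
      have "convergent (\<lambda>n. h (r n) q s)" using conv[of "(q, s)"] s(1) by (auto simp: convergent_def)
      then obtain M where M: "\<And>m n. m \<ge> M \<Longrightarrow> n \<ge> M \<Longrightarrow> dist (h (r m) q s) (h (r n) q s) < e / 3"
        using \<open>0 < e\<close> unfolding convergent_eq_Cauchy metric_Cauchy_iff2
        by (metis Cauchy_def convergent_Cauchy convergent_eq_Cauchy \<open>convergent (\<lambda>n. h (r n) q s)\<close> divide_pos_pos zero_less_numeral)
      have near: "\<bar>h (r n) q t - h (r n) q s\<bar> \<le> e / 3" for n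
        using hmono[of t s "r n" q] hlip[of t s "r n" q] s by auto
      have "dist (h (r m) q t) (h (r n) q t) < e" if "m \<ge> M" "n \<ge> M" for m n
        using M[OF that] near[of m] near[of n] unfolding dist_real_def by linarith
      then show "\<exists>M. \<forall>m\<ge>M. \<forall>n\<ge>M. dist (h (r m) q t) (h (r n) q t) < e" by blast
    qed
    then show ?thesis by (simp add: Cauchy_convergent_iff)
  qed
  define H where "H q t = lim (\<lambda>n. h (r n) q t)" for q t
  have Hlim: "(\<lambda>n. h (r n) q t) \<longlonglongrightarrow> H q t" for q t
    unfolding H_def using convt convergent_LIMSEQ_iff by blast
  have Hmono: "H q s \<le> H q t" if "s \<le> t" for q s t
    by (rule LIMSEQ_le[OF Hlim Hlim]) (use hmono that in auto)
  have Hlip: "H q t - H q s \<le> t - s" if "s \<le> t" for q s t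
    by (rule LIMSEQ_le[OF tendsto_diff[OF Hlim Hlim] tendsto_const]) (use hlip that in auto)
  have "\<exists>G. \<forall>q. G q \<in> borel_measurable borel \<and> (\<forall>a b. a \<le> b \<longrightarrow>
      emeasure (density lborel (G q)) {a<..b} = ennreal (H q b - H q a))"
    using lipschitz_monotone_density[OF Hmono Hlip] by (intro choice) blast
  then obtain G where G: "\<And>q. G q \<in> borel_measurable borel"
      "\<And>q a b. a \<le> b \<Longrightarrow> emeasure (density lborel (G q)) {a<..b} = ennreal (H q b - H q a)"
    by blast
  show thesis
  proof (rule that[of r G H, OF r G(1) Hmono G(2)])
    fix q and a b :: real assume "a \<le> b"
    show "(\<lambda>i. measure lborel (E (r i) q \<inter> {a<..b})) \<longlonglongrightarrow> H q b - H q a"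
      using tendsto_diff[OF Hlim[of q b] Hlim[of q a]] unfolding diff[OF \<open>a \<le> b\<close>] .
  qed
qed

text \<open>The bits of \<open>c n x\<close> record to which of the first \<open>n\<close> sets of a countable basis \<open>x\<close> belongs.\<close>

lemma binary_partition_code:
  fixes K :: "'a::{metric_space, second_countable_topology} set"
  assumes "compact K"
  obtains c :: "nat \<Rightarrow> 'a \<Rightarrow> nat"
  where "\<And>n. c n \<in> borel \<rightarrow>\<^sub>M count_space UNIV"
    and "\<And>n x. c n x < 2 ^ n"
    and "\<And>n x. c (Suc n) x div 2 = c n x"
    and "\<And>\<delta>. 0 < \<delta> \<Longrightarrow> \<exists>n0. \<forall>n\<ge>n0. \<forall>x\<in>K. \<forall>y\<in>K. c n x = c n y \<longrightarrow> dist x y < \<delta>"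
proof -
  obtain \<B> :: "'a set set" where \<B>: "countable \<B>" "topological_basis \<B>"
    using ex_countable_basis by blast
  define B where "B = from_nat_into \<B>"
  have "\<B> \<noteq> {}" using \<B>(2) topological_basis_imp_subbasis by (metis UNIV_I UnionE empty_iff open_UNIV topological_basisE)
  then have rangeB: "range B = \<B>" unfolding B_def using \<B>(1) by simp
  have openB: "open (B m)" for m using \<B>(2) rangeB topological_basis_open by blast
  define c where "c = (\<lambda>n x. rec_nat 0 (\<lambda>m v. 2 * v + (if x \<in> B m then 1 else 0)) n :: nat)"
  have c0: "c 0 x = 0" and cS: "c (Suc n) x = 2 * c n x + (if x \<in> B n then 1 else 0)" for n x
    unfolding c_def by simp_all
  have decode: "x \<in> B m \<longleftrightarrow> y \<in> B m" if "c n x = c n y" "m < n" for n m x y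
    using that
  proof (induction n)
    case (Suc n)
    have "c n x = c n y \<and> (x \<in> B n \<longleftrightarrow> y \<in> B n)"
      using Suc.prems(1) unfolding cS by (auto split: if_splits) presburger+
    then show ?case using Suc by (cases "m = n") auto
  qed simp
  show thesis
  proof (rule that[of c])
    show "c n \<in> borel \<rightarrow>\<^sub>M count_space UNIV" for n
    proof (induction n)
      case (Suc n)
      have [measurable]: "B n \<in> sets borel" using openB by simp
      have [measurable]: "c n \<in> borel \<rightarrow>\<^sub>M count_space UNIV" by (rule Suc)
      show ?case unfolding cS[abs_def] by measurable
    qed (simp add: c0)
    show "c n x < 2 ^ n" for n x by (induction n) (auto simp: c0 cS)
    show "c (Suc n) x div 2 = c n x" for n x by (simp add: cS)
    fix \<delta> :: real assume "0 < \<delta>"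
    \<comment> \<open>Finitely many basic sets contained in balls of radius \<delta> / 2 cover
      \<open>K\<close>. Once the code records membership in all of them, equal codes place two
      points of \<open>K\<close> in a common ball.\<close>
    define I where "I = {m. \<exists>x. B m \<subseteq> ball x (\<delta> / 2)}"
    have "K \<subseteq> (\<Union>m\<in>I. B m)"
    proof
      fix x assume "x \<in> K"
      obtain b where "b \<in> \<B>" "x \<in> b" "b \<subseteq> ball x (\<delta> / 2)"
        using topological_basisE[OF \<B>(2) open_ball, of x x "\<delta> / 2"] \<open>0 < \<delta>\<close> by auto
      then show "x \<in> (\<Union>m\<in>I. B m)" unfolding rangeB[symmetric] I_def by auto
    qed
    then obtain I' where I': "I' \<subseteq> I" "finite I'" "K \<subseteq> (\<Union>m\<in>I'. B m)"
      using compactE_image[OF assms, of I B] openB by blast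
    obtain n0 where n0: "\<forall>m\<in>I'. m < n0" using I'(2) finite_nat_set_iff_bounded by blast
    have "dist x y < \<delta>" if xy: "n \<ge> n0" "x \<in> K" "y \<in> K" "c n x = c n y" for n x y
    proof -
      obtain m where m: "m \<in> I'" "x \<in> B m" using I'(3) xy(2) by auto
      then have "y \<in> B m" using decode[OF xy(4), of m] n0 xy(1) by auto
      moreover obtain z where "B m \<subseteq> ball z (\<delta> / 2)" using m(1) I'(1) unfolding I_def by auto
      ultimately have "dist z x < \<delta> / 2" "dist z y < \<delta> / 2" using m(2) by auto
      then show ?thesis using dist_triangle3[of x y z] by linarith
    qed
    then show "\<exists>n0. \<forall>n\<ge>n0. \<forall>x\<in>K. \<forall>y\<in>K. c n x = c n y \<longrightarrow> dist x y < \<delta>" by blast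
  qed
qed

section \<open>Nested quantile intervals\<close>

definition quantile_index :: "(nat \<Rightarrow> real) \<Rightarrow> real \<Rightarrow> nat" where
  "quantile_index p y = (LEAST j. y < sum p {..<Suc j})"

text \<open>\<open>quantile_index\<close> is the generalized inverse of the distribution function of
  the weights. The intervals it inverts contain their left but not their right endpoints, so an
  index of weight zero is never selected; later this ensures that the selected cells meet
  \<open>K\<close>.\<close>

lemma quantile_index_bounds:
  assumes "\<And>i. 0 \<le> p i" "0 \<le> y" "y < sum p {..<N}"
  shows "quantile_index p y < N"
    and "sum p {..<quantile_index p y} \<le> y" and "y < sum p {..<Suc (quantile_index p y)}"
proof -
  have "N \<noteq> 0" using assms(2,3) by (intro notI) auto
  then have ex: "y < sum p {..<Suc (N - 1)}" using assms(3) by simp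
  show "y < sum p {..<Suc (quantile_index p y)}" unfolding quantile_index_def by (rule LeastI[of "\<lambda>j. y < sum p {..<Suc j}", OF ex])
  have "quantile_index p y \<le> N - 1" unfolding quantile_index_def by (rule Least_le[of "\<lambda>j. y < sum p {..<Suc j}", OF ex])
  then show "quantile_index p y < N" using \<open>N \<noteq> 0\<close> by simp
  show "sum p {..<quantile_index p y} \<le> y"
  proof (cases "quantile_index p y")
    case (Suc j)
    then have "\<not> y < sum p {..<Suc j}" using not_less_Least[of j "\<lambda>j. y < sum p {..<Suc j}"]
      unfolding quantile_index_def by simp
    then show ?thesis using Suc by simp
  qed (use assms in simp)
qed

lemma quantile_index_eqI:
  assumes "\<And>i. 0 \<le> p i" "sum p {..<j} \<le> y" "y < sum p {..<Suc j}"
  shows "quantile_index p y = j"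
  unfolding quantile_index_def
proof (rule Least_equality[of "\<lambda>j. y < sum p {..<Suc j}", OF assms(3)])
  fix i assume i: "y < sum p {..<Suc i}"
  show "j \<le> i"
  proof (rule ccontr)
    assume "\<not> j \<le> i"
    then have "sum p {..<Suc i} \<le> sum p {..<j}" by (intro sum_mono2) (use assms(1) in auto)
    then show False using i assms(2) by linarith
  qed
qed

lemma sum_refine:
  fixes p :: "nat \<Rightarrow> real"
  assumes "\<And>j. j < N \<Longrightarrow> p j = q (2 * j) + q (2 * j + 1)" "n \<le> N"
  shows "sum p {..<n} = sum q {..<2 * n}"
  using assms(2) by (induction n) (auto simp: assms(1))

text \<open>An interchange of limits. It is applied twice: to functions that are constant on cells
  of the state space, and to functions that are constant in time on the intervals of a grid.\<close>

lemma LIMSEQ_uniform_approx: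
  fixes A :: "nat \<Rightarrow> real"
  assumes "\<And>\<eta>. 0 < \<eta> \<Longrightarrow> \<exists>S L. S \<longlonglongrightarrow> L \<and> (\<forall>i. \<bar>A i - S i\<bar> \<le> \<eta>) \<and> \<bar>M - L\<bar> \<le> \<eta>"
  shows "A \<longlonglongrightarrow> M"
proof (rule metric_LIMSEQ_I)
  fix e :: real assume "0 < e"
  then obtain S L where S: "S \<longlonglongrightarrow> L" "\<And>i. \<bar>A i - S i\<bar> \<le> e / 4" "\<bar>M - L\<bar> \<le> e / 4"
    using assms[of "e / 4"] by auto
  obtain n0 where n0: "\<And>n. n \<ge> n0 \<Longrightarrow> dist (S n) L < e / 4"
    using metric_LIMSEQ_D[OF S(1), of "e / 4"] \<open>0 < e\<close> by auto
  have "dist (A n) M < e" if "n \<ge> n0" for n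
    using n0[OF that] S(2)[of n] S(3) \<open>0 < e\<close> unfolding dist_real_def by linarith
  then show "\<exists>n0. \<forall>n\<ge>n0. dist (A n) M < e" by blast
qed

lemma set_integrable_Ioc_bounded:
  fixes f :: "real \<Rightarrow> real"
  assumes "f \<in> borel_measurable borel" "\<And>t. t \<in> {a<..b} \<Longrightarrow> \<bar>f t\<bar> \<le> B"
  shows "set_integrable lborel {a<..b} f"
  unfolding set_integrable_def
proof (rule integrableI_bounded_set[where A = "{a<..b}" and B = B])
  show "emeasure lborel {a<..b} < \<infinity>" by (cases "a \<le> b") auto
qed (use assms in auto)

lemma set_integral_Ioc_diff_le:
  fixes f g :: "real \<Rightarrow> real"
  assumes f: "set_integrable lborel {a<..b} f" and g: "set_integrable lborel {a<..b} g"
    and le: "AE t in lborel. t \<in> {a<..b} \<longrightarrow> \<bar>f t - g t\<bar> \<le> \<eta>" and "a \<le> b"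
  shows "\<bar>(LINT t:{a<..b}|lborel. f t) - (LINT t:{a<..b}|lborel. g t)\<bar> \<le> \<eta> * (b - a)"
proof -
  have "(LINT t:{a<..b}|lborel. f t) - (LINT t:{a<..b}|lborel. g t) = (LINT t:{a<..b}|lborel. f t - g t)"
    by (rule set_integral_diff(2)[OF f g, symmetric])
  also have "\<bar>\<dots>\<bar> \<le> (LINT t|lborel. norm (indicator {a<..b} t *\<^sub>R (f t - g t)))"
    unfolding set_lebesgue_integral_def real_norm_def[symmetric] by (rule integral_norm_bound)
  also have "\<dots> \<le> (LINT t|lborel. indicator {a<..b} t * \<eta>)"
  proof (rule integral_mono_AE)
    show "integrable lborel (\<lambda>t. norm (indicator {a<..b} t *\<^sub>R (f t - g t)))"
      using set_integral_diff(1)[OF f g] unfolding set_integrable_def by (rule integrable_norm)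
    show "integrable lborel (\<lambda>t. indicator {a<..b} t * \<eta>)"
      using \<open>a \<le> b\<close> by (intro integrable_mult_left) simp
    show "AE t in lborel. norm (indicator {a<..b} t *\<^sub>R (f t - g t)) \<le> indicator {a<..b} t * \<eta>"
      using le by eventually_elim (auto simp: indicator_def)
  qed
  also have "\<dots> = \<eta> * (b - a)" using \<open>a \<le> b\<close> by simp
  finally show ?thesis .
qed

text \<open>The partial sum before j on one level is the partial sum before 2 j on the next, so the
  interval containing \<open>y\<close> shrinks inside its parent and the indices are compatible
  under \<open>div 2\<close>. All later representatives therefore share the level-n cell, which
  gives a Cauchy sequence in \<open>K\<close>. Cells need not be closed, so the limit may leave
  them; hence the final bound is non-strict.\<close>

lemma cell_refinement_limit:
  fixes c :: "nat \<Rightarrow> 'a::metric_space \<Rightarrow> nat"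
  assumes "compact K"
    and c: "\<And>n x. c (Suc n) x div 2 = c n x"
    and sep: "\<And>\<delta>. 0 < \<delta> \<Longrightarrow> \<exists>n0. \<forall>n\<ge>n0. \<forall>x\<in>K. \<forall>y\<in>K. c n x = c n y \<longrightarrow> dist x y < \<delta>"
    and p: "\<And>n i. 0 \<le> p n i" "\<And>n. sum (p n) {..<2 ^ n} = 1"
      "\<And>n j. j < 2 ^ n \<Longrightarrow> p n j = p (Suc n) (2 * j) + p (Suc n) (2 * j + 1)"
    and rep: "\<And>n j. 0 < p n j \<Longrightarrow> rep n j \<in> K \<and> c n (rep n j) = j"
    and y: "0 \<le> y" "y < 1"
  defines "Y \<equiv> \<lambda>n. rep n (quantile_index (p n) y)"
  shows "Y n \<in> K" and "lim Y \<in> K"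
    and "(\<And>x y. x \<in> K \<Longrightarrow> y \<in> K \<Longrightarrow> c n x = c n y \<Longrightarrow> dist x y < \<delta>) \<Longrightarrow> dist (lim Y) (Y n) \<le> \<delta>"
proof -
  define J where "J n = quantile_index (p n) y" for n
  have J: "J n < 2 ^ n" "sum (p n) {..<J n} \<le> y" "y < sum (p n) {..<Suc (J n)}" for n
    unfolding J_def using quantile_index_bounds[of "p n" y "2 ^ n", OF p(1) y(1)] p(2)[of n] y(2) by auto
  have Jdiv: "J (Suc n) div 2 = J n" for n
  proof -
    define j where "j = J (Suc n) div 2"
    have j: "j < 2 ^ n" using J(1)[of "Suc n"] unfolding j_def by auto
    have ref: "sum (p n) {..<k} = sum (p (Suc n)) {..<2 * k}" if "k \<le> 2 ^ n" for k
      by (rule sum_refine[OF p(3) that])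
    have "sum (p n) {..<j} \<le> sum (p (Suc n)) {..<J (Suc n)}"
      unfolding ref[OF less_imp_le[OF j]] by (rule sum_mono2) (auto simp: j_def p(1))
    also have "\<dots> \<le> y" by (rule J)
    finally have 1: "sum (p n) {..<j} \<le> y" .
    have "y < sum (p (Suc n)) {..<Suc (J (Suc n))}" by (rule J)
    also have "\<dots> \<le> sum (p n) {..<Suc j}"
      unfolding ref[OF Suc_leI[OF j]] by (rule sum_mono2) (auto simp: j_def p(1))
    finally have "J n = j" unfolding J_def by (intro quantile_index_eqI p(1) 1)
    then show ?thesis unfolding j_def by simp
  qed
  have "0 < p n (J n)" for n using J(2,3)[of n] by simp
  then have Y: "Y n \<in> K" "c n (Y n) = J n" for n
    using rep[of n "J n"] unfolding Y_def J_def by auto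
  show "Y n \<in> K" by (rule Y)
  have cY: "c n (Y m) = J n" if "n \<le> m" for n m
    using that
  proof (induction rule: inc_induct)
    case (step n)
    then show ?case using c[of n "Y m"] Jdiv[of n] by simp
  qed (rule Y)
  have near: "dist (Y m) (Y n) < \<delta>"
    if "\<And>x y. x \<in> K \<Longrightarrow> y \<in> K \<Longrightarrow> c n x = c n y \<Longrightarrow> dist x y < \<delta>" "n \<le> m" for n m \<delta>
    using that Y cY by simp
  have "Cauchy Y"
  proof (rule metric_CauchyI)
    fix e :: real assume "0 < e"
    then obtain n0 where n0: "\<And>x y. x \<in> K \<Longrightarrow> y \<in> K \<Longrightarrow> c n0 x = c n0 y \<Longrightarrow> dist x y < e"
      using sep[of e] by blast
    have "dist (Y m) (Y n) < e" if "m \<ge> n0" "n \<ge> n0" for m n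
      using n0[OF Y(1) Y(1)] cY that by simp
    then show "\<exists>M. \<forall>m\<ge>M. \<forall>n\<ge>M. dist (Y m) (Y n) < e" by blast
  qed
  then obtain l where l: "l \<in> K" "Y \<longlonglongrightarrow> l"
    using compact_imp_complete[OF \<open>compact K\<close>] Y(1) unfolding complete_def by blast
  have lim: "lim Y = l" using l(2) by (rule limI)
  then show "lim Y \<in> K" using l by simp
  assume \<delta>: "\<And>x y. x \<in> K \<Longrightarrow> y \<in> K \<Longrightarrow> c n x = c n y \<Longrightarrow> dist x y < \<delta>"
  have "(\<lambda>m. dist (Y m) (Y n)) \<longlonglongrightarrow> dist l (Y n)" by (intro tendsto_intros l)
  then show "dist (lim Y) (Y n) \<le> \<delta>"
    unfolding lim
    by (rule tendsto_upperbound)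
       (auto intro!: eventually_sequentiallyI[of n] less_imp_le near[OF \<delta>])
qed

section \<open>Sampling the weights with a uniform variable\<close>

definition unit_interval :: "real measure" where
  "unit_interval = restrict_space lborel {0..<1}"

lemma prob_space_unit_interval: "prob_space unit_interval"
  unfolding unit_interval_def
  by (rule prob_spaceI) (simp add: space_restrict_space emeasure_restrict_space)

lemma space_unit_interval: "space unit_interval = {0..<1}"
  unfolding unit_interval_def by (simp add: space_restrict_space)

lemma measurable_ident_unit_interval: "(\<lambda>y. y) \<in> unit_interval \<rightarrow>\<^sub>M borel"
  unfolding unit_interval_def by (intro measurable_restrict_space1) simp

text \<open>Inverse transform sampling: the \<open>y\<close> with index \<open>j\<close> fill a
  half-open interval of length \<open>p j\<close>, and these intervals tile [0,1).\<close>

lemma integral_quantile_index: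
  fixes f :: "nat \<Rightarrow> real"
  assumes p: "\<And>i. 0 \<le> p i" "sum p {..<N} = 1"
  shows "(LINT y|unit_interval. f (quantile_index p y)) = (\<Sum>j<N. f j * p j)"
proof -
  define A where "A j = {sum p {..<j}..<sum p {..<Suc j}}" for j
  have mono: "sum p {..<i} \<le> sum p {..<j}" if "i \<le> j" for i j
    by (rule sum_mono2) (use that p in auto)
  have "(LINT y|unit_interval. f (quantile_index p y)) =
      (LINT y|lborel. indicator {0..<1} y *\<^sub>R f (quantile_index p y))"
    unfolding unit_interval_def by (rule integral_restrict_space) simp
  also have "\<dots> = (LINT y|lborel. (\<Sum>j<N. f j * indicator (A j) y))"
  proof (rule Bochner_Integration.integral_cong[OF refl])
    fix y :: real
    show "indicator {0..<1} y *\<^sub>R f (quantile_index p y) = (\<Sum>j<N. f j * indicator (A j) y)"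
    proof (cases "y \<in> {0..<1}")
      case True
      note q = quantile_index_bounds[of p y N]
      have "y \<in> A j \<longleftrightarrow> j = quantile_index p y" if "j < N" for j
        using quantile_index_eqI[of p j y] q p True unfolding A_def by auto
      then have "(\<Sum>j<N. f j * indicator (A j) y) = (\<Sum>j<N. if j = quantile_index p y then f j else 0)"
        by (intro sum.cong) auto
      also have "\<dots> = f (quantile_index p y)" using q(1) p True by simp
      finally show ?thesis using True by simp
    next
      case False
      have "y \<notin> A j" if "j < N" for j
        using mono[of 0 j] mono[of "Suc j" N] that p(2) False unfolding A_def by auto
      then have "(\<Sum>j<N. f j * indicator (A j) y) = 0" by (intro sum.neutral) auto
      then show ?thesis using False by simp
    qed
  qed
  also have "\<dots> = (\<Sum>j<N. f j * p j)"
  proof -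
    have "emeasure lborel (A j) = ennreal (p j)" for j
      unfolding A_def using p(1) by (subst emeasure_lborel_Ico) auto
    then have "measure lborel (A j) = p j" "emeasure lborel (A j) < \<infinity>" for j
      using p(1) by (auto simp: measure_def)
    moreover have "A j \<in> sets lborel" for j unfolding A_def by simp
    ultimately show ?thesis by (subst Bochner_Integration.integral_sum) auto
  qed
  finally show ?thesis .
qed

lemma measurable_quantile_index:
  assumes [measurable]: "\<And>i. p i \<in> borel_measurable M"
  shows "(\<lambda>z. quantile_index (\<lambda>i. p i (fst z)) (snd z)) \<in> M \<Otimes>\<^sub>M unit_interval \<rightarrow>\<^sub>M count_space UNIV"
proof -
  have [measurable]: "snd \<in> M \<Otimes>\<^sub>M unit_interval \<rightarrow>\<^sub>M borel"
    by (rule measurable_compose[OF measurable_snd measurable_ident_unit_interval])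
  show ?thesis unfolding quantile_index_def by measurable
qed

text \<open>The kernel is realized by a jointly measurable map \<open>X\<close>, so its
  measurability in \<tau> comes from that of image measures. Convergence is obtained here for
  products of a time interval with a function of the state; general test functions are reached
  afterwards by a grid in time.\<close>

lemma young_measure_compactness:
  fixes u :: "nat \<Rightarrow> real \<Rightarrow> 'a::euclidean_space"
  assumes "compact K" and u [measurable]: "\<And>i. u i \<in> borel_measurable borel"
    and uK: "\<And>i \<tau>. u i \<tau> \<in> K"
  obtains r \<mu> where "strict_mono (r :: nat \<Rightarrow> nat)"
    and "\<mu> \<in> borel \<rightarrow>\<^sub>M prob_algebra borel"
    and "\<And>\<tau>. AE V in \<mu> \<tau>. V \<in> K"
    and "\<And>(g :: 'a \<Rightarrow> real) a b. continuous_on UNIV g \<Longrightarrow> 0 \<le> a \<Longrightarrow> a \<le> b \<Longrightarrow> b \<le> T \<Longrightarrow>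
      (\<lambda>i. LINT \<tau>:{a<..b}|lborel. g (u (r i) \<tau>))
        \<longlonglongrightarrow> (LINT \<tau>:{a<..b}|lborel. LINT V|\<mu> \<tau>. g V)"
proof -
  obtain c :: "nat \<Rightarrow> 'a \<Rightarrow> nat"
    where c [measurable]: "\<And>n. c n \<in> borel \<rightarrow>\<^sub>M count_space UNIV"
      and c_less: "\<And>n x. c n x < 2 ^ n"
      and c_div: "\<And>n x. c (Suc n) x div 2 = c n x"
      and sep: "\<And>\<delta>. 0 < \<delta> \<Longrightarrow> \<exists>n0. \<forall>n\<ge>n0. \<forall>x\<in>K. \<forall>y\<in>K. c n x = c n y \<longrightarrow> dist x y < \<delta>"
    using binary_partition_code[OF \<open>compact K\<close>] by metis
  \<comment> \<open>The restriction to [0,T] keeps these sets of finite measure; the densities are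
    accordingly normalized only there.\<close>
  define E where "E i = (\<lambda>(n, j). {\<tau>\<in>{0..T}. c n (u i \<tau>) = j})" for i
  have E_meas [measurable]: "E i q \<in> sets borel" for i q
  proof -
    obtain n j where q: "q = (n, j)" by (cases q)
    have "{\<tau>\<in>space borel. \<tau> \<in> {0..T} \<and> c n (u i \<tau>) = j} \<in> sets borel" by measurable
    then show ?thesis unfolding E_def q by simp
  qed
  have E_sub: "E i q \<subseteq> {0..T}" for i q unfolding E_def by (cases q) auto
  have E_fm: "E i q \<inter> {a<..b} \<in> fmeasurable lborel" for i q a b
  proof (rule fmeasurableI2[of "{0..T}"])
    show "{0..T} \<in> fmeasurable lborel" by (auto simp: fmeasurable_def emeasure_lborel_Icc_eq)
  qed (use E_sub[of i q] in auto)
  obtain r G H where r: "strict_mono (r :: nat \<Rightarrow> nat)"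
    and G [measurable]: "\<And>q. G q \<in> borel_measurable borel"
    and Hmono: "\<And>q s t. s \<le> t \<Longrightarrow> H q s \<le> H q t"
    and GH: "\<And>q a b. a \<le> b \<Longrightarrow> emeasure (density lborel (G q)) {a<..b} = ennreal (H q b - H q a)"
    and EH: "\<And>q a b. a \<le> b \<Longrightarrow> (\<lambda>i. measure lborel (E (r i) q \<inter> {a<..b})) \<longlonglongrightarrow> H q b - H q a"
    using weak_star_limit_indicators[of E T, OF E_meas E_sub] by metis
  have fin: "emeasure (density lborel (G q)) {a<..b} < \<infinity>" if "a \<le> b" for q a b
    using GH[OF that] by simp

  have E_split: "E i (n, j) = E i (Suc n, 2 * j) \<union> E i (Suc n, 2 * j + 1)" for i n j
  proof -
    have "c n x = j \<longleftrightarrow> c (Suc n) x = 2 * j \<or> c (Suc n) x = 2 * j + 1" for x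
      using c_div[of n x] by presburger
    then show ?thesis unfolding E_def by auto
  qed
  have refine_AE: "AE \<tau> in lborel. G (n, j) \<tau> = G (Suc n, 2 * j) \<tau> + G (Suc n, 2 * j + 1) \<tau>" for n j
  proof (rule AE_eq_of_Ioc)
    fix a b :: real assume ab: "a \<le> b"
    have "measure lborel (E i (n, j) \<inter> {a<..b}) = measure lborel (E i (Suc n, 2 * j) \<inter> {a<..b})
        + measure lborel (E i (Suc n, 2 * j + 1) \<inter> {a<..b})" for i
      unfolding E_split[of i n j] Int_Un_distrib2
      by (rule measure_Un_AE) (use E_fm in \<open>auto simp: E_def\<close>)
    then have "(\<lambda>i. measure lborel (E (r i) (n, j) \<inter> {a<..b})) \<longlonglongrightarrow>
        (H (Suc n, 2 * j) b - H (Suc n, 2 * j) a) + (H (Suc n, 2 * j + 1) b - H (Suc n, 2 * j + 1) a)"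
      using tendsto_add[OF EH[OF ab] EH[OF ab]] by simp
    then have eq: "H (n, j) b - H (n, j) a =
        (H (Suc n, 2 * j) b - H (Suc n, 2 * j) a) + (H (Suc n, 2 * j + 1) b - H (Suc n, 2 * j + 1) a)"
      using LIMSEQ_unique EH[OF ab] by blast
    have "emeasure (density lborel (\<lambda>\<tau>. G (Suc n, 2 * j) \<tau> + G (Suc n, 2 * j + 1) \<tau>)) {a<..b}
       = emeasure (density lborel (G (Suc n, 2 * j))) {a<..b} + emeasure (density lborel (G (Suc n, 2 * j + 1))) {a<..b}"
      by (simp add: emeasure_density distrib_right nn_integral_add)
    also have "\<dots> = emeasure (density lborel (G (n, j))) {a<..b}"
      unfolding GH[OF ab] eq using Hmono[OF ab] by (simp add: ennreal_plus)
    finally show "emeasure (density lborel (G (n, j))) {a<..b} =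
        emeasure (density lborel (\<lambda>\<tau>. G (Suc n, 2 * j) \<tau> + G (Suc n, 2 * j + 1) \<tau>)) {a<..b}" by simp
  qed (use fin in auto)
  have root_AE: "AE \<tau> in lborel. G (0, 0) \<tau> = indicator {0..T} \<tau>"
  proof (rule AE_eq_of_Ioc)
    fix a b :: real assume ab: "a \<le> b"
    have E0: "E i (0, 0) = {0..T}" for i unfolding E_def using c_less[of 0] by auto
    have "H (0, 0) b - H (0, 0) a = measure lborel ({0..T} \<inter> {a<..b})"
      using EH[OF ab, of "(0, 0)"] unfolding E0 by (simp add: LIMSEQ_const_iff)
    then have "emeasure (density lborel (G (0, 0))) {a<..b} = emeasure lborel ({0..T} \<inter> {a<..b})"
      using GH[OF ab, of "(0, 0)"] emeasure_eq_ennreal_measure[of lborel "{0..T} \<inter> {a<..b}"]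
        fmeasurableD2[OF E_fm[of 0 "(0, 0)" a b]] unfolding E0 by simp
    then show "emeasure (density lborel (G (0, 0))) {a<..b} = emeasure (density lborel (indicator {0..T})) {a<..b}"
      by (simp add: emeasure_density indicator_inter_arith[symmetric])
  qed (use fin in auto)
  have empty_AE: "AE \<tau> in lborel. (\<forall>x\<in>K. c n x \<noteq> j) \<longrightarrow> G (n, j) \<tau> = 0" for n j
  proof (cases "\<forall>x\<in>K. c n x \<noteq> j")
    case True
    have "AE \<tau> in lborel. G (n, j) \<tau> = (\<lambda>_. 0) \<tau>"
    proof (rule AE_eq_of_Ioc)
      fix a b :: real assume ab: "a \<le> b"
      have E0: "E i (n, j) = {}" for i unfolding E_def using True uK by auto
      have "H (n, j) b - H (n, j) a = 0"
        using EH[OF ab, of "(n, j)"] unfolding E0 by (simp add: LIMSEQ_const_iff)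
      then show "emeasure (density lborel (G (n, j))) {a<..b} = emeasure (density lborel (\<lambda>_. 0)) {a<..b}"
        unfolding GH[OF ab] by (simp add: emeasure_density)
    qed (use fin in auto)
    then show ?thesis by eventually_elim simp
  qed auto

  \<comment> \<open>The countably many relations between the densities hold almost everywhere each.
    At a good time all of them hold together, so the weights of each level form a probability vector
    that refines that of the level before.\<close>
  define good where "good \<tau> \<longleftrightarrow> \<tau> \<in> {0..T} \<and> G (0, 0) \<tau> = 1 \<and>
    (\<forall>n j. G (n, j) \<tau> = G (Suc n, 2 * j) \<tau> + G (Suc n, 2 * j + 1) \<tau>) \<and>
    (\<forall>n j. (\<forall>x\<in>K. c n x \<noteq> j) \<longrightarrow> G (n, j) \<tau> = 0)" for \<tau>
  have good_meas [measurable]: "Measurable.pred borel good"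
    unfolding good_def[abs_def] by measurable
  have "AE \<tau> in lborel. \<forall>n j. G (n, j) \<tau> = G (Suc n, 2 * j) \<tau> + G (Suc n, 2 * j + 1) \<tau>"
    unfolding AE_all_countable using refine_AE by blast
  moreover have "AE \<tau> in lborel. \<forall>n j. (\<forall>x\<in>K. c n x \<noteq> j) \<longrightarrow> G (n, j) \<tau> = 0"
    unfolding AE_all_countable using empty_AE by blast
  moreover have "AE \<tau> in lborel. \<tau> \<in> {0..T} \<longrightarrow> G (0, 0) \<tau> = 1"
    using root_AE by eventually_elim simp
  ultimately have good_AE: "AE \<tau> in lborel. \<tau> \<in> {0..T} \<longrightarrow> good \<tau>"
    unfolding good_def by eventually_elim blast
  have goodD: "G (0, 0) \<tau> = 1" "G (n, j) \<tau> = G (Suc n, 2 * j) \<tau> + G (Suc n, 2 * j + 1) \<tau>"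
      "(\<forall>x\<in>K. c n x \<noteq> j) \<Longrightarrow> G (n, j) \<tau> = 0" if "good \<tau>" for \<tau> n j
    using that unfolding good_def by blast+
  \<comment> \<open>A density is bounded by that of its parent cell and finally by the root value 1.
    It is thus finite, and \<open>enn2real\<close> loses nothing.\<close>
  have G_le1: "G (n, j) \<tau> \<le> 1" if "good \<tau>" for n j \<tau>
  proof (induction n arbitrary: j)
    case 0
    show ?case
    proof (cases "j = 0")
      case False
      then have "\<forall>x\<in>K. c 0 x \<noteq> j" using c_less[of 0] by auto
      then show ?thesis using goodD(3)[OF that] by simp
    qed (use goodD(1)[OF that] in simp)
  next
    case (Suc n)
    have "G (n, j div 2) \<tau> = G (Suc n, 2 * (j div 2)) \<tau> + G (Suc n, 2 * (j div 2) + 1) \<tau>"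
      by (rule goodD(2)[OF that])
    moreover have "j = 2 * (j div 2) \<or> j = 2 * (j div 2) + 1" by presburger
    ultimately have "G (Suc n, j) \<tau> \<le> G (n, j div 2) \<tau>" by (metis add_increasing add_increasing2 order_refl zero_le)
    then show ?case using Suc.IH order_trans by blast
  qed
  define p where "p n j \<tau> = (if good \<tau> then enn2real (G (n, j) \<tau>) else 0)" for n j \<tau>
  have p_meas [measurable]: "p n j \<in> borel_measurable borel" for n j
    unfolding p_def[abs_def] by measurable
  have p0: "0 \<le> p n j \<tau>" and p1: "p n j \<tau> \<le> 1" for n j \<tau>
    using G_le1[of \<tau> n j] enn2real_mono[of "G (n, j) \<tau>" 1] unfolding p_def by auto
  have pG: "ennreal (p n j \<tau>) = G (n, j) \<tau>" if "good \<tau>" for n j \<tau>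
    using G_le1[OF that, of n j] that unfolding p_def
    by (simp add: ennreal_enn2real_if top_unique) (metis ennreal_one_neq_top neq_top_trans)
  have p_split: "p n j \<tau> = p (Suc n) (2 * j) \<tau> + p (Suc n) (2 * j + 1) \<tau>" if "good \<tau>" for n j \<tau>
  proof -
    have "ennreal (p n j \<tau>) = ennreal (p (Suc n) (2 * j) \<tau> + p (Suc n) (2 * j + 1) \<tau>)"
      using p0 by (simp add: ennreal_plus pG[OF that] goodD(2)[OF that, of n j])
    then show ?thesis using p0 by (subst (asm) ennreal_inj) auto
  qed
  have p_sum: "sum (\<lambda>j. p n j \<tau>) {..<2 ^ n} = 1" if "good \<tau>" for n \<tau>
  proof (induction n)
    case 0
    show ?case using that goodD(1)[OF that] by (simp add: p_def)
  next
    case (Suc n)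
    then show ?case using sum_refine[of "2 ^ n" "\<lambda>j. p n j \<tau>" "\<lambda>j. p (Suc n) j \<tau>" "2 ^ n",
        OF p_split[OF that] order_refl]
      by simp
  qed

  \<comment> \<open>Cells that miss \<open>K\<close> carry weight zero at good times, so a default
    suffices for them; \<open>u 0 0\<close> is an available point of \<open>K\<close>.\<close>
  define rep where "rep n j = (if \<exists>x\<in>K. c n x = j then SOME x. x \<in> K \<and> c n x = j else u 0 0)" for n j
  have rep: "rep n j \<in> K \<and> c n (rep n j) = j" if "\<exists>x\<in>K. c n x = j" for n j
    using someI_ex[of "\<lambda>x. x \<in> K \<and> c n x = j"] that unfolding rep_def by auto
  have rep_p: "rep n j \<in> K \<and> c n (rep n j) = j" if "0 < p n j \<tau>" for n j \<tau>
  proof (rule rep, rule ccontr)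
    assume "\<not> (\<exists>x\<in>K. c n x = j)"
    then have "p n j \<tau> = 0" unfolding p_def using goodD(3)[of \<tau> n j] by auto
    then show False using that by simp
  qed
  define Y where "Y n = (\<lambda>(\<tau>, y). rep n (quantile_index (\<lambda>j. p n j \<tau>) y))" for n
  \<comment> \<open>The constant value at exceptional times lies in \<open>K\<close>, so that the
    measure is concentrated on \<open>K\<close> for every \<tau>.\<close>
  define X where "X = (\<lambda>(\<tau>, y). if good \<tau> then lim (\<lambda>n. Y n (\<tau>, y)) else u 0 0)"
  have Y_meas [measurable]: "Y n \<in> borel \<Otimes>\<^sub>M unit_interval \<rightarrow>\<^sub>M borel" for n
    unfolding Y_def split_beta'
    by (rule measurable_compose[OF measurable_quantile_index]) measurable
  have X_meas [measurable]: "X \<in> borel \<Otimes>\<^sub>M unit_interval \<rightarrow>\<^sub>M borel"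
    unfolding X_def split_beta' by measurable
  have Y_meas2: "(\<lambda>y. Y n (\<tau>, y)) \<in> unit_interval \<rightarrow>\<^sub>M borel"
    and X_meas2: "(\<lambda>y. X (\<tau>, y)) \<in> unit_interval \<rightarrow>\<^sub>M borel" for n \<tau>
    by (rule measurable_compose[OF measurable_Pair1' Y_meas] measurable_compose[OF measurable_Pair1' X_meas]; simp)+
  have X_facts: "Y n (\<tau>, y) \<in> K" "X (\<tau>, y) \<in> K"
     "(\<And>x y. x \<in> K \<Longrightarrow> y \<in> K \<Longrightarrow> c n x = c n y \<Longrightarrow> dist x y < \<delta>) \<Longrightarrow> dist (X (\<tau>, y)) (Y n (\<tau>, y)) \<le> \<delta>"
    if "good \<tau>" "y \<in> space unit_interval" for n \<tau> y \<delta>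
  proof -
    have "0 \<le> y" "y < 1" using that(2) unfolding space_unit_interval by auto
    note y = this
    note side = \<open>compact K\<close> c_div p0 p_sum[OF that(1)] p_split[OF that(1)] y
    note lim = cell_refinement_limit[where K = K and c = c and p = "\<lambda>n j. p n j \<tau>" and rep = rep and y = y]
    have Y: "Y n (\<tau>, y) = rep n (quantile_index (\<lambda>j. p n j \<tau>) y)" for n
      unfolding Y_def by simp
    have X: "X (\<tau>, y) = lim (\<lambda>n. rep n (quantile_index (\<lambda>j. p n j \<tau>) y))"
      using that(1) unfolding X_def by (simp add: Y)
    show "Y n (\<tau>, y) \<in> K" unfolding Y by (rule lim(1); (rule side | erule sep | erule rep_p))
    show "X (\<tau>, y) \<in> K" unfolding X by (rule lim(2); (rule side | erule sep | erule rep_p))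
    show "dist (X (\<tau>, y)) (Y n (\<tau>, y)) \<le> \<delta>"
      if near: "\<And>x y. x \<in> K \<Longrightarrow> y \<in> K \<Longrightarrow> c n x = c n y \<Longrightarrow> dist x y < \<delta>"
      unfolding X Y by (rule lim(3); (rule side | erule sep | erule rep_p | (rule near; assumption)))
  qed
  have XK: "X (\<tau>, y) \<in> K" if "y \<in> space unit_interval" for \<tau> y
    using X_facts(2)[of \<tau> y] that uK unfolding X_def by (cases "good \<tau>") auto
  interpret R: prob_space unit_interval by (rule prob_space_unit_interval)
  define \<mu> where "\<mu> \<tau> = distr unit_interval borel (\<lambda>y. X (\<tau>, y))" for \<tau>
  have sets_\<mu> [simp]: "sets (\<mu> \<tau>) = sets borel" for \<tau> unfolding \<mu>_def by simp
  have "\<mu> \<in> borel \<rightarrow>\<^sub>M subprob_algebra borel"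
    unfolding \<mu>_def[abs_def]
  proof (rule measurable_distr2[where M = unit_interval])
    show "(\<lambda>x. unit_interval) \<in> borel \<rightarrow>\<^sub>M subprob_algebra unit_interval"
      by (intro measurable_const) (simp add: space_subprob_algebra R.subprob_space_axioms)
  qed simp
  moreover have prob_\<mu>: "prob_space (\<mu> \<tau>)" for \<tau>
    unfolding \<mu>_def by (rule R.prob_space_distr[OF X_meas2])
  ultimately have \<mu>_meas: "\<mu> \<in> borel \<rightarrow>\<^sub>M prob_algebra borel"
    by (auto simp: measurable_prob_algebraI)
  have \<mu>K: "AE V in \<mu> \<tau>. V \<in> K" for \<tau>
    unfolding \<mu>_def using compact_imp_closed[OF \<open>compact K\<close>]
    by (subst AE_distr_iff[OF X_meas2]) (auto intro!: AE_I2 XK)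

  \<comment> \<open>On both sides \<open>g\<close> is replaced by its value at the representative of
    the level-n cell. This leaves finite combinations of cell indicators, respectively of their
    densities, and their convergence is \<open>EH\<close>.\<close>
  have conv: "(\<lambda>i. LINT \<tau>:{a<..b}|lborel. g (u (r i) \<tau>))
        \<longlonglongrightarrow> (LINT \<tau>:{a<..b}|lborel. LINT V|\<mu> \<tau>. g V)"
    if g: "continuous_on UNIV g" and ab: "0 \<le> a" "a \<le> b" "b \<le> T" for g :: "'a \<Rightarrow> real" and a b
  proof (rule LIMSEQ_uniform_approx)
    fix \<eta> :: real assume "0 < \<eta>"
    have g_meas [measurable]: "g \<in> borel_measurable borel" by (rule borel_measurable_continuous_onI[OF g])
    have gK: "continuous_on K g" using g continuous_on_subset by blast
    obtain B where B: "\<And>x. x \<in> K \<Longrightarrow> \<bar>g x\<bar> \<le> B"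
      using compact_imp_bounded[OF compact_continuous_image[OF gK \<open>compact K\<close>]]
      unfolding bounded_iff by auto
    \<comment> \<open>The summand 1 admits the degenerate interval a = b.\<close>
    define \<theta> where "\<theta> = \<eta> / (b - a + 1)"
    have \<theta>: "0 < \<theta>" "\<theta> * (b - a) \<le> \<eta>" using \<open>0 < \<eta>\<close> ab unfolding \<theta>_def by (auto simp: field_simps)
    obtain \<delta> where \<delta>: "0 < \<delta>" "\<And>x y. x \<in> K \<Longrightarrow> y \<in> K \<Longrightarrow> dist x y < \<delta> \<Longrightarrow> \<bar>g x - g y\<bar> < \<theta>"
      using compact_uniformly_continuous[OF gK \<open>compact K\<close>] \<theta>(1)
      unfolding uniformly_continuous_on_def dist_real_def by metis
    \<comment> \<open>Half of \<delta>, because the distance to the limit point \<open>X\<close> is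
      bounded only non-strictly whereas \<delta> asks for a strict bound.\<close>
    obtain n where n: "\<And>x y. x \<in> K \<Longrightarrow> y \<in> K \<Longrightarrow> c n x = c n y \<Longrightarrow> dist x y < \<delta> / 2"
      using sep[of "\<delta> / 2"] \<delta>(1) by auto
    define S where "S i = (\<Sum>j<2 ^ n. g (rep n j) * measure lborel (E (r i) (n, j) \<inter> {a<..b}))" for i
    define L where "L = (\<Sum>j<2 ^ n. g (rep n j) * (H (n, j) b - H (n, j) a))"
    have "S \<longlonglongrightarrow> L" unfolding S_def L_def by (intro tendsto_intros EH ab)
    moreover have "\<bar>(LINT \<tau>:{a<..b}|lborel. g (u (r i) \<tau>)) - S i\<bar> \<le> \<eta>" for i
    proof -
      have rc: "rep n (c n (u (r i) \<tau>)) \<in> K" "c n (rep n (c n (u (r i) \<tau>))) = c n (u (r i) \<tau>)" for \<tau>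
        using rep[of n "c n (u (r i) \<tau>)"] uK by blast+
      have "S i = (LINT \<tau>:{a<..b}|lborel. g (rep n (c n (u (r i) \<tau>))))"
      proof -
        have "(LINT \<tau>:{a<..b}|lborel. g (rep n (c n (u (r i) \<tau>)))) =
           (LINT \<tau>|lborel. (\<Sum>j<2 ^ n. g (rep n j) * indicator (E (r i) (n, j) \<inter> {a<..b}) \<tau>))"
          unfolding set_lebesgue_integral_def
        proof (rule Bochner_Integration.integral_cong[OF refl])
          fix \<tau> :: real
          show "indicator {a<..b} \<tau> *\<^sub>R g (rep n (c n (u (r i) \<tau>))) =
              (\<Sum>j<2 ^ n. g (rep n j) * indicator (E (r i) (n, j) \<inter> {a<..b}) \<tau>)"
          proof (cases "\<tau> \<in> {a<..b}")
            case True
            then have "(\<Sum>j<2 ^ n. g (rep n j) * indicator (E (r i) (n, j) \<inter> {a<..b}) \<tau>) =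
                (\<Sum>j<2 ^ n. if j = c n (u (r i) \<tau>) then g (rep n j) else 0)"
              using ab by (intro sum.cong) (auto simp: E_def)
            then show ?thesis using True c_less by simp
          qed simp
        qed
        also have "\<dots> = S i"
        proof -
          have "emeasure lborel (E (r i) (n, j) \<inter> {a<..b}) < \<infinity>" for j
            using E_fm[of "r i" "(n, j)" a b] by (simp add: fmeasurable_def)
          then show ?thesis unfolding S_def by (subst Bochner_Integration.integral_sum) auto
        qed
        finally show ?thesis by simp
      qed
      moreover have "\<bar>(LINT \<tau>:{a<..b}|lborel. g (u (r i) \<tau>)) - (LINT \<tau>:{a<..b}|lborel. g (rep n (c n (u (r i) \<tau>))))\<bar> \<le> \<theta> * (b - a)"
      proof (rule set_integral_Ioc_diff_le)
        show "set_integrable lborel {a<..b} (\<lambda>\<tau>. g (u (r i) \<tau>))"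
          by (rule set_integrable_Ioc_bounded[where B = B]) (use B uK in auto)
        have "(\<lambda>\<tau>. g (rep n (c n (u (r i) \<tau>)))) \<in> borel_measurable borel" by measurable
        then show "set_integrable lborel {a<..b} (\<lambda>\<tau>. g (rep n (c n (u (r i) \<tau>))))"
          by (rule set_integrable_Ioc_bounded[where B = B]) (use B rc in auto)
        have "\<bar>g (u (r i) \<tau>) - g (rep n (c n (u (r i) \<tau>)))\<bar> \<le> \<theta>" for \<tau>
        proof (intro less_imp_le \<delta>(2) uK rc(1))
          have "dist (u (r i) \<tau>) (rep n (c n (u (r i) \<tau>))) < \<delta> / 2"
            by (rule n[OF uK rc(1) rc(2)[symmetric]])
          then show "dist (u (r i) \<tau>) (rep n (c n (u (r i) \<tau>))) < \<delta>" using \<delta>(1) by linarith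
        qed
        then show "AE \<tau> in lborel. \<tau> \<in> {a<..b} \<longrightarrow> \<bar>g (u (r i) \<tau>) - g (rep n (c n (u (r i) \<tau>)))\<bar> \<le> \<theta>" by simp
      qed (use ab in auto)
      ultimately show ?thesis using \<theta> by simp
    qed
    moreover have "\<bar>(LINT \<tau>:{a<..b}|lborel. LINT V|\<mu> \<tau>. g V) - L\<bar> \<le> \<eta>"
    proof -
      have gX: "(LINT V|\<mu> \<tau>. g V) = (LINT y|unit_interval. g (X (\<tau>, y)))" for \<tau>
        unfolding \<mu>_def by (rule integral_distr[OF X_meas2 g_meas])
      have gX_int: "integrable unit_interval (\<lambda>y. g (X (\<tau>, y)))" for \<tau>
        using measurable_compose[OF X_meas2 g_meas] B XK
        by (intro R.integrable_const_bound[where B = B]) (auto intro!: AE_I2)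
      have gX_le: "\<bar>LINT y|unit_interval. g (X (\<tau>, y))\<bar> \<le> B" for \<tau>
      proof -
        have "\<bar>LINT y|unit_interval. g (X (\<tau>, y))\<bar> \<le> (LINT y|unit_interval. \<bar>g (X (\<tau>, y))\<bar>)"
          by (rule integral_abs_bound)
        also have "\<dots> \<le> B" using gX_int B XK by (intro R.integral_le_const) (auto intro!: AE_I2)
        finally show ?thesis .
      qed
      have gX_meas: "(\<lambda>\<tau>. LINT y|unit_interval. g (X (\<tau>, y))) \<in> borel_measurable borel"
        by measurable
      have p_int: "set_integrable lborel {a<..b} (p n j)" for j
        by (rule set_integrable_Ioc_bounded[where B = 1]) (use p0 p1 in auto)
      have pH: "(LINT \<tau>:{a<..b}|lborel. p n j \<tau>) = H (n, j) b - H (n, j) a" for j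
      proof -
        have "(LINT \<tau>:{a<..b}|lborel. p n j \<tau>) = enn2real (\<integral>\<^sup>+\<tau>. ennreal (indicator {a<..b} \<tau> *\<^sub>R p n j \<tau>) \<partial>lborel)"
          unfolding set_lebesgue_integral_def by (rule integral_eq_nn_integral) (use p0 in auto)
        also have "(\<integral>\<^sup>+\<tau>. ennreal (indicator {a<..b} \<tau> *\<^sub>R p n j \<tau>) \<partial>lborel) =
            (\<integral>\<^sup>+\<tau>. G (n, j) \<tau> * indicator {a<..b} \<tau> \<partial>lborel)"
          using good_AE
          by (intro nn_integral_cong_AE, eventually_elim) (use pG ab in \<open>auto simp: indicator_def\<close>)
        also have "\<dots> = ennreal (H (n, j) b - H (n, j) a)"
          using GH[OF ab(2), of "(n, j)"] by (simp add: emeasure_density)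
        finally show ?thesis using Hmono[OF ab(2), of "(n, j)"] by simp
      qed
      have sum_int: "set_integrable lborel {a<..b} (\<lambda>\<tau>. \<Sum>j<2 ^ n. g (rep n j) * p n j \<tau>)"
        using p_int unfolding set_integrable_def scaleR_sum_right
        by (intro Bochner_Integration.integrable_sum) (auto simp: mult.left_commute)
      have "(LINT \<tau>:{a<..b}|lborel. (\<Sum>j<2 ^ n. g (rep n j) * p n j \<tau>)) = L"
      proof -
        have "(LINT \<tau>:{a<..b}|lborel. (\<Sum>j<2 ^ n. g (rep n j) * p n j \<tau>)) =
          (\<Sum>j<2 ^ n. LINT \<tau>:{a<..b}|lborel. g (rep n j) * p n j \<tau>)"
          unfolding set_lebesgue_integral_def scaleR_sum_right
          using p_int by (intro Bochner_Integration.integral_sum) (auto simp: set_integrable_def mult.left_commute)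
        then show ?thesis unfolding L_def by (simp add: pH)
      qed
      moreover have "\<bar>(LINT \<tau>:{a<..b}|lborel. LINT V|\<mu> \<tau>. g V) - (LINT \<tau>:{a<..b}|lborel. (\<Sum>j<2 ^ n. g (rep n j) * p n j \<tau>))\<bar> \<le> \<theta> * (b - a)"
        unfolding gX
      proof (rule set_integral_Ioc_diff_le)
        show "set_integrable lborel {a<..b} (\<lambda>\<tau>. LINT y|unit_interval. g (X (\<tau>, y)))"
          by (rule set_integrable_Ioc_bounded[OF gX_meas gX_le])
        show "AE \<tau> in lborel. \<tau> \<in> {a<..b} \<longrightarrow>
            \<bar>(LINT y|unit_interval. g (X (\<tau>, y))) - (\<Sum>j<2 ^ n. g (rep n j) * p n j \<tau>)\<bar> \<le> \<theta>"
          using good_AE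
        proof (eventually_elim, intro impI)
          fix \<tau> assume "\<tau> \<in> {0..T} \<longrightarrow> good \<tau>" "\<tau> \<in> {a<..b}"
          then have good: "good \<tau>" using ab by auto
          have eq: "(\<Sum>j<2 ^ n. g (rep n j) * p n j \<tau>) = (LINT y|unit_interval. g (Y n (\<tau>, y)))"
            unfolding Y_def using integral_quantile_index[OF p0 p_sum[OF good], of "\<lambda>j. g (rep n j)" n] by simp
          have gY_int: "integrable unit_interval (\<lambda>y. g (Y n (\<tau>, y)))"
            using measurable_compose[OF Y_meas2 g_meas] B X_facts(1)[OF good]
            by (intro R.integrable_const_bound[where B = B]) (auto intro!: AE_I2)
          have "\<bar>LINT y|unit_interval. g (X (\<tau>, y)) - g (Y n (\<tau>, y))\<bar> \<le> (LINT y|unit_interval. \<bar>g (X (\<tau>, y)) - g (Y n (\<tau>, y))\<bar>)"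
            by (rule integral_abs_bound)
          also have "\<dots> \<le> \<theta>"
          proof (rule R.integral_le_const)
            show "integrable unit_interval (\<lambda>y. \<bar>g (X (\<tau>, y)) - g (Y n (\<tau>, y))\<bar>)"
              using gX_int gY_int by auto
            show "AE y in unit_interval. \<bar>g (X (\<tau>, y)) - g (Y n (\<tau>, y))\<bar> \<le> \<theta>"
            proof (rule AE_I2)
              fix y assume y: "y \<in> space unit_interval"
              have "dist (X (\<tau>, y)) (Y n (\<tau>, y)) \<le> \<delta> / 2" by (rule X_facts(3)[OF good y n])
              then show "\<bar>g (X (\<tau>, y)) - g (Y n (\<tau>, y))\<bar> \<le> \<theta>"
                using \<delta>(1) by (intro less_imp_le \<delta>(2) X_facts[OF good y]) simp
            qed
          qed
          finally show "\<bar>(LINT y|unit_interval. g (X (\<tau>, y))) - (\<Sum>j<2 ^ n. g (rep n j) * p n j \<tau>)\<bar> \<le> \<theta>"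
            unfolding eq using gX_int gY_int by simp
        qed
      qed (use ab sum_int in auto)
      ultimately show ?thesis using \<theta> by simp
    qed
    ultimately show "\<exists>S L. S \<longlonglongrightarrow> L \<and> (\<forall>i. \<bar>(LINT \<tau>:{a<..b}|lborel. g (u (r i) \<tau>)) - S i\<bar> \<le> \<eta>) \<and>
        \<bar>(LINT \<tau>:{a<..b}|lborel. LINT V|\<mu> \<tau>. g V) - L\<bar> \<le> \<eta>" by blast
  qed
  show thesis by (rule that[OF r \<mu>_meas \<mu>K conv])
qed

section \<open>From products of a time interval and a state function to general test
  functions\<close>

lemma borel_measurable_kernel_integral:
  fixes f :: "'a \<times> 'b \<Rightarrow> real"
  assumes f [measurable]: "f \<in> borel_measurable (M \<Otimes>\<^sub>M N)"
    and L [measurable]: "L \<in> M \<rightarrow>\<^sub>M subprob_algebra N"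
  shows "(\<lambda>x. LINT y|L x. f (x, y)) \<in> borel_measurable M"
proof -
  have "(\<lambda>x. distr (L x) (M \<Otimes>\<^sub>M N) (\<lambda>y. (x, y))) \<in> M \<rightarrow>\<^sub>M subprob_algebra (M \<Otimes>\<^sub>M N)"
    by (rule measurable_distr2[OF _ L]) simp
  from measurable_compose[OF this integral_measurable_subprob_algebra[OF f]]
  have "(\<lambda>x. LINT z|distr (L x) (M \<Otimes>\<^sub>M N) (\<lambda>y. (x, y)). f z) \<in> borel_measurable M" .
  moreover have "(LINT z|distr (L x) (M \<Otimes>\<^sub>M N) (\<lambda>y. (x, y)). f z) = (LINT y|L x. f (x, y))"
    if "x \<in> space M" for x
  proof (rule integral_distr[OF _ f])
    show "(\<lambda>y. (x, y)) \<in> L x \<rightarrow>\<^sub>M M \<Otimes>\<^sub>M N"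
      using measurable_Pair1'[OF that, of N] by (simp add: measurable_cong_sets[OF sets_kernel[OF L that] refl])
  qed
  ultimately show ?thesis by (simp cong: measurable_cong)
qed

text \<open>Nonnegativity allows both functions, cut off to (0,T], to be read as densities of
  measures, which are determined by intervals. The missing time 0 is a null set.\<close>

lemma AE_eq_of_set_integral_Ioc:
  fixes f g :: "real \<Rightarrow> real"
  assumes [measurable]: "f \<in> borel_measurable borel" "g \<in> borel_measurable borel"
    and f: "\<And>t. 0 \<le> f t \<and> f t \<le> B" and g: "\<And>t. 0 \<le> g t \<and> g t \<le> B"
    and eq: "\<And>a b. 0 \<le> a \<Longrightarrow> a \<le> b \<Longrightarrow> b \<le> T \<Longrightarrow>
      (LINT t:{a<..b}|lborel. f t) = (LINT t:{a<..b}|lborel. g t)"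
  shows "AE t in lborel. t \<in> {0..T} \<longrightarrow> f t = g t"
proof -
  have nn: "(\<integral>\<^sup>+t. ennreal (indicator {0<..T} t * h t) * indicator {a<..b} t \<partial>lborel)
      = ennreal (LINT t:{max 0 a<..min T b}|lborel. h t)"
    if [measurable]: "h \<in> borel_measurable borel" and h: "\<And>t. 0 \<le> h t \<and> h t \<le> B" for h :: "real \<Rightarrow> real" and a b
  proof -
    have int: "set_integrable lborel {max 0 a<..min T b} h"
      by (rule set_integrable_Ioc_bounded[where B = B]) (use h in \<open>auto simp: abs_of_nonneg\<close>)
    have "(\<integral>\<^sup>+t. ennreal (indicator {0<..T} t * h t) * indicator {a<..b} t \<partial>lborel)
        = (\<integral>\<^sup>+t. ennreal (indicator {max 0 a<..min T b} t *\<^sub>R h t) \<partial>lborel)"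
      by (intro nn_integral_cong) (auto simp: indicator_def)
    also have "\<dots> = ennreal (LINT t:{max 0 a<..min T b}|lborel. h t)"
      unfolding set_lebesgue_integral_def
      by (rule nn_integral_eq_integral) (use int h in \<open>auto simp: set_integrable_def\<close>)
    finally show ?thesis .
  qed
  have "AE t in lborel. ennreal (indicator {0<..T} t * f t) = ennreal (indicator {0<..T} t * g t)"
  proof (rule AE_eq_of_Ioc)
    fix a b :: real
    have "(LINT t:{max 0 a<..min T b}|lborel. f t) = (LINT t:{max 0 a<..min T b}|lborel. g t)"
    proof (cases "max 0 a \<le> min T b")
      case True
      then show ?thesis by (intro eq) auto
    next
      case False
      then have "{max 0 a<..min T b} = {}" by (intro greaterThanAtMost_empty) linarith
      then show ?thesis by (simp only:) (simp add: set_lebesgue_integral_def)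
    qed
    then show "emeasure (density lborel (\<lambda>t. ennreal (indicator {0<..T} t * f t))) {a<..b}
        = emeasure (density lborel (\<lambda>t. ennreal (indicator {0<..T} t * g t))) {a<..b}"
      by (simp add: emeasure_density nn[OF assms(1) f] nn[OF assms(2) g])
    show "emeasure (density lborel (\<lambda>t. ennreal (indicator {0<..T} t * f t))) {a<..b} < \<infinity>"
      by (simp add: emeasure_density nn[OF assms(1) f])
  qed auto
  then show ?thesis
    using AE_lborel_singleton[of 0]
  proof eventually_elim
    case (elim t)
    have "f t = g t" if "t \<in> {0..T}"
    proof -
      have "indicator {0<..T} t = (1 :: real)" using that elim(2) by auto
      then show ?thesis using elim(1) f[of t] g[of t] by simp
    qed
    then show ?case by blast
  qed
qed

lemma set_integral_Ioc_partition:
  fixes F :: "real \<Rightarrow> real"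
  assumes "incseq t" and F: "set_integrable lborel {t 0<..t N} F"
  shows "(LINT \<tau>:{t 0<..t N}|lborel. F \<tau>) = (\<Sum>k<N. LINT \<tau>:{t k<..t (Suc k)}|lborel. F \<tau>)"
  using F
proof (induction N)
  case (Suc N)
  have le: "t 0 \<le> t N" "t N \<le> t (Suc N)" using \<open>incseq t\<close> by (auto simp: incseq_def)
  have sub: "set_integrable lborel {t 0<..t N} F" "set_integrable lborel {t N<..t (Suc N)} F"
    by (rule set_integrable_subset[OF Suc.prems]; use le in auto)+
  have "{t 0<..t (Suc N)} = {t 0<..t N} \<union> {t N<..t (Suc N)}" using le by auto
  then have "(LINT \<tau>:{t 0<..t (Suc N)}|lborel. F \<tau>) =
      (LINT \<tau>:{t 0<..t N}|lborel. F \<tau>) + (LINT \<tau>:{t N<..t (Suc N)}|lborel. F \<tau>)"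
    using set_integral_Un[OF _ sub] by (simp add: Int_greaterThanAtMost)
  then show ?case using Suc.IH[OF sub(1)] by simp
qed (simp add: set_lebesgue_integral_def)

text \<open>A point is a null set and does not affect integrability either; for a nonintegrable
  function both sides are 0 by the convention of the Bochner integral.\<close>

lemma set_integral_Icc_eq_Ioc:
  fixes F :: "real \<Rightarrow> real"
  shows "(LINT \<tau>:{a..b}|lborel. F \<tau>) = (LINT \<tau>:{a<..b}|lborel. F \<tau>)"
proof -
  have "(LINT \<tau>:{a..b}|lborel. F \<tau>) = (LINT \<tau>|lborel. indicator {a<..b} \<tau> *\<^sub>R F \<tau> + indicator {a} \<tau> *\<^sub>R (if a \<le> b then F a else 0))"
    unfolding set_lebesgue_integral_def
    by (intro Bochner_Integration.integral_cong) (auto simp: indicator_def)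
  also have "\<dots> = (LINT \<tau>:{a<..b}|lborel. F \<tau>)"
  proof (cases "integrable lborel (\<lambda>\<tau>. indicator {a<..b} \<tau> *\<^sub>R F \<tau>)")
    case True
    then show ?thesis unfolding set_lebesgue_integral_def by simp
  next
    case False
    have i: "integrable lborel (\<lambda>\<tau>. indicator {a} \<tau> *\<^sub>R (if a \<le> b then F a else 0))" by simp
    have "\<not> integrable lborel (\<lambda>\<tau>. indicator {a<..b} \<tau> *\<^sub>R F \<tau> + indicator {a} \<tau> *\<^sub>R (if a \<le> b then F a else 0))"
    proof
      assume "integrable lborel (\<lambda>\<tau>. indicator {a<..b} \<tau> *\<^sub>R F \<tau> + indicator {a} \<tau> *\<^sub>R (if a \<le> b then F a else 0))"
      from Bochner_Integration.integrable_diff[OF this i] show False using False by simp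
    qed
    then show ?thesis using False unfolding set_lebesgue_integral_def by (simp add: not_integrable_integral_eq)
  qed
  finally show ?thesis .
qed

text \<open>On the compact set [0,T] x K the function \<open>f\<close> is uniformly continuous.
  Freezing its time argument at the left endpoints of a fine grid thus costs little, and each frozen
  integrand depends on the state alone, so that \<open>conv\<close> applies to it.\<close>

lemma young_convergence_of_rectangles:
  fixes u :: "nat \<Rightarrow> real \<Rightarrow> 'a::euclidean_space" and f :: "real \<times> 'a \<Rightarrow> real"
  assumes "0 < T" "compact K" and u [measurable]: "\<And>i. u i \<in> borel_measurable borel"
    and uK: "\<And>i \<tau>. u i \<tau> \<in> K"
    and \<mu>: "\<mu> \<in> borel \<rightarrow>\<^sub>M prob_algebra borel" and \<mu>K: "\<And>\<tau>. AE V in \<mu> \<tau>. V \<in> K"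
    and conv: "\<And>(g :: 'a \<Rightarrow> real) a b. continuous_on UNIV g \<Longrightarrow> 0 \<le> a \<Longrightarrow> a \<le> b \<Longrightarrow> b \<le> T \<Longrightarrow>
      (\<lambda>i. LINT \<tau>:{a<..b}|lborel. g (u i \<tau>)) \<longlonglongrightarrow> (LINT \<tau>:{a<..b}|lborel. LINT V|\<mu> \<tau>. g V)"
    and f: "continuous_on ({0..T} \<times> UNIV) f"
  shows "(\<lambda>i. LINT \<tau>:{0..T}|lborel. f (\<tau>, u i \<tau>)) \<longlonglongrightarrow> (LINT \<tau>:{0..T}|lborel. LINT V|\<mu> \<tau>. f (\<tau>, V))"
proof (rule LIMSEQ_uniform_approx)
  fix \<eta> :: real assume "0 < \<eta>"
  \<comment> \<open>Continuity of \<open>f\<close> is known only on the strip; the extension by zero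
    is Borel on the whole product space.\<close>
  define F where "F z = indicator ({0..T} \<times> UNIV) z *\<^sub>R f z" for z
  have F_meas: "F \<in> borel_measurable (borel \<Otimes>\<^sub>M borel)"
    unfolding F_def[abs_def] borel_prod
    by (rule borel_measurable_continuous_on_indicator[OF _ f]) (auto intro!: borel_closed closed_Times)
  note F_meas[measurable]
  have prob_\<mu>: "prob_space (\<mu> \<tau>)" and sets_\<mu>: "sets (\<mu> \<tau>) = sets borel" for \<tau>
    using measurable_space[OF \<mu>, of \<tau>] by (auto simp: space_prob_algebra)
  have f_slice: "continuous_on UNIV (\<lambda>V. f (\<tau>, V))" if "\<tau> \<in> {0..T}" for \<tau>
    by (rule continuous_on_compose2[OF f]) (use that in \<open>auto intro!: continuous_intros\<close>)
  have f_slice_meas: "(\<lambda>V. f (\<tau>, V)) \<in> borel_measurable (\<mu> \<tau>')" if "\<tau> \<in> {0..T}" for \<tau> \<tau>'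
    using borel_measurable_continuous_onI[OF f_slice[OF that]] by (simp add: measurable_cong_sets[OF sets_\<mu> refl])
  have comp: "compact ({0..T} \<times> K)" using \<open>compact K\<close> by (intro compact_Times) auto
  have fK: "continuous_on ({0..T} \<times> K) f" using f by (rule continuous_on_subset) auto
  obtain B where B: "\<And>\<tau> V. \<tau> \<in> {0..T} \<Longrightarrow> V \<in> K \<Longrightarrow> \<bar>f (\<tau>, V)\<bar> \<le> B"
    using compact_imp_bounded[OF compact_continuous_image[OF fK comp]]
    unfolding bounded_iff real_norm_def by (metis SigmaI image_eqI)
  define \<theta> where "\<theta> = \<eta> / T"
  have \<theta>: "0 < \<theta>" "\<theta> * T = \<eta>" using \<open>0 < \<eta>\<close> \<open>0 < T\<close> unfolding \<theta>_def by auto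
  obtain \<delta> where \<delta>: "0 < \<delta>" "\<And>\<tau> \<tau>' V. \<tau> \<in> {0..T} \<Longrightarrow> \<tau>' \<in> {0..T} \<Longrightarrow> V \<in> K \<Longrightarrow> \<bar>\<tau> - \<tau>'\<bar> < \<delta> \<Longrightarrow>
      \<bar>f (\<tau>, V) - f (\<tau>', V)\<bar> \<le> \<theta>"
  proof -
    obtain d where d: "0 < d" "\<And>x y. x \<in> {0..T} \<times> K \<Longrightarrow> y \<in> {0..T} \<times> K \<Longrightarrow> dist x y < d \<Longrightarrow> dist (f x) (f y) < \<theta>"
      using compact_uniformly_continuous[OF fK comp] \<theta>(1) unfolding uniformly_continuous_on_def by metis
    have "\<bar>f (\<tau>, V) - f (\<tau>', V)\<bar> \<le> \<theta>"
      if "\<tau> \<in> {0..T}" "\<tau>' \<in> {0..T}" "V \<in> K" "\<bar>\<tau> - \<tau>'\<bar> < d" for \<tau> \<tau>' V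
      using d(2)[of "(\<tau>, V)" "(\<tau>', V)"] that by (auto simp: dist_Pair_Pair dist_real_def)
    then show thesis using that d(1) by blast
  qed
  obtain N :: nat where N: "N \<noteq> 0" "T / real N < \<delta>"
  proof -
    obtain n :: nat where "T / \<delta> < real n" using reals_Archimedean2 by blast
    moreover have "0 < T / \<delta>" using \<open>0 < T\<close> \<delta>(1) by simp
    ultimately have n: "T / \<delta> < real n" "0 < real n" by linarith+
    then have "T / real n < \<delta>" using \<delta>(1) by (simp add: field_simps)
    then show thesis using n(2) by (intro that) auto
  qed
  define t where "t k = real k * (T / real N)" for k
  have t0: "t 0 = 0" and tN: "t N = T" unfolding t_def using N by auto
  have incseq: "incseq t" unfolding t_def incseq_def using \<open>0 < T\<close>
    by (intro allI impI mult_right_mono) simp_all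
  have t_step: "t (Suc k) - t k = T / real N" for k unfolding t_def by (simp add: distrib_right add_divide_distrib)
  have t_in: "t k \<in> {0..T}" if "k \<le> N" for k
    using incseqD[OF incseq, of 0 k] incseqD[OF incseq that] t0 tN by auto
  have t_le: "t k \<le> t (Suc k)" for k using incseq by (simp add: incseq_SucD)
  have near: "\<bar>f (\<tau>, V) - f (t k, V)\<bar> \<le> \<theta>" "\<tau> \<in> {0..T}" if "\<tau> \<in> {t k<..t (Suc k)}" "V \<in> K" "k < N" for \<tau> V k
  proof -
    show "\<tau> \<in> {0..T}" using that t_in[of k] t_in[of "Suc k"] by auto
    then show "\<bar>f (\<tau>, V) - f (t k, V)\<bar> \<le> \<theta>"
      using that t_in[of k] t_step[of k] N(2) by (intro \<delta>(2)) auto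
  qed
  define S where "S i = (\<Sum>k<N. LINT \<tau>:{t k<..t (Suc k)}|lborel. f (t k, u i \<tau>))" for i
  define L where "L = (\<Sum>k<N. LINT \<tau>:{t k<..t (Suc k)}|lborel. LINT V|\<mu> \<tau>. f (t k, V))"
  have "S \<longlonglongrightarrow> L"
    unfolding S_def L_def
  proof (intro tendsto_sum conv f_slice t_le)
    fix k assume "k \<in> {..<N}"
    then show "t k \<in> {0..T}" "0 \<le> t k" "t (Suc k) \<le> T" using t_in[of k] t_in[of "Suc k"] by auto
  qed
  \<comment> \<open>The grid estimate in abstract form, used once for the integrals along
    \<open>u i\<close> and once for those against \<mu>.\<close>
  moreover have approx: "\<bar>(LINT \<tau>:{0..T}|lborel. P \<tau>) - (\<Sum>k<N. LINT \<tau>:{t k<..t (Suc k)}|lborel. Q k \<tau>)\<bar> \<le> \<eta>"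
    if P: "set_integrable lborel {0<..T} P"
      and Q: "\<And>k. k < N \<Longrightarrow> set_integrable lborel {t k<..t (Suc k)} (Q k)"
      and le: "\<And>k \<tau>. k < N \<Longrightarrow> \<tau> \<in> {t k<..t (Suc k)} \<Longrightarrow> \<bar>P \<tau> - Q k \<tau>\<bar> \<le> \<theta>" for P Q
  proof -
    have "(LINT \<tau>:{0..T}|lborel. P \<tau>) = (\<Sum>k<N. LINT \<tau>:{t k<..t (Suc k)}|lborel. P \<tau>)"
      using set_integral_Ioc_partition[OF incseq, of N P] P unfolding set_integral_Icc_eq_Ioc t0 tN by simp
    then have "(LINT \<tau>:{0..T}|lborel. P \<tau>) - (\<Sum>k<N. LINT \<tau>:{t k<..t (Suc k)}|lborel. Q k \<tau>) =
       (\<Sum>k<N. (LINT \<tau>:{t k<..t (Suc k)}|lborel. P \<tau>) - (LINT \<tau>:{t k<..t (Suc k)}|lborel. Q k \<tau>))"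
      by (simp add: sum_subtractf)
    then have "\<bar>(LINT \<tau>:{0..T}|lborel. P \<tau>) - (\<Sum>k<N. LINT \<tau>:{t k<..t (Suc k)}|lborel. Q k \<tau>)\<bar> \<le>
       (\<Sum>k<N. \<bar>(LINT \<tau>:{t k<..t (Suc k)}|lborel. P \<tau>) - (LINT \<tau>:{t k<..t (Suc k)}|lborel. Q k \<tau>)\<bar>)"
      by (simp only: sum_abs)
    also have "\<dots> \<le> (\<Sum>k<N. \<theta> * (t (Suc k) - t k))"
    proof (rule sum_mono)
      fix k assume "k \<in> {..<N}"
      then have k: "k < N" by simp
      have "{t k<..t (Suc k)} \<subseteq> {0<..T}" using t_in[of k] t_in[of "Suc k"] k by auto
      then have "set_integrable lborel {t k<..t (Suc k)} P" using set_integrable_subset[OF P] by auto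
      then show "\<bar>(LINT \<tau>:{t k<..t (Suc k)}|lborel. P \<tau>) - (LINT \<tau>:{t k<..t (Suc k)}|lborel. Q k \<tau>)\<bar> \<le> \<theta> * (t (Suc k) - t k)"
        by (rule set_integral_Ioc_diff_le) (use Q[OF k] le[OF k] t_le in auto)
    qed
    also have "\<dots> = \<eta>" unfolding t_step using N \<theta> by simp
    finally show ?thesis .
  qed
  moreover have "\<bar>(LINT \<tau>:{0..T}|lborel. f (\<tau>, u i \<tau>)) - S i\<bar> \<le> \<eta>" for i
    unfolding S_def
  proof (rule approx)
    have "set_integrable lborel {0<..T} (\<lambda>\<tau>. F (\<tau>, u i \<tau>))"
    proof (rule set_integrable_Ioc_bounded[where B = B])
      show "(\<lambda>\<tau>. F (\<tau>, u i \<tau>)) \<in> borel_measurable borel" by measurable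
    qed (use B uK in \<open>auto simp: F_def\<close>)
    then show "set_integrable lborel {0<..T} (\<lambda>\<tau>. f (\<tau>, u i \<tau>))"
      by (rule set_integrable_cong[THEN iffD1, rotated -1]) (auto simp: F_def)
    fix k assume "k < N"
    then show "set_integrable lborel {t k<..t (Suc k)} (\<lambda>\<tau>. f (t k, u i \<tau>))"
      using measurable_compose[OF u borel_measurable_continuous_onI[OF f_slice[OF t_in]], of k] B t_in[of k] uK
      by (intro set_integrable_Ioc_bounded[where B = B]) auto
  qed (use near uK in auto)
  moreover have "\<bar>(LINT \<tau>:{0..T}|lborel. LINT V|\<mu> \<tau>. f (\<tau>, V)) - L\<bar> \<le> \<eta>"
  proof -
    have bnd: "integrable (\<mu> \<tau>') (\<lambda>V. f (\<tau>, V))" "\<bar>LINT V|\<mu> \<tau>'. f (\<tau>, V)\<bar> \<le> B" if "\<tau> \<in> {0..T}" for \<tau> \<tau>'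
    proof -
      interpret prob_space "\<mu> \<tau>'" by (rule prob_\<mu>)
      have AE: "AE V in \<mu> \<tau>'. \<bar>f (\<tau>, V)\<bar> \<le> B" using \<mu>K[of \<tau>'] by eventually_elim (rule B[OF that])
      then show int: "integrable (\<mu> \<tau>') (\<lambda>V. f (\<tau>, V))"
        by (intro integrable_const_bound[where B = B] f_slice_meas that) auto
      have "\<bar>LINT V|\<mu> \<tau>'. f (\<tau>, V)\<bar> \<le> (LINT V|\<mu> \<tau>'. \<bar>f (\<tau>, V)\<bar>)" by (rule integral_abs_bound)
      also have "\<dots> \<le> B" using int AE by (intro integral_le_const) auto
      finally show "\<bar>LINT V|\<mu> \<tau>'. f (\<tau>, V)\<bar> \<le> B" .
    qed
    have \<mu>_sub: "\<mu> \<in> borel \<rightarrow>\<^sub>M subprob_algebra borel" using \<mu> by (rule measurable_prob_algebraD)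
    show ?thesis
      unfolding L_def
    proof (rule approx)
      have "set_integrable lborel {0<..T} (\<lambda>\<tau>. LINT V|\<mu> \<tau>. F (\<tau>, V))"
      proof (rule set_integrable_Ioc_bounded[where B = B])
        show "(\<lambda>\<tau>. LINT V|\<mu> \<tau>. F (\<tau>, V)) \<in> borel_measurable borel"
          by (rule borel_measurable_kernel_integral[OF _ \<mu>_sub]) (rule F_meas)
        fix \<tau> assume "\<tau> \<in> {0<..T}"
        then show "\<bar>LINT V|\<mu> \<tau>. F (\<tau>, V)\<bar> \<le> B" using bnd(2)[of \<tau> \<tau>] by (simp add: F_def)
      qed
      then show "set_integrable lborel {0<..T} (\<lambda>\<tau>. LINT V|\<mu> \<tau>. f (\<tau>, V))"
        by (rule set_integrable_cong[THEN iffD1, rotated -1]) (auto simp: F_def)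
      fix k assume k: "k < N"
      then have tk: "t k \<in> {0..T}" using t_in by simp
      show "set_integrable lborel {t k<..t (Suc k)} (\<lambda>\<tau>. LINT V|\<mu> \<tau>. f (t k, V))"
      proof (rule set_integrable_Ioc_bounded[OF _ bnd(2)[OF tk]])
        have "(\<lambda>z :: real \<times> 'a. f (t k, snd z)) \<in> borel_measurable (borel \<Otimes>\<^sub>M borel)"
          by (rule measurable_compose[OF measurable_snd borel_measurable_continuous_onI[OF f_slice[OF tk]]])
        from borel_measurable_kernel_integral[OF this \<mu>_sub] show "(\<lambda>\<tau>. LINT V|\<mu> \<tau>. f (t k, V)) \<in> borel_measurable borel"
          by simp
      qed
      fix \<tau> assume \<tau>: "\<tau> \<in> {t k<..t (Suc k)}"
      then have \<tau>T: "\<tau> \<in> {0..T}" using t_in[of k] t_in[of "Suc k"] k by auto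
      interpret prob_space "\<mu> \<tau>" by (rule prob_\<mu>)
      have int: "integrable (\<mu> \<tau>) (\<lambda>V. f (\<tau>, V) - f (t k, V))"
        using bnd(1)[OF \<tau>T] bnd(1)[OF tk] by simp
      have "(LINT V|\<mu> \<tau>. f (\<tau>, V)) - (LINT V|\<mu> \<tau>. f (t k, V)) = (LINT V|\<mu> \<tau>. f (\<tau>, V) - f (t k, V))"
        using bnd(1)[OF \<tau>T] bnd(1)[OF tk] by simp
      also have "\<bar>\<dots>\<bar> \<le> (LINT V|\<mu> \<tau>. \<bar>f (\<tau>, V) - f (t k, V)\<bar>)" by (rule integral_abs_bound)
      also have "\<dots> \<le> \<theta>"
      proof (rule integral_le_const)
        show "AE V in \<mu> \<tau>. \<bar>f (\<tau>, V) - f (t k, V)\<bar> \<le> \<theta>"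
          using \<mu>K[of \<tau>] by eventually_elim (rule near(1)[OF \<tau> _ k])
      qed (use int in auto)
      finally show "\<bar>(LINT V|\<mu> \<tau>. f (\<tau>, V)) - (LINT V|\<mu> \<tau>. f (t k, V))\<bar> \<le> \<theta>" .
    qed
  qed
  ultimately show "\<exists>S L. S \<longlonglongrightarrow> L \<and> (\<forall>i. \<bar>(LINT \<tau>:{0..T}|lborel. f (\<tau>, u i \<tau>)) - S i\<bar> \<le> \<eta>) \<and>
      \<bar>(LINT \<tau>:{0..T}|lborel. LINT V|\<mu> \<tau>. f (\<tau>, V)) - L\<bar> \<le> \<eta>" by blast
qed

section \<open>Asymptotic invariance\<close>

text \<open>With s = 2 h \<epsilon>, the curve \<open>u (\<tau> + s * t)\<close> solves the fast
  equation in \<open>t\<close> up to s times the diffusion, which is bounded on the trap. It starts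
  at the same point as the fast orbit, so Gronwall leaves only the perturbation.\<close>

lemma slow_solution_tracks_fast_flow:
  fixes u :: "real \<Rightarrow> ('m::finite) state"
  assumes u: "solves_ode_on (slow_field \<epsilon>) {0..T} u"
    and trap: "\<And>t. t \<in> {0..T} \<Longrightarrow> u t \<in> trap S p" and "0 < p" "0 < \<epsilon>" "0 \<le> \<sigma>"
    and \<tau>: "0 \<le> \<tau>" "\<tau> + 2 * mesh TYPE('m) * \<epsilon> * \<sigma> \<le> T"
  shows "norm (u (\<tau> + 2 * mesh TYPE('m) * \<epsilon> * \<sigma>) - fast_flow \<sigma> (u \<tau>)) \<le>
    2 * mesh TYPE('m) * \<epsilon> * (real CARD('m bit0) * (4 * S / (mesh TYPE('m))\<^sup>2))
      * exp ((2 * (real CARD('m bit0) * (4 * S)) + 1) * \<sigma>)"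
proof -
  define s where "s = 2 * mesh TYPE('m) * \<epsilon>"
  have s: "0 < s" using mesh_pos[where 'm = 'm] \<open>0 < \<epsilon>\<close> unfolding s_def by simp
  define q where "q = (2 * (real CARD('m bit0) * (4 * S)) + 1) * \<sigma>"
  define \<delta> where "\<delta> = s * (real CARD('m bit0) * (4 * S / (mesh TYPE('m))\<^sup>2))"
  have comp: "\<bar>u t $ k\<bar> \<le> S" if "t \<in> {0..T}" for t k
    using trap[OF that] by (intro state_bounded_component) (auto simp: trap_def)
  have in_T: "\<tau> + s * t \<in> {0..T}" if "t \<in> {0..\<sigma>}" for t
  proof -
    have "s * t \<le> s * \<sigma>" "0 \<le> s * t" using that s by auto
    then show ?thesis using \<tau> unfolding s_def[symmetric] by auto
  qed
  have \<tau>T: "\<tau> \<in> {0..T}" using in_T[of 0] \<open>0 \<le> \<sigma>\<close> by simp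
  have V: "u \<tau> \<in> pos_orthant" "(\<Sum>k\<in>UNIV. u \<tau> $ k) \<le> S"
    using trap[OF \<tau>T] trap_subset_pos_orthant[OF \<open>0 < p\<close>] by (auto simp: trap_def)
  have "0 \<le> S" using comp[OF \<tau>T, of undefined] by linarith
  then have \<delta>0: "0 \<le> \<delta>" and q0: "0 \<le> q" using s \<open>0 \<le> \<sigma>\<close> unfolding \<delta>_def q_def by auto
  have "(norm (u (\<tau> + s * \<sigma>) - fast_flow \<sigma> (u \<tau>)))\<^sup>2 \<le>
    ((norm (u (\<tau> + s * 0) - fast_flow 0 (u \<tau>)))\<^sup>2 + \<delta>\<^sup>2) * exp q"
    unfolding q_def
  proof (rule fast_field_gronwall[where c = 1 and u = "\<lambda>t. u (\<tau> + s * t)" and v = "\<lambda>t. fast_flow t (u \<tau>)"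
      and p = "\<lambda>t. s *\<^sub>R diffusion_field (u (\<tau> + s * t))"])
    show "solves_ode_on (\<lambda>x. 1 *\<^sub>R fast_field x) {0..\<sigma>} (\<lambda>t. fast_flow t (u \<tau>))"
      using solves_ode_on_subset[OF fast_flow_solves(1)[OF V(1)]] by simp
    fix t assume t: "t \<in> {0..\<sigma>}"
    have "(u has_vector_derivative slow_field \<epsilon> (u (\<tau> + s * t))) (at (\<tau> + s * t) within {0..T})"
      using u in_T[OF t] unfolding solves_ode_on_def by blast
    then have "(u has_vector_derivative slow_field \<epsilon> (u (\<tau> + s * t))) (at (\<tau> + s * t) within (\<lambda>t. \<tau> + s * t) ` {0..\<sigma>})"
      by (rule has_vector_derivative_within_subset) (use in_T in auto)
    moreover have "((\<lambda>t. \<tau> + s * t) has_vector_derivative s) (at t within {0..\<sigma>})"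
      unfolding has_real_derivative_iff_has_vector_derivative[symmetric]
      by (auto intro!: derivative_eq_intros)
    ultimately have "((\<lambda>t. u (\<tau> + s * t)) has_vector_derivative s *\<^sub>R slow_field \<epsilon> (u (\<tau> + s * t))) (at t within {0..\<sigma>})"
      using vector_diff_chain_within[of "\<lambda>t. \<tau> + s * t" s t "{0..\<sigma>}" u] by (simp add: o_def)
    moreover have "s *\<^sub>R slow_field \<epsilon> (u (\<tau> + s * t)) =
        1 *\<^sub>R fast_field (u (\<tau> + s * t)) + s *\<^sub>R diffusion_field (u (\<tau> + s * t))"
      unfolding slow_field_split s_def[symmetric] using s by (simp add: scaleR_add_right)
    ultimately show "((\<lambda>t. u (\<tau> + s * t)) has_vector_derivative
        1 *\<^sub>R fast_field (u (\<tau> + s * t)) + s *\<^sub>R diffusion_field (u (\<tau> + s * t))) (at t within {0..\<sigma>})"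
      by simp
    show "norm (s *\<^sub>R diffusion_field (u (\<tau> + s * t))) \<le> \<delta>"
    proof -
      have "s * norm (diffusion_field (u (\<tau> + s * t))) \<le> \<delta>"
        unfolding \<delta>_def using s by (intro mult_left_mono norm_diffusion_field_le comp[OF in_T[OF t]]) simp
      then show ?thesis using s by simp
    qed
    fix k
    show "\<bar>u (\<tau> + s * t) $ k\<bar> \<le> S" by (rule comp[OF in_T[OF t]])
    show "\<bar>fast_flow t (u \<tau>) $ k\<bar> \<le> S" by (rule fast_flow_component_le[OF V])
  qed (use \<open>0 \<le> \<sigma>\<close> \<delta>0 in auto)
  also have "\<dots> = \<delta>\<^sup>2 * exp q" using fast_flow_solves(2)[OF V(1)] by simp
  \<comment> \<open>Since q \<ge> 0, enlarging exp q to its square makes the bound a perfect square,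
    from which the root is taken.\<close>
  also have "\<dots> \<le> \<delta>\<^sup>2 * (exp q)\<^sup>2"
    using q0 by (intro mult_left_mono) (simp_all add: power2_eq_square)
  also have "\<dots> = (\<delta> * exp q)\<^sup>2" by (simp add: power_mult_distrib)
  finally have "norm (u (\<tau> + s * \<sigma>) - fast_flow \<sigma> (u \<tau>)) \<le> \<delta> * exp q"
    by (rule power2_le_imp_le) (use \<delta>0 in simp)
  then show ?thesis unfolding \<delta>_def q_def s_def by simp
qed

lemma set_integral_Ioc_shift:
  fixes F :: "real \<Rightarrow> real"
  shows "(LINT \<tau>:{a<..b}|lborel. F (\<tau> + s)) = (LINT \<tau>:{a + s<..b + s}|lborel. F \<tau>)"
proof -
  have "(LINT \<tau>:{a + s<..b + s}|lborel. F \<tau>) =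
     (LINT \<tau>|lborel. indicator {a + s<..b + s} (s + 1 * \<tau>) *\<^sub>R F (s + 1 * \<tau>))"
    unfolding set_lebesgue_integral_def by (subst lborel_integral_real_affine[of 1 _ s]) auto
  also have "\<dots> = (LINT \<tau>:{a<..b}|lborel. F (\<tau> + s))"
    unfolding set_lebesgue_integral_def
    by (intro Bochner_Integration.integral_cong) (auto simp: indicator_def add.commute)
  finally show ?thesis by simp
qed

text \<open>The two windows differ by one interval of length at most \<open>s\<close> at each end,
  and F is bounded by 1.\<close>

lemma set_integral_shift_diff_le:
  fixes F :: "real \<Rightarrow> real"
  assumes [measurable]: "F \<in> borel_measurable borel" and F: "\<And>t. \<bar>F t\<bar> \<le> 1" and "a \<le> b" "0 \<le> s"
  shows "\<bar>(LINT \<tau>:{a<..b}|lborel. F (\<tau> + s)) - (LINT \<tau>:{a<..b}|lborel. F \<tau>)\<bar> \<le> 2 * s"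
proof -
  have int: "set_integrable lborel {x<..y} F" for x y
    by (rule set_integrable_Ioc_bounded[where B = 1]) (use F in auto)
  have split: "(LINT \<tau>:{x<..z}|lborel. F \<tau>) = (LINT \<tau>:{x<..y}|lborel. F \<tau>) + (LINT \<tau>:{y<..z}|lborel. F \<tau>)"
    if "x \<le> y" "y \<le> z" for x y z
  proof -
    have "{x<..z} = {x<..y} \<union> {y<..z}" using that by auto
    then show ?thesis using set_integral_Un[OF _ int int, of x y y z] by (simp add: Int_greaterThanAtMost)
  qed
  have le: "\<bar>LINT \<tau>:{x<..x + s}|lborel. F \<tau>\<bar> \<le> s" for x
  proof -
    have "\<bar>(LINT \<tau>:{x<..x + s}|lborel. F \<tau>) - (LINT \<tau>:{x<..x + s}|lborel. 0)\<bar> \<le> 1 * (x + s - x)"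
      by (rule set_integral_Ioc_diff_le[OF int]) (use F \<open>0 \<le> s\<close> in \<open>auto simp: set_integrable_def\<close>)
    then show ?thesis by (simp add: set_lebesgue_integral_def)
  qed
  show ?thesis
    unfolding set_integral_Ioc_shift
    using split[of a b "b + s"] split[of a "a + s" "b + s"] le[of a] le[of b] \<open>a \<le> b\<close> \<open>0 \<le> s\<close> by linarith
qed

text \<open>Because of \<open>U\<^sub>\<epsilon> (\<tau> + 2 h \<epsilon> \<sigma>) \<approx> \<Phi>\<^sub>\<sigma> (U\<^sub>\<epsilon> \<tau>)\<close>, replacing \<open>g\<close> by \<open>g \<circ> \<Phi>\<^sub>\<sigma>\<close> amounts to
  a shift of the slow time by \<open>O(\<epsilon>)\<close>, which does not affect time averages in the limit.\<close>

lemma slow_average_almost_invariant: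
  fixes u :: "real \<Rightarrow> ('m::finite) state"
  assumes u: "solves_ode_on (slow_field \<epsilon>) {0..T} u" and "0 < T"
    and trap: "\<And>t. t \<in> {0..T} \<Longrightarrow> u t \<in> trap S p" and "0 < p" "0 < \<epsilon>" "0 \<le> \<sigma>"
    and w: "\<And>t. w t = u (max 0 (min T t))" and w_meas [measurable]: "w \<in> borel_measurable borel"
    and g [measurable]: "g \<in> borel_measurable borel" and g1: "\<And>V. \<bar>g V\<bar> \<le> 1"
    and gM: "\<And>V W. \<bar>g V - g W\<bar> \<le> M * norm (V - W)"
    and \<psi> [measurable]: "\<psi> \<in> borel_measurable borel" and \<psi>g: "\<And>V. V \<in> trap S p \<Longrightarrow> \<psi> V = g (fast_flow \<sigma> V)"
    and ab: "0 \<le> a" "a \<le> b" "b \<le> T"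
  shows "\<bar>(LINT \<tau>:{a<..b}|lborel. \<psi> (w \<tau>)) - (LINT \<tau>:{a<..b}|lborel. g (w \<tau>))\<bar> \<le>
    (M * (2 * mesh TYPE('m) * (real CARD('m bit0) * (4 * S / (mesh TYPE('m))\<^sup>2))
      * exp ((2 * (real CARD('m bit0) * (4 * S)) + 1) * \<sigma>)) * T + 8 * mesh TYPE('m) * \<sigma>) * \<epsilon>"
proof -
  define s where "s = 2 * mesh TYPE('m) * \<epsilon> * \<sigma>"
  have s: "0 \<le> s" using mesh_pos[where 'm = 'm] \<open>0 < \<epsilon>\<close> \<open>0 \<le> \<sigma>\<close> unfolding s_def by simp
  define C where "C = 2 * mesh TYPE('m) * (real CARD('m bit0) * (4 * S / (mesh TYPE('m))\<^sup>2))
      * exp ((2 * (real CARD('m bit0) * (4 * S)) + 1) * \<sigma>)"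
  have M0: "0 \<le> M"
    using gM[of "axis undefined 1" 0] by (simp add: norm_axis_1)
  have wT: "w t \<in> trap S p" for t unfolding w by (rule trap) (use \<open>0 < T\<close> in auto)
  have \<psi>1: "\<bar>\<psi> (w t)\<bar> \<le> 1" for t using \<psi>g[OF wT] g1 by simp
  have pt: "\<bar>\<psi> (w t) - g (w (t + s))\<bar> \<le> M * (C * \<epsilon>)" if "0 \<le> t" "t + s \<le> T" for t
  proof -
    have "norm (w (t + s) - fast_flow \<sigma> (w t)) \<le> C * \<epsilon>"
      using slow_solution_tracks_fast_flow[OF u trap \<open>0 < p\<close> \<open>0 < \<epsilon>\<close> \<open>0 \<le> \<sigma>\<close>, of t] that s
      unfolding s_def[symmetric] C_def by (simp add: w mult_ac)
    then have "M * norm (fast_flow \<sigma> (w t) - w (t + s)) \<le> M * (C * \<epsilon>)"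
      using M0 by (intro mult_left_mono) (simp_all add: norm_minus_commute)
    then show ?thesis using gM[of "fast_flow \<sigma> (w t)" "w (t + s)"] \<psi>g[OF wT[of t]] by simp
  qed
  have C0: "0 \<le> M * (C * \<epsilon>)"
  proof -
    have "\<bar>w 0 $ undefined\<bar> \<le> S"
      using wT[of 0] by (intro state_bounded_component) (auto simp: trap_def)
    then have "0 \<le> S" by linarith
    then show ?thesis using M0 \<open>0 < \<epsilon>\<close> mesh_pos[where 'm = 'm] unfolding C_def by auto
  qed
  \<comment> \<open>Tracking is available only while \<tau> + s stays within [0,T]. The rest of the
    window has length at most \<open>s\<close> and is estimated trivially; the maximum with
    \<open>a\<close> covers windows that start after T - s.\<close>
  define b' where "b' = max a (min b (T - s))"
  have b': "a \<le> b'" "b' \<le> b" "b - b' \<le> s" using ab s unfolding b'_def by auto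
  have intg: "set_integrable lborel {x<..y} (\<lambda>\<tau>. g (w (\<tau> + s)))" for x y
    by (rule set_integrable_Ioc_bounded[where B = 1]) (use g1 in auto)
  have int\<psi>: "set_integrable lborel {x<..y} (\<lambda>\<tau>. \<psi> (w \<tau>))" for x y
    by (rule set_integrable_Ioc_bounded[where B = 1]) (use \<psi>1 in auto)
  have split: "(LINT \<tau>:{a<..b}|lborel. F \<tau>) = (LINT \<tau>:{a<..b'}|lborel. F \<tau>) + (LINT \<tau>:{b'<..b}|lborel. F \<tau>)"
    if "\<And>x y. set_integrable lborel {x<..y} F" for F :: "real \<Rightarrow> real"
  proof -
    have "{a<..b} = {a<..b'} \<union> {b'<..b}" using b' by auto
    then show ?thesis using set_integral_Un[OF _ that that, of a b' b' b] by (simp add: Int_greaterThanAtMost)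
  qed
  have "\<bar>(LINT \<tau>:{a<..b'}|lborel. \<psi> (w \<tau>)) - (LINT \<tau>:{a<..b'}|lborel. g (w (\<tau> + s)))\<bar> \<le> (M * (C * \<epsilon>)) * (b' - a)"
  proof (rule set_integral_Ioc_diff_le[OF int\<psi> intg])
    have "\<bar>\<psi> (w t) - g (w (t + s))\<bar> \<le> M * (C * \<epsilon>)" if "t \<in> {a<..b'}" for t
      using that ab b' by (intro pt) (auto simp: b'_def)
    then show "AE t in lborel. t \<in> {a<..b'} \<longrightarrow> \<bar>\<psi> (w t) - g (w (t + s))\<bar> \<le> M * (C * \<epsilon>)" by simp
  qed (use b' in auto)
  also have "\<dots> \<le> (M * (C * \<epsilon>)) * T"
    using b' ab C0 by (intro mult_left_mono) auto
  finally have 1: "\<bar>(LINT \<tau>:{a<..b'}|lborel. \<psi> (w \<tau>)) - (LINT \<tau>:{a<..b'}|lborel. g (w (\<tau> + s)))\<bar> \<le> (M * (C * \<epsilon>)) * T" .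
  have "\<bar>(LINT \<tau>:{b'<..b}|lborel. \<psi> (w \<tau>)) - (LINT \<tau>:{b'<..b}|lborel. g (w (\<tau> + s)))\<bar> \<le> 2 * (b - b')"
  proof (rule set_integral_Ioc_diff_le[OF int\<psi> intg])
    have "\<bar>\<psi> (w t) - g (w (t + s))\<bar> \<le> 2" for t
      using \<psi>1[of t] g1[of "w (t + s)"] by linarith
    then show "AE t in lborel. t \<in> {b'<..b} \<longrightarrow> \<bar>\<psi> (w t) - g (w (t + s))\<bar> \<le> 2" by simp
  qed (use b' in auto)
  then have 2: "\<bar>(LINT \<tau>:{b'<..b}|lborel. \<psi> (w \<tau>)) - (LINT \<tau>:{b'<..b}|lborel. g (w (\<tau> + s)))\<bar> \<le> 2 * s"
    by (rule order_trans) (use b' in simp)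
  have 3: "\<bar>(LINT \<tau>:{a<..b}|lborel. g (w (\<tau> + s))) - (LINT \<tau>:{a<..b}|lborel. g (w \<tau>))\<bar> \<le> 2 * s"
    by (rule set_integral_shift_diff_le[where F = "\<lambda>\<tau>. g (w \<tau>)"]) (use g1 ab s in auto)
  \<comment> \<open>Of the 4 s, one half comes from the tail after \<open>b'\<close> and the other
    from shifting the window; with s = 2 h \<epsilon> \<sigma> this is the term 8 h \<sigma>
    \<epsilon>.\<close>
  have "\<bar>(LINT \<tau>:{a<..b}|lborel. \<psi> (w \<tau>)) - (LINT \<tau>:{a<..b}|lborel. g (w \<tau>))\<bar> \<le> (M * (C * \<epsilon>)) * T + 4 * s"
    using 1 2 3 split[OF int\<psi>] split[OF intg] by linarith
  also have "\<dots> = (M * C * T + 8 * mesh TYPE('m) * \<sigma>) * \<epsilon>" unfolding s_def by (simp add: algebra_simps)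
  finally show ?thesis unfolding C_def .
qed

section \<open>Determining invariance by countably many test functions\<close>

text \<open>Lipschitz functions increasing with \<open>n\<close> to the indicator of an open set B
  other than UNIV. For B = UNIV the complement is empty, \<open>infdist\<close> to it is 0 and the
  function vanishes, so UNIV has to be treated apart.\<close>

definition bump :: "'a::metric_space set \<Rightarrow> nat \<Rightarrow> 'a \<Rightarrow> real" where
  "bump B n x = min 1 (real n * infdist x (- B))"

lemma bump_range: "0 \<le> bump B n x" "bump B n x \<le> 1"
  unfolding bump_def by (auto simp: infdist_nonneg)

lemma bump_abs: "\<bar>bump B n x\<bar> \<le> 1"
  using bump_range[of B n x] by simp

lemma bump_lipschitz:
  "\<bar>bump B n x - bump B n y\<bar> \<le> real n * dist x y"
proof -
  have le: "bump B n x - bump B n y \<le> real n * dist x y" for x y :: 'a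
  proof -
    have "real n * infdist x (- B) \<le> real n * (infdist y (- B) + dist x y)"
      by (intro mult_left_mono infdist_triangle) simp
    moreover have "0 \<le> real n * dist x y" by simp
    ultimately show ?thesis unfolding bump_def distrib_left by linarith
  qed
  show ?thesis using le[of x y] le[of y x] by (simp add: abs_le_iff dist_commute)
qed

lemma continuous_on_bump: "continuous_on A (bump B n)"
  unfolding bump_def[abs_def] by (intro continuous_intros)

lemma bump_tendsto_indicator:
  assumes "open B" "B \<noteq> UNIV"
  shows "(\<lambda>n. bump B n x) \<longlonglongrightarrow> indicator B x"
proof (cases "x \<in> B")
  case True
  have "infdist x (- B) \<noteq> 0"
    using in_closed_iff_infdist_zero[of "- B" x] assms True by auto
  then have d: "0 < infdist x (- B)" using infdist_nonneg[of x "- B"] by linarith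
  obtain n0 :: nat where n0: "1 / infdist x (- B) < real n0" using reals_Archimedean2 by blast
  have "bump B n x = 1" if "n \<ge> n0" for n
  proof -
    have "1 / infdist x (- B) \<le> real n" using n0 that by linarith
    then show ?thesis unfolding bump_def using d by (simp add: field_simps)
  qed
  then show ?thesis using True by (intro tendsto_eventually eventually_sequentiallyI[of n0]) simp
next
  case False
  then have "infdist x (- B) = 0" by simp
  then show ?thesis using False by (simp add: bump_def)
qed

text \<open>Finite intersections of members of a countable basis form an intersection-stable
  generator of the Borel sets. The integrals of the \<open>bump\<close> functions converge to the
  measures of its members, except for UNIV, the empty intersection, whose measure is 1
  anyway.\<close>

lemma countable_determining_class:
  obtains \<E> :: "'a::{metric_space, second_countable_topology} set set"
  where "countable \<E>"
    and "\<And>\<mu> \<nu>. prob_space \<mu> \<Longrightarrow> prob_space \<nu> \<Longrightarrow> sets \<mu> = sets borel \<Longrightarrow> sets \<nu> = sets borel \<Longrightarrow>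
      (\<And>B n. B \<in> \<E> \<Longrightarrow> (LINT x|\<mu>. bump B n x) = (LINT x|\<nu>. bump B n x)) \<Longrightarrow> \<mu> = \<nu>"
proof -
  obtain \<B> :: "'a set set" where \<B>: "countable \<B>" "topological_basis \<B>"
    using ex_countable_basis by blast
  define \<E> where "\<E> = Inter ` {F. finite F \<and> F \<subseteq> \<B>}"
  have "countable \<E>" unfolding \<E>_def
    using countable_Collect_finite_subset[OF \<B>(1)] by (intro countable_image)
  moreover have open_E: "open B" if "B \<in> \<E>" for B
    using that topological_basis_open[OF \<B>(2)] unfolding \<E>_def by (auto intro!: open_Inter)
  have sets_E: "sets borel = sigma_sets UNIV \<E>"
  proof -
    have "\<B> \<subseteq> \<E>"
    proof
      fix B assume "B \<in> \<B>"
      then have "B = \<Inter>{B}" "{B} \<in> {F. finite F \<and> F \<subseteq> \<B>}" by auto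
      then show "B \<in> \<E>" unfolding \<E>_def by blast
    qed
    have "sets (borel :: 'a measure) = sigma_sets UNIV \<B>"
      unfolding borel_eq_countable_basis[OF \<B>] by (rule sets_measure_of) auto
    also have "\<dots> \<subseteq> sigma_sets UNIV \<E>" using \<open>\<B> \<subseteq> \<E>\<close> by (rule sigma_sets_mono')
    finally have "sets (borel :: 'a measure) \<subseteq> sigma_sets UNIV \<E>" .
    moreover have "sigma_sets UNIV \<E> \<subseteq> sets (borel :: 'a measure)"
      using sets.sigma_sets_subset[of \<E> "borel :: 'a measure"] open_E
      by (simp add: subset_iff)
    ultimately show ?thesis by blast
  qed
  have "\<mu> = \<nu>"
    if \<mu>: "prob_space \<mu>" and \<nu>: "prob_space \<nu>" and sets: "sets \<mu> = sets borel" "sets \<nu> = sets borel"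
      and eq: "\<And>B n. B \<in> \<E> \<Longrightarrow> (LINT x|\<mu>. bump B n x) = (LINT x|\<nu>. bump B n x)" for \<mu> \<nu>
  proof (rule measure_eqI_generator_eq[where E = \<E> and \<Omega> = UNIV and A = "\<lambda>_. UNIV"])
    have space: "space \<mu> = UNIV" "space \<nu> = UNIV" using sets[THEN sets_eq_imp_space_eq] by auto
    have lim: "(\<lambda>n. LINT x|M. bump B n x) \<longlonglongrightarrow> measure M B"
      if M: "prob_space M" "sets M = sets borel" and B: "B \<in> \<E>" "B \<noteq> UNIV" for M B
    proof -
      interpret prob_space M by (rule M)
      have [measurable]: "B \<in> sets M" using open_E[OF B(1)] M(2) by simp
      have [measurable]: "bump B n \<in> borel_measurable M" for n
        using borel_measurable_continuous_onI[OF continuous_on_bump] by (simp add: measurable_cong_sets[OF M(2) refl])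
      have "(\<lambda>n. LINT x|M. bump B n x) \<longlonglongrightarrow> (LINT x|M. indicator B x)"
        by (rule integral_dominated_convergence[where w = "\<lambda>_. 1"])
           (use bump_tendsto_indicator[OF open_E[OF B(1)] B(2)] in \<open>auto simp: bump_abs\<close>)
      then show ?thesis by simp
    qed
    interpret \<mu>: prob_space \<mu> by (rule \<mu>)
    interpret \<nu>: prob_space \<nu> by (rule \<nu>)
    show "emeasure \<mu> B = emeasure \<nu> B" if B: "B \<in> \<E>" for B
    proof (cases "B = UNIV")
      case True
      then show ?thesis using \<mu>.emeasure_space_1 \<nu>.emeasure_space_1 space by simp
    next
      case False
      have "measure \<mu> B = measure \<nu> B"
        using LIMSEQ_unique[OF lim[OF \<mu> sets(1) B False]] lim[OF \<nu> sets(2) B False] eq[OF B] by simp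
      then show ?thesis by (simp add: \<mu>.emeasure_eq_measure \<nu>.emeasure_eq_measure)
    qed
    show "Int_stable \<E>"
      unfolding Int_stable_def
    proof (intro ballI)
      fix a b assume "a \<in> \<E>" "b \<in> \<E>"
      then obtain F F' where F: "a = \<Inter>F" "b = \<Inter>F'" "finite F" "finite F'" "F \<subseteq> \<B>" "F' \<subseteq> \<B>"
        unfolding \<E>_def by blast
      then have "a \<inter> b = \<Inter>(F \<union> F')" "F \<union> F' \<in> {F. finite F \<and> F \<subseteq> \<B>}" by auto
      then show "a \<inter> b \<in> \<E>" unfolding \<E>_def by blast
    qed
    have "UNIV \<in> \<E>" unfolding \<E>_def by (rule image_eqI[of _ _ "{}"]) auto
    then show "range (\<lambda>_. UNIV) \<subseteq> \<E>" by auto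
  qed (use sets sets_E in \<open>auto simp: prob_space.emeasure_space_1 \<mu>[THEN prob_space.finite_measure, THEN finite_measure.emeasure_finite]\<close>)
  with \<open>countable \<E>\<close> show thesis by (rule that)
qed

section \<open>The fast flow as a Borel map, and a criterion for invariance\<close>

definition fast_map :: "real \<Rightarrow> ('m::finite) state \<Rightarrow> 'm state" where
  "fast_map \<sigma> V = (if V \<in> pos_orthant then fast_flow \<sigma> V else V)"

lemma fast_map_measurable [measurable]:
  "(fast_map \<sigma> :: ('m::finite) state \<Rightarrow> _) \<in> borel_measurable borel"
proof -
  have "(\<lambda>V :: 'm state. if V \<in> pos_orthant then fast_flow \<sigma> V else V) \<in> borel_measurable borel"
    by (rule borel_measurable_continuous_on_if)
       (auto intro!: continuous_on_fast_flow continuous_on_id borel_open open_pos_orthant)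
  then show ?thesis unfolding fast_map_def[abs_def] .
qed

lemma fast_map_continuous_time:
  assumes "s \<longlonglongrightarrow> \<sigma>"
  shows "(\<lambda>n. fast_map (s n) V) \<longlonglongrightarrow> fast_map \<sigma> V"
proof (cases "V \<in> pos_orthant")
  case True
  have "isCont (\<lambda>\<sigma>. fast_flow \<sigma> V) \<sigma>"
    using fast_flow_solves(1)[OF True] unfolding solves_ode_on_def
    by (metis UNIV_I has_vector_derivative_continuous)
  then show ?thesis using True assms unfolding fast_map_def by (simp add: isCont_tendsto_compose[where g = "\<lambda>\<sigma>. fast_flow \<sigma> V"])
qed (simp add: fast_map_def)

text \<open>Three extensions: from rational to real times by continuity of orbits and dominated
  convergence, from test functions to measures by \<open>det\<close>, and from nonnegative to
  negative times by the group property, applying the forward statement to the preimage of A.\<close>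

lemma fast_invariant_measureI:
  fixes \<mu> :: "('m::finite) state measure"
  assumes \<mu>: "prob_space \<mu>" "sets \<mu> = sets borel" "AE V in \<mu>. V \<in> pos_orthant"
    and det: "\<And>\<nu> \<nu>'. prob_space \<nu> \<Longrightarrow> prob_space \<nu>' \<Longrightarrow> sets \<nu> = sets borel \<Longrightarrow> sets \<nu>' = sets borel \<Longrightarrow>
      (\<And>B n. B \<in> \<E> \<Longrightarrow> (LINT x|\<nu>. bump B n x) = (LINT x|\<nu>'. bump B n x)) \<Longrightarrow> \<nu> = (\<nu>' :: 'm state measure)"
    and inv: "\<And>B n \<sigma>. B \<in> \<E> \<Longrightarrow> \<sigma> \<in> \<rat> \<Longrightarrow> 0 \<le> \<sigma> \<Longrightarrow>
      (LINT V|\<mu>. bump B n (fast_map \<sigma> V)) = (LINT V|\<mu>. bump B n V)"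
  shows "fast_invariant_measure \<mu>"
proof -
  interpret prob_space \<mu> by (rule \<mu>)
  have meas: "fast_map \<sigma> \<in> \<mu> \<rightarrow>\<^sub>M borel" for \<sigma>
    using fast_map_measurable by (simp add: measurable_cong_sets[OF \<mu>(2) refl])
  have bump_meas: "bump B n \<in> borel_measurable borel" for B :: "'m state set" and n
    by (rule borel_measurable_continuous_onI[OF continuous_on_bump])
  have inv_real: "(LINT V|\<mu>. bump B n (fast_map \<sigma> V)) = (LINT V|\<mu>. bump B n V)"
    if "B \<in> \<E>" "0 \<le> \<sigma>" for B n \<sigma>
  proof -
    \<comment> \<open>Approximation from above keeps the rational times nonnegative even for
      \<sigma> = 0.\<close>
    have "\<exists>q\<in>\<rat>. \<sigma> < q \<and> q < \<sigma> + inverse (real (Suc k))" for k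
      using Rats_dense_in_real[of \<sigma> "\<sigma> + inverse (real (Suc k))"] by auto
    then obtain q where q: "\<And>k. q k \<in> \<rat>" "\<And>k. \<sigma> < q k" "\<And>k. q k < \<sigma> + inverse (real (Suc k))"
      by metis
    have "q \<longlonglongrightarrow> \<sigma>"
    proof (rule tendsto_sandwich[where f = "\<lambda>_. \<sigma>" and h = "\<lambda>k. \<sigma> + inverse (real (Suc k))"])
      show "(\<lambda>k. \<sigma> + inverse (real (Suc k))) \<longlonglongrightarrow> \<sigma>"
        using tendsto_add[OF tendsto_const LIMSEQ_inverse_real_of_nat, of \<sigma>] by simp
    qed (auto intro!: always_eventually less_imp_le q simp del: of_nat_Suc)
    have "(\<lambda>k. LINT V|\<mu>. bump B n (fast_map (q k) V)) \<longlonglongrightarrow> (LINT V|\<mu>. bump B n (fast_map \<sigma> V))"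
    proof (rule integral_dominated_convergence[where w = "\<lambda>_. 1"])
      have "(\<lambda>k. bump B n (fast_map (q k) V)) \<longlonglongrightarrow> bump B n (fast_map \<sigma> V)" for V
        by (rule isCont_tendsto_compose[OF _ fast_map_continuous_time[OF \<open>q \<longlonglongrightarrow> \<sigma>\<close>]])
           (use continuous_on_bump[of UNIV B n] in \<open>auto simp: continuous_on_eq_continuous_at\<close>)
      then show "AE V in \<mu>. (\<lambda>k. bump B n (fast_map (q k) V)) \<longlonglongrightarrow> bump B n (fast_map \<sigma> V)" by simp
    qed (use measurable_compose[OF meas bump_meas] in \<open>auto simp: bump_abs\<close>)
    moreover have "(LINT V|\<mu>. bump B n (fast_map (q k) V)) = (LINT V|\<mu>. bump B n V)" for k
      using q(2)[of k] that by (intro inv q) auto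
    ultimately show ?thesis by (simp add: LIMSEQ_const_iff)
  qed
  have distr: "distr \<mu> borel (fast_map \<sigma>) = \<mu>" if "0 \<le> \<sigma>" for \<sigma>
  proof (rule det)
    show "prob_space (distr \<mu> borel (fast_map \<sigma>))" by (rule prob_space_distr[OF meas])
    fix B n assume "B \<in> \<E>"
    then show "(LINT x|distr \<mu> borel (fast_map \<sigma>). bump B n x) = (LINT x|\<mu>. bump B n x)"
      by (simp add: integral_distr[OF meas bump_meas] inv_real that)
  qed (use \<mu> in auto)
  \<comment> \<open>Off the orthant \<open>fast_map\<close> is the identity, so no outside point is
    mapped into a subset of the orthant, and the set in the definition of invariance is a full
    preimage.\<close>
  have sets_pre: "{V \<in> pos_orthant. fast_flow \<sigma> V \<in> A} \<in> sets borel"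
    and pre_eq: "{V \<in> pos_orthant. fast_flow \<sigma> V \<in> A} = fast_map \<sigma> -` A"
    if A: "A \<in> sets borel" "A \<subseteq> pos_orthant" for A \<sigma>
  proof -
    show eq: "{V \<in> pos_orthant. fast_flow \<sigma> V \<in> A} = fast_map \<sigma> -` A"
      using A(2) unfolding fast_map_def by (auto split: if_splits)
    show "{V \<in> pos_orthant. fast_flow \<sigma> V \<in> A} \<in> sets borel"
      unfolding eq using measurable_sets[OF fast_map_measurable A(1), of \<sigma>] by simp
  qed
  have forward: "emeasure \<mu> {V \<in> pos_orthant. fast_flow \<sigma> V \<in> A} = emeasure \<mu> A"
    if "A \<in> sets borel" "A \<subseteq> pos_orthant" "0 \<le> \<sigma>" for A \<sigma>
  proof -
    have "emeasure \<mu> A = emeasure (distr \<mu> borel (fast_map \<sigma>)) A" using distr[OF that(3)] by simp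
    also have "\<dots> = emeasure \<mu> (fast_map \<sigma> -` A)"
      using emeasure_distr[OF meas that(1)] sets_eq_imp_space_eq[OF \<mu>(2)] by simp
    finally show ?thesis unfolding pre_eq[OF that(1,2)] by simp
  qed
  have "emeasure \<mu> {V \<in> pos_orthant. fast_flow \<sigma> V \<in> A} = emeasure \<mu> A"
    if A: "A \<in> sets borel" "A \<subseteq> pos_orthant" for A \<sigma>
  proof (cases "0 \<le> \<sigma>")
    case False
    define A' where "A' = {V \<in> pos_orthant. fast_flow \<sigma> V \<in> A}"
    have "fast_flow \<sigma> (fast_flow (- \<sigma>) V) = V" if "V \<in> pos_orthant" for V :: "'m state"
      using fast_flow_add[OF that, of \<sigma> "- \<sigma>"] fast_flow_solves(2)[OF that] by simp
    then have "{V \<in> pos_orthant. fast_flow (- \<sigma>) V \<in> A'} = A"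
      using A(2) fast_flow_solves(3) unfolding A'_def by auto
    then show ?thesis
      using forward[of A' "- \<sigma>"] sets_pre[OF A, of \<sigma>] False unfolding A'_def by auto
  qed (use forward A in blast)
  then show ?thesis unfolding fast_invariant_measure_def using \<mu> by blast
qed

section \<open>Assembly of trapping, compactness and asymptotic invariance\<close>

theorem theorem5p1:
  fixes T :: real
    and K :: "('m::finite) state set"
    and U0 :: "real \<Rightarrow> 'm state"
    and U :: "real \<Rightarrow> real \<Rightarrow> 'm state"
  assumes "T > 0"
    and "compact K" and "K \<subseteq> pos_orthant"
    and "\<And>\<epsilon>. \<epsilon> > 0 \<Longrightarrow> U0 \<epsilon> \<in> K"
    and "\<And>\<epsilon>. \<epsilon> > 0 \<Longrightarrow> solves_ode_on (slow_field \<epsilon>) {0..T} (U \<epsilon>) \<and> U \<epsilon> 0 = U0 \<epsilon>"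
  shows "\<exists>(e :: nat \<Rightarrow> real) (\<mu>\<^sub>0 :: real \<Rightarrow> 'm state measure).
           (\<forall>i. e i > 0) \<and> e \<longlonglongrightarrow> 0 \<and>
           young_measure T \<mu>\<^sub>0 \<and>
           young_tendsto T (\<lambda>i. dirac_young (U (e i))) \<mu>\<^sub>0 \<and>
           (AE \<tau>\<in>{0..T} in lborel. fast_invariant_measure (\<mu>\<^sub>0 \<tau>))"
proof -
  obtain S p where Sp: "0 < p" "K \<subseteq> trap S p"
    using compact_subset_trap[OF assms(2,3)] by blast
  have sol: "solves_ode_on (slow_field \<epsilon>) {0..T} (U \<epsilon>)" if "0 < \<epsilon>" for \<epsilon>
    using assms(5)[OF that] by blast
  have U_trap: "U \<epsilon> t \<in> trap S p" if "0 < \<epsilon>" "t \<in> {0..T}" for \<epsilon> t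
    using assms(4,5)[OF that(1)] Sp slow_solution_stays_in_trap[OF sol[OF that(1)] _ \<open>0 < p\<close> that(2)] by auto
  define eps where "eps i = inverse (real (Suc i))" for i
  have eps_pos: "0 < eps i" for i unfolding eps_def by simp
  \<comment> \<open>Clamping the time to [0,T] extends the solution to a continuous function on the
    real line with all values in the trap, as the compactness lemma requires.\<close>
  define w where "w i t = U (eps i) (max 0 (min T t))" for i t
  have w_trap: "w i t \<in> trap S p" for i t
    unfolding w_def by (rule U_trap[OF eps_pos]) (use \<open>0 < T\<close> in auto)
  have w_meas: "w i \<in> borel_measurable borel" for i
  proof (rule borel_measurable_continuous_onI)
    have "continuous_on {0..T} (U (eps i))"
      using sol[OF eps_pos[of i]] unfolding solves_ode_on_def continuous_on_eq_continuous_within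
      by (blast intro: has_vector_derivative_continuous)
    then show "continuous_on UNIV (w i)"
      unfolding w_def
      by (rule continuous_on_compose2[where f = "\<lambda>t. max 0 (min T t)"])
         (use \<open>0 < T\<close> in \<open>auto intro!: continuous_intros\<close>)
  qed
  obtain r \<mu> where r: "strict_mono (r :: nat \<Rightarrow> nat)"
    and \<mu>: "\<mu> \<in> borel \<rightarrow>\<^sub>M prob_algebra borel"
    and \<mu>_trap: "\<And>\<tau>. AE V in \<mu> \<tau>. V \<in> (trap S p :: 'm state set)"
    and conv: "\<And>(g :: 'm state \<Rightarrow> real) a b. continuous_on UNIV g \<Longrightarrow> 0 \<le> a \<Longrightarrow> a \<le> b \<Longrightarrow> b \<le> T \<Longrightarrow>
      (\<lambda>i. LINT \<tau>:{a<..b}|lborel. g (w (r i) \<tau>))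
        \<longlonglongrightarrow> (LINT \<tau>:{a<..b}|lborel. LINT V|\<mu> \<tau>. g V)"
    by (rule young_measure_compactness[of "trap S p" w T]) (use compact_trap w_meas w_trap in blast)+
  define e where "e i = eps (r i)" for i
  have e_pos: "0 < e i" for i unfolding e_def by (rule eps_pos)
  have e_lim: "e \<longlonglongrightarrow> 0"
    using LIMSEQ_subseq_LIMSEQ[OF LIMSEQ_inverse_real_of_nat r] unfolding e_def[abs_def] eps_def o_def .
  have prob_\<mu>: "prob_space (\<mu> \<tau>)" and sets_\<mu>: "sets (\<mu> \<tau>) = sets borel" for \<tau>
    using measurable_space[OF \<mu>, of \<tau>] by (auto simp: space_prob_algebra)
  have "\<mu> \<in> lborel \<rightarrow>\<^sub>M prob_algebra borel" using \<mu> by simp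
  then have ym: "young_measure T \<mu>"
    unfolding young_measure_def by (rule measurable_restrict_space1)
  have yt: "young_tendsto T (\<lambda>i. dirac_young (U (e i))) \<mu>"
    unfolding young_tendsto_def
  proof (intro allI impI, elim conjE)
    fix f :: "real \<times> 'm state \<Rightarrow> real" assume f: "continuous_on ({0..T} \<times> UNIV) f"
    have "(LINT \<tau>:{0..T}|lborel. LINT V|dirac_young (U (e i)) \<tau>. f (\<tau>, V)) =
        (LINT \<tau>:{0..T}|lborel. f (\<tau>, w (r i) \<tau>))" for i
    proof (rule set_lebesgue_integral_cong)
      show "\<forall>\<tau>. \<tau> \<in> {0..T} \<longrightarrow> (LINT V|dirac_young (U (e i)) \<tau>. f (\<tau>, V)) = f (\<tau>, w (r i) \<tau>)"
      proof (intro allI impI)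
        fix \<tau> assume \<tau>: "\<tau> \<in> {0..T}"
        have "continuous_on UNIV (\<lambda>V. f (\<tau>, V))"
          by (rule continuous_on_compose2[OF f]) (use \<tau> in \<open>auto intro!: continuous_intros\<close>)
        then have "(LINT V|dirac_young (U (e i)) \<tau>. f (\<tau>, V)) = f (\<tau>, U (e i) \<tau>)"
          unfolding dirac_young_def by (intro integral_return borel_measurable_continuous_onI) simp_all
        then show "(LINT V|dirac_young (U (e i)) \<tau>. f (\<tau>, V)) = f (\<tau>, w (r i) \<tau>)"
          using \<tau> by (simp add: w_def e_def)
      qed
    qed simp
    then show "(\<lambda>i. LINT \<tau>:{0..T}|lborel. LINT V|dirac_young (U (e i)) \<tau>. f (\<tau>, V))
        \<longlonglongrightarrow> (LINT \<tau>:{0..T}|lborel. LINT V|\<mu> \<tau>. f (\<tau>, V))"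
      using young_convergence_of_rectangles[OF \<open>0 < T\<close> compact_trap w_meas w_trap \<mu> \<mu>_trap conv f] by simp
  qed

  obtain \<E> :: "'m state set set" where \<E>: "countable \<E>"
    and det: "\<And>\<nu> \<nu>'. prob_space \<nu> \<Longrightarrow> prob_space \<nu>' \<Longrightarrow> sets \<nu> = sets borel \<Longrightarrow> sets \<nu>' = sets borel \<Longrightarrow>
      (\<And>B n. B \<in> \<E> \<Longrightarrow> (LINT x|\<nu>. bump B n x) = (LINT x|\<nu>'. bump B n x)) \<Longrightarrow> \<nu> = \<nu>'"
    using countable_determining_class by metis
  have bump_meas: "bump B n \<in> borel_measurable borel" for B :: "'m state set" and n
    by (rule borel_measurable_continuous_onI[OF continuous_on_bump])
  have kernel_meas: "(\<lambda>\<tau>. LINT V|\<mu> \<tau>. g V) \<in> borel_measurable borel"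
    if "g \<in> borel_measurable borel" for g :: "'m state \<Rightarrow> real"
    by (rule measurable_compose[OF measurable_prob_algebraD[OF \<mu>] integral_measurable_subprob_algebra[OF that]])
  have kernel_range: "0 \<le> (LINT V|\<mu> \<tau>. g V) \<and> (LINT V|\<mu> \<tau>. g V) \<le> 1"
    if "g \<in> borel_measurable borel" "\<And>V. 0 \<le> g V" "\<And>V. g V \<le> 1" for g :: "'m state \<Rightarrow> real" and \<tau>
  proof -
    interpret prob_space "\<mu> \<tau>" by (rule prob_\<mu>)
    have "integrable (\<mu> \<tau>) g"
      using that by (intro integrable_const_bound[where B = 1]) (auto simp: abs_of_nonneg measurable_cong_sets[OF sets_\<mu> refl])
    then show ?thesis using that by (auto intro!: integral_nonneg integral_le_const)
  qed
  have inv: "AE \<tau> in lborel. \<tau> \<in> {0..T} \<longrightarrow> (LINT V|\<mu> \<tau>. bump B n (fast_map \<sigma> V)) = (LINT V|\<mu> \<tau>. bump B n V)"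
    if \<sigma>: "0 \<le> \<sigma>" for B n \<sigma>
  proof (rule AE_eq_of_set_integral_Ioc[where B = 1])
    have fm: "(\<lambda>V. bump B n (fast_map \<sigma> V)) \<in> borel_measurable borel"
      by (rule measurable_compose[OF fast_map_measurable bump_meas])
    show "(\<lambda>\<tau>. LINT V|\<mu> \<tau>. bump B n (fast_map \<sigma> V)) \<in> borel_measurable borel"
      "(\<lambda>\<tau>. LINT V|\<mu> \<tau>. bump B n V) \<in> borel_measurable borel"
      by (rule kernel_meas[OF fm], rule kernel_meas[OF bump_meas])
    show "0 \<le> (LINT V|\<mu> \<tau>. bump B n (fast_map \<sigma> V)) \<and> (LINT V|\<mu> \<tau>. bump B n (fast_map \<sigma> V)) \<le> 1"
      "0 \<le> (LINT V|\<mu> \<tau>. bump B n V) \<and> (LINT V|\<mu> \<tau>. bump B n V) \<le> 1" for \<tau>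
      by (rule kernel_range; intro fm bump_meas bump_range)+
    fix a b :: real assume ab: "0 \<le> a" "a \<le> b" "b \<le> T"
    have trap_pos: "(trap S p :: 'm state set) \<subseteq> pos_orthant" by (rule trap_subset_pos_orthant[OF \<open>0 < p\<close>])
    \<comment> \<open>\<open>conv\<close> accepts only functions continuous on the whole space,
      whereas the flow is known to be continuous only on the orthant. By Tietze its composition with
      the \<open>bump\<close> function is extended from the compact trap; solutions and limit
      measures live there, so the integrals are unaffected.\<close>
    have "continuous_on (trap S p) (\<lambda>V. bump B n (fast_flow \<sigma> V))"
      by (rule continuous_on_compose2[OF continuous_on_bump[of UNIV] continuous_on_subset[OF continuous_on_fast_flow trap_pos]]) simp
    note cont = this
    have "closedin (top_of_set UNIV) (trap S p :: 'm state set)"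
      by (simp add: compact_imp_closed[OF compact_trap])
    then obtain \<psi> where "continuous_on UNIV \<psi>" "\<forall>V. V \<in> trap S p \<longrightarrow> \<psi> V = bump B n (fast_flow \<sigma> V)"
      by (rule Tietze[OF cont, of UNIV 1]) (simp_all add: bump_abs)
    then have \<psi>: "continuous_on UNIV \<psi>" "\<And>V. V \<in> trap S p \<Longrightarrow> \<psi> V = bump B n (fast_flow \<sigma> V)"
      by blast+
    define C where "C = real n * (2 * mesh TYPE('m) * (real CARD('m bit0) * (4 * S / (mesh TYPE('m))\<^sup>2))
      * exp ((2 * (real CARD('m bit0) * (4 * S)) + 1) * \<sigma>)) * T + 8 * mesh TYPE('m) * \<sigma>"
    let ?A = "\<lambda>i. LINT \<tau>:{a<..b}|lborel. \<psi> (w (r i) \<tau>)"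
    let ?B = "\<lambda>i. LINT \<tau>:{a<..b}|lborel. bump B n (w (r i) \<tau>)"
    have close: "\<bar>?A i - ?B i\<bar> \<le> C * e i" for i
      unfolding C_def
    proof (rule slow_average_almost_invariant[OF sol[OF e_pos] \<open>0 < T\<close> U_trap[OF e_pos] \<open>0 < p\<close> e_pos \<sigma>])
      show "w (r i) t = U (e i) (max 0 (min T t))" for t by (simp add: w_def e_def)
      show "\<bar>bump B n V - bump B n W\<bar> \<le> real n * norm (V - W)" for V W
        using bump_lipschitz[of B n V W] by (simp add: dist_norm)
    qed (use w_meas bump_meas bump_abs \<psi> ab in \<open>auto intro: borel_measurable_continuous_onI\<close>)
    have lim0: "(\<lambda>i. ?A i - ?B i) \<longlonglongrightarrow> 0"
    proof (rule Lim_null_comparison)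
      show "\<forall>\<^sub>F i in sequentially. norm (?A i - ?B i) \<le> C * e i"
        unfolding real_norm_def by (rule always_eventually) (rule allI, rule close)
      show "(\<lambda>i. C * e i) \<longlonglongrightarrow> 0" by (rule tendsto_mult_right_zero[OF e_lim])
    qed
    have "(\<lambda>i. ?A i - ?B i) \<longlonglongrightarrow> (LINT \<tau>:{a<..b}|lborel. LINT V|\<mu> \<tau>. \<psi> V) - (LINT \<tau>:{a<..b}|lborel. LINT V|\<mu> \<tau>. bump B n V)"
      by (rule tendsto_diff[OF conv[OF \<psi>(1) ab] conv[OF continuous_on_bump ab]])
    from LIMSEQ_unique[OF this lim0]
    have "(LINT \<tau>:{a<..b}|lborel. LINT V|\<mu> \<tau>. \<psi> V) = (LINT \<tau>:{a<..b}|lborel. LINT V|\<mu> \<tau>. bump B n V)"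
      by simp
    moreover have "(LINT V|\<mu> \<tau>. \<psi> V) = (LINT V|\<mu> \<tau>. bump B n (fast_map \<sigma> V))" for \<tau>
    proof (rule integral_cong_AE)
      show "AE V in \<mu> \<tau>. \<psi> V = bump B n (fast_map \<sigma> V)"
        using \<mu>_trap[of \<tau>] by eventually_elim (use trap_pos \<psi>(2) in \<open>auto simp: fast_map_def\<close>)
    qed (use fm borel_measurable_continuous_onI[OF \<psi>(1)] in \<open>auto simp: measurable_cong_sets[OF sets_\<mu> refl]\<close>)
    ultimately show "(LINT \<tau>:{a<..b}|lborel. LINT V|\<mu> \<tau>. bump B n (fast_map \<sigma> V)) =
        (LINT \<tau>:{a<..b}|lborel. LINT V|\<mu> \<tau>. bump B n V)" by simp
  qed
  have Q: "countable (\<rat> \<inter> {0..} :: real set)" by (intro countable_Int1 countable_rat)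
  have "AE \<tau> in lborel. \<forall>B\<in>\<E>. \<forall>n. \<forall>\<sigma>\<in>\<rat> \<inter> {0..}. \<tau> \<in> {0..T} \<longrightarrow>
      (LINT V|\<mu> \<tau>. bump B n (fast_map \<sigma> V)) = (LINT V|\<mu> \<tau>. bump B n V)"
    unfolding AE_ball_countable[OF \<E>] AE_all_countable AE_ball_countable[OF Q]
    using inv by (intro ballI allI) simp
  then have "AE \<tau>\<in>{0..T} in lborel. fast_invariant_measure (\<mu> \<tau>)"
  proof eventually_elim
    case (elim \<tau>)
    show ?case
    proof
      assume \<tau>: "\<tau> \<in> {0..T}"
      show "fast_invariant_measure (\<mu> \<tau>)"
      proof (rule fast_invariant_measureI[OF prob_\<mu> sets_\<mu> _ det])
        show "AE V in \<mu> \<tau>. V \<in> pos_orthant"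
          using \<mu>_trap[of \<tau>] by eventually_elim (use trap_subset_pos_orthant[OF \<open>0 < p\<close>] in auto)
      qed (use elim \<tau> in auto)
    qed
  qed
  then show ?thesis using e_pos e_lim ym yt by blast
qed

end
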